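(* Let $\mathbf{k}$ be a field and let $M$ be a finitely generated object of $\mathcal{A}_{\mathbf{k}}$. Then there exists $n\ge0$ such that the shift $\Sigma^n(M)\in\mathcal{A}_{\mathbf{k}(u_1,\ldots,u_n)}$ is semi-standard.
   Context: Let $\mathfrak{S}=\bigcup_{n\ge1}\mathfrak{S}_n$ be the infinite symmetric group (finitary permutations of $\{1,2,\ldots\}$), and $\mathfrak{S}^n\subset\mathfrak{S}$ the subgroup fixing each of $1,\ldots,n$. For a field $\mathbf{k}$ let $\mathbf{K}=\mathbf{K}(\mathbf{k})=\mathbf{k}(\xi_1,\xi_2,\ldots)$, on which $\mathfrak{S}$ acts by permuting the $\xi_i$ (and trivially on $\mathbf{k}$). $\mathcal{A}_{\mathbf{k}}$ is the category of smooth $\mathbf{K}$-semilinear representations of $\mathfrak{S}$: $\mathbf{K}$-vector spaces $M$ with an additive action of $\mathfrak{S}$ satisfying $\sigma(av)=(\sigma a)(\sigma v)$, such that every $v\in M$ is fixed by $\mathfrak{S}^m$ for some $m$. Morphisms are $\mathbf{K}$-linear $\mathfrak{S}$-equivariant maps. $M$ is finitely generated if it is the $\mathbf{K}$-span of the $\mathfrak{S}$-orbits of finitely many elements. $\mathbf{I}^r_{\mathbf{k}}=\mathbf{K}\otimes_{\mathbf{k}}\mathbf{V}^r$, where $\mathbf{V}^r$ is the $\mathbf{k}$-vector space with basis $\{e_S\}$ indexed by the $r$-element subsets $S$ of $\{1,2,\ldots\}$, permuted by $\mathfrak{S}$. An object of $\mathcal{A}_{\mathbf{k}}$ is standard if it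 is isomorphic to a direct sum of objects of the form $\mathbf{I}^r_{\mathbf{k}}$ ($r\ge0$ allowed to vary), and semi-standard if it admits a finite filtration whose graded pieces are standard. The same definitions apply over the field $\mathbf{k}(u_1,\ldots,u_n)$. The $n$th shift functor $\Sigma^n\colon\mathcal{A}_{\mathbf{k}}\to\mathcal{A}_{\mathbf{k}(u_1,\ldots,u_n)}$: the additive group of $\Sigma^n(M)$ is $M$; writing $x^{\flat}$ for $x\in M$ regarded in $\Sigma^n(M)$, the $\mathbf{K}(u_1,\ldots,u_n)$-vector space structure is determined by $u_i\cdot x^\flat=(\xi_ix)^\flat$ for $1\le i\le n$ and $\xi_i\cdot x^\flat=(\xi_{i+n}x)^\flat$ for $i\ge1$ (and $\mathbf{k}$ acts as before); and $\sigma\in\mathfrak{S}$ acts by $\sigma\cdot x^\flat=(\sigma^{\sharp}x)^\flat$, where $\sigma^\sharp(i)=i$ for $1\le i\le n$ and $\sigma^\sharp(i)=\sigma(i-n)+n$ for $i>n$. *)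

theory Defs
  imports
    "HOL-Algebra.Module"
    "HOL-Algebra.AbelCoset"
    "HOL-Library.Poly_Mapping"
    "HOL-Computational_Algebra.Fraction_Field"
    "HOL-Combinatorics.Perm"
begin

text \<open>
  Variables and the points permuted by the infinite symmetric group are indexed by
  \<open>0, 1, 2, \<dots>\<close> instead of \<open>1, 2, 3, \<dots>\<close>. The infinite symmetric group is the type
  \<^typ>\<open>nat perm\<close> of finitary permutations.
\<close>

notation Perm.apply (infixl \<open>\<langle>$\<rangle>\<close> 999)


section \<open>Rational functions in the variables \<open>\<xi> i\<close>\<close>

type_synonym 'a poly_xi = "(nat \<Rightarrow>\<^sub>0 nat) \<Rightarrow>\<^sub>0 'a"
type_synonym 'a ratfun = "'a poly_xi fract"

definition ratfun_const :: "'a::field \<Rightarrow> 'a ratfun"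
  where "ratfun_const c = Fract (Poly_Mapping.single 0 c) 1"

definition xi :: "nat \<Rightarrow> 'a::field ratfun"
  where "xi i = Fract (Poly_Mapping.single (Poly_Mapping.single i 1) 1) 1"

definition polys :: "'a::field set \<Rightarrow> nat set \<Rightarrow> 'a poly_xi set"
  where "polys F I = {p. \<forall>m \<in> Poly_Mapping.keys p.
           Poly_Mapping.lookup p m \<in> F \<and> Poly_Mapping.keys m \<subseteq> I}"

text \<open>If \<open>F\<close> is a subfield, this is the field \<open>F(\<xi> i | i \<in> I)\<close>.\<close>

definition ratfuns :: "'a::field set \<Rightarrow> nat set \<Rightarrow> 'a ratfun set"
  where "ratfuns F I = {Fract p q | p q. p \<in> polys F I \<and> q \<in> polys F I \<and> q \<noteq> 0}"

text \<open>
  The field over which everything is defined is a subfield \<open>F\<close> of a type, because the field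
  \<open>k(u\<^sub>1,\<dots>,u\<^sub>n)\<close> depends on \<open>n\<close>: it is realised as the subfield
  \<^term>\<open>ratfuns UNIV {..<n}\<close> of the type \<open>'k ratfun\<close>, with \<^term>\<open>xi i\<close> for
  \<open>i < n\<close> in the role of \<open>u\<^sub>i\<^sub>+\<^sub>1\<close>. The field \<open>k\<close> itself is \<^term>\<open>UNIV\<close>.
\<close>

definition ratfun_field :: "'f::field set \<Rightarrow> 'f ratfun ring"
  where "ratfun_field F = \<lparr>carrier = ratfuns F UNIV, mult = (*), one = 1, zero = 0, add = (+)\<rparr>"

text \<open>
  Substitution of \<open>v i\<close> for \<open>\<xi> i\<close> in a polynomial or rational function, the coefficients being
  transported along \<open>\<phi>\<close>. When \<open>\<phi>\<close> is a ring homomorphism, the value on a rational function does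
  not depend on the fraction \<open>p/q\<close> chosen; it is unspecified if every denominator vanishes, which
  does not happen in the two uses below.
\<close>

definition poly_subst :: "('a::field \<Rightarrow> 'b::field) \<Rightarrow> (nat \<Rightarrow> 'b) \<Rightarrow> 'a poly_xi \<Rightarrow> 'b"
  where "poly_subst \<phi> v p = (\<Sum>m \<in> Poly_Mapping.keys p.
           \<phi> (Poly_Mapping.lookup p m) * (\<Prod>i \<in> Poly_Mapping.keys m. v i ^ Poly_Mapping.lookup m i))"

definition ratfun_subst :: "('a::field \<Rightarrow> 'b::field) \<Rightarrow> (nat \<Rightarrow> 'b) \<Rightarrow> 'a ratfun \<Rightarrow> 'b"
  where "ratfun_subst \<phi> v f = (THE y. \<exists>p q. q \<noteq> 0 \<and> f = Fract p q \<and>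
           poly_subst \<phi> v q \<noteq> 0 \<and> y = poly_subst \<phi> v p / poly_subst \<phi> v q)"

definition perm_ratfun :: "nat perm \<Rightarrow> 'f::field ratfun \<Rightarrow> 'f ratfun"
  where "perm_ratfun \<sigma> = ratfun_subst ratfun_const (\<lambda>i. xi (\<sigma> \<langle>$\<rangle> i))"


section \<open>Smooth semilinear representations\<close>

text \<open>
  As for modules in the library, the multiplicative part of the underlying ring record
  is never used.
\<close>

record ('a, 'm) semirep = "('a, 'm) module" +
  act :: "nat perm \<Rightarrow> 'm \<Rightarrow> 'm"

locale smooth_semilinear_rep = module "ratfun_field F" M
  for F :: "'f::field set" and M :: "('f ratfun, 'm, 'z) semirep_scheme" +
  assumes act_closed: "x \<in> carrier M \<Longrightarrow> act M \<sigma> x \<in> carrier M"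
    and act_one: "x \<in> carrier M \<Longrightarrow> act M 1 x = x"
    and act_mult: "x \<in> carrier M \<Longrightarrow> act M (\<sigma> * \<tau>) x = act M \<sigma> (act M \<tau> x)"
    and act_add: "x \<in> carrier M \<Longrightarrow> y \<in> carrier M \<Longrightarrow>
      act M \<sigma> (x \<oplus>\<^bsub>M\<^esub> y) = act M \<sigma> x \<oplus>\<^bsub>M\<^esub> act M \<sigma> y"
    and act_smult: "a \<in> carrier (ratfun_field F) \<Longrightarrow> x \<in> carrier M \<Longrightarrow>
      act M \<sigma> (a \<odot>\<^bsub>M\<^esub> x) = perm_ratfun \<sigma> a \<odot>\<^bsub>M\<^esub> act M \<sigma> x"
    and smooth: "x \<in> carrier M \<Longrightarrow>
      \<exists>m. \<forall>\<sigma>. (\<forall>i<m. \<sigma> \<langle>$\<rangle> i = i) \<longrightarrow> act M \<sigma> x = x"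

definition rep_hom ::
  "'f::field set \<Rightarrow> ('f ratfun, 'm, 'y) semirep_scheme \<Rightarrow> ('f ratfun, 'n, 'z) semirep_scheme \<Rightarrow> ('m \<Rightarrow> 'n) set"
  where "rep_hom F M N = {h \<in> carrier M \<rightarrow> carrier N.
    (\<forall>x \<in> carrier M. \<forall>y \<in> carrier M. h (x \<oplus>\<^bsub>M\<^esub> y) = h x \<oplus>\<^bsub>N\<^esub> h y) \<and>
    (\<forall>a \<in> carrier (ratfun_field F). \<forall>x \<in> carrier M. h (a \<odot>\<^bsub>M\<^esub> x) = a \<odot>\<^bsub>N\<^esub> h x) \<and>
    (\<forall>\<sigma>. \<forall>x \<in> carrier M. h (act M \<sigma> x) = act N \<sigma> (h x))}"

definition rep_iso ::
  "'f::field set \<Rightarrow> ('f ratfun, 'm, 'y) semirep_scheme \<Rightarrow> ('f ratfun, 'n, 'z) semirep_scheme \<Rightarrow> bool"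
  where "rep_iso F M N \<longleftrightarrow> (\<exists>h \<in> rep_hom F M N. bij_betw h (carrier M) (carrier N))"

definition K_span :: "'f::field set \<Rightarrow> ('f ratfun, 'm, 'z) semirep_scheme \<Rightarrow> 'm set \<Rightarrow> 'm set"
  where "K_span F M X = \<Inter>{N. submodule N (ratfun_field F) M \<and> X \<subseteq> N}"

definition finitely_generated :: "'f::field set \<Rightarrow> ('f ratfun, 'm, 'z) semirep_scheme \<Rightarrow> bool"
  where "finitely_generated F M \<longleftrightarrow> (\<exists>X. finite X \<and> X \<subseteq> carrier M \<and>
    carrier M = K_span F M {act M \<sigma> x | \<sigma> x. x \<in> X})"

definition subrep :: "'f::field set \<Rightarrow> 'm set \<Rightarrow> ('f ratfun, 'm, 'z) semirep_scheme \<Rightarrow> bool"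
  where "subrep F N M \<longleftrightarrow> submodule N (ratfun_field F) M \<and> (\<forall>\<sigma>. \<forall>x \<in> N. act M \<sigma> x \<in> N)"

definition quot_rep :: "('a, 'm, 'z) semirep_scheme \<Rightarrow> 'm set \<Rightarrow> ('a, 'm set) semirep"
  where "quot_rep M N = \<lparr>carrier = a_rcosets\<^bsub>M\<^esub> N, mult = undefined, one = undefined,
    zero = N, add = set_add M,
    smult = (\<lambda>a X. \<Union>x \<in> X. N +>\<^bsub>M\<^esub> (a \<odot>\<^bsub>M\<^esub> x)),
    act = (\<lambda>\<sigma> X. \<Union>x \<in> X. N +>\<^bsub>M\<^esub> act M \<sigma> x)\<rparr>"

definition direct_sum :: "'j set \<Rightarrow> ('j \<Rightarrow> ('a, 'm, 'z) semirep_scheme) \<Rightarrow> ('a, 'j \<Rightarrow> 'm) semirep"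
  where "direct_sum J N = \<lparr>
    carrier = {x \<in> \<Pi>\<^sub>E j\<in>J. carrier (N j). finite {j \<in> J. x j \<noteq> \<zero>\<^bsub>N j\<^esub>}},
    mult = undefined, one = undefined,
    zero = (\<lambda>j\<in>J. \<zero>\<^bsub>N j\<^esub>),
    add = (\<lambda>x y. \<lambda>j\<in>J. x j \<oplus>\<^bsub>N j\<^esub> y j),
    smult = (\<lambda>a x. \<lambda>j\<in>J. a \<odot>\<^bsub>N j\<^esub> x j),
    act = (\<lambda>\<sigma> x. \<lambda>j\<in>J. act (N j) \<sigma> (x j))\<rparr>"


section \<open>Standard and semi-standard objects\<close>

text \<open>
  \<open>F(\<xi>) \<otimes>\<^sub>F V\<^sup>r\<close>, where \<open>V\<^sup>r\<close> has basis \<open>e\<^sub>S\<close> for \<open>S\<close> an \<open>r\<close>-element set: the element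
  \<open>a \<otimes> e\<^sub>S\<close> is \<^term>\<open>Poly_Mapping.single S a\<close>.
\<close>

definition std_rep :: "'f::field set \<Rightarrow> nat \<Rightarrow> ('f ratfun, nat set \<Rightarrow>\<^sub>0 'f ratfun) semirep"
  where "std_rep F r = \<lparr>
    carrier = {x. \<forall>S \<in> Poly_Mapping.keys x.
      finite S \<and> card S = r \<and> Poly_Mapping.lookup x S \<in> carrier (ratfun_field F)},
    mult = undefined, one = undefined, zero = 0, add = (+),
    smult = (\<lambda>a. Poly_Mapping.map ((*) a)),
    act = (\<lambda>\<sigma> x. \<Sum>S \<in> Poly_Mapping.keys x.
      Poly_Mapping.single ((\<langle>$\<rangle>) \<sigma> ` S) (perm_ratfun \<sigma> (Poly_Mapping.lookup x S)))\<rparr>"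

text \<open>
  The index set \<open>J\<close> of the direct sum may be arbitrary. Taking it inside the type \<open>'m\<close> is no
  restriction: every \<^term>\<open>std_rep F r\<close> is nonzero, so choosing a nonzero element in each summand
  embeds \<open>J\<close> in \<open>M\<close>.
\<close>

definition standard :: "'f::field set \<Rightarrow> ('f ratfun, 'm, 'z) semirep_scheme \<Rightarrow> bool"
  where "standard F M \<longleftrightarrow> smooth_semilinear_rep F M \<and>
    (\<exists>(J :: 'm set) r. rep_iso F M (direct_sum J (\<lambda>j. std_rep F (r j))))"

definition semi_standard :: "'f::field set \<Rightarrow> ('f ratfun, 'm, 'z) semirep_scheme \<Rightarrow> bool"
  where "semi_standard F M \<longleftrightarrow> smooth_semilinear_rep F M \<and>
    (\<exists>(s::nat) N. N 0 = {\<zero>\<^bsub>M\<^esub>} \<and> N s = carrier M \<and> (\<forall>i\<le>s. subrep F (N i) M) \<and>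
      (\<forall>i<s. N i \<subseteq> N (Suc i) \<and>
        standard F (quot_rep (M\<lparr>carrier := N (Suc i)\<rparr>) (N i))))"


section \<open>The shift functor\<close>

lift_definition shift_perm :: "nat \<Rightarrow> nat perm \<Rightarrow> nat perm"
  is "\<lambda>n \<sigma> i. if i < n then i else \<sigma> (i - n) + n"
proof -
  fix n :: nat and \<sigma> :: "nat \<Rightarrow> nat"
  let ?f = "\<lambda>i. if i < n then i else \<sigma> (i - n) + n"
  assume \<sigma>: "bij \<sigma> \<and> finite {i. \<sigma> i \<noteq> i}"
  have "inj ?f"
  proof (rule injI)
    fix i j assume "?f i = ?f j"
    then show "i = j"
      using \<sigma> by (auto split: if_splits dest!: bij_is_inj injD)
  qed
  moreover have "i \<in> Set.range ?f" for i
  proof (cases "i < n")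
    case True
    then show ?thesis by (intro image_eqI[of _ _ i]) auto
  next
    case False
    obtain j where "\<sigma> j = i - n" using \<sigma> by (metis bij_pointE)
    with False show ?thesis by (intro image_eqI[of _ _ "j + n"]) auto
  qed
  moreover
  have "{i. ?f i \<noteq> i} \<subseteq> (\<lambda>i. i + n) ` {i. \<sigma> i \<noteq> i}"
  proof
    fix i assume "i \<in> {i. ?f i \<noteq> i}"
    then have "\<sigma> (i - n) \<noteq> i - n" "i = (i - n) + n" by (auto split: if_splits)
    then show "i \<in> (\<lambda>i. i + n) ` {i. \<sigma> i \<noteq> i}" by blast
  qed
  then have "finite {i. ?f i \<noteq> i}"
    using \<sigma> by (meson finite_imageI finite_subset)
  ultimately show "bij ?f \<and> finite {i. ?f i \<noteq> i}"
    by (auto simp only: bij_def surj_def image_iff)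
qed

text \<open>
  The homomorphism \<open>k(u\<^sub>1,\<dots>,u\<^sub>n)(\<xi>) \<rightarrow> k(\<xi>)\<close> over \<open>k\<close> through which scalars act
  on the shift. On coefficients it is the identity, as \<open>u\<^sub>i\<^sub>+\<^sub>1\<close> is already represented
  by \<^term>\<open>xi i\<close>.
\<close>

definition shift_scalar :: "nat \<Rightarrow> 'k::field ratfun ratfun \<Rightarrow> 'k ratfun"
  where "shift_scalar n = ratfun_subst id (\<lambda>i. xi (i + n))"

definition shift :: "nat \<Rightarrow> ('k::field ratfun, 'm, 'z) semirep_scheme \<Rightarrow> ('k ratfun ratfun, 'm) semirep"
  where "shift n M = \<lparr>carrier = carrier M, mult = undefined, one = undefined,
    zero = zero M, add = add M,
    smult = (\<lambda>a x. shift_scalar n a \<odot>\<^bsub>M\<^esub> x),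
    act = (\<lambda>\<sigma>. act M (shift_perm n \<sigma>))\<rparr>"

end

theory Submission
  imports
    Defs
    "HOL.Vector_Spaces"
    "HOL-Combinatorics.Permutations"
begin

text \<open>
  Shifting by \<open>n\<close> amounts to restricting the action on \<open>M\<close> to the permutations that fix
  \<open>0, \<dots>, n - 1\<close>, so all levels can be compared inside \<open>M\<close>. By Galois descent for a finite symmetric
  group, \<open>M\<close> is spanned by finitely many equivariant families \<open>(b\<^sub>j\<^sub>,\<^sub>S)\<close> indexed by
  \<open>d\<close>-element sets, that is, \<open>M\<close> is a quotient of a standard object. At level \<open>n\<close> each family
  splits according to the intersection of \<open>S\<close> with \<open>{..<n}\<close>. If the families of largest size
  \<open>r\<close> are linearly independent modulo the span of the smaller ones, they form a standard quotient,
  and one continues with the smaller ones. Otherwise take a nontrivial relation and a set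
  \<open>S\<^sub>0\<close> occurring in it: after increasing \<open>n\<close> and applying a permutation, every other set in the
  relation meets \<open>{..<n}\<close> and so belongs to a smaller family; hence one family of size \<open>r\<close> has
  become superfluous.
\<close>


section \<open>Substitution in rational functions\<close>

text \<open>The scalars of a shift map isomorphically onto \<open>k(\<xi>)\<close>, so span and
  independence mean the same at every level and only the acting group shrinks. No chain condition is
  used; termination is a count. A label of size \<open>r\<close> refines to itself and to labels of
  smaller size only, so refinement creates no new family of the largest size, while each nontrivial
  relation removes one. Descent is needed because smoothness makes a generator invariant only under
  the permutations fixing \<open>{..<d}\<close> pointwise, whereas a family indexed by sets rather
  than tuples requires invariance under the setwise stabiliser; the missing finite group acts
  faithfully on the first \<open>d\<close> variables, so traces can make up for it. Equivariance of
  families holds only modulo a stable subspace \<open>A\<^sub>0\<close>, because \<open>M\<close> is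
  presented as a quotient of a free vector space.\<close>

lemma poly_mapping_single_add_induct:
  assumes "P 0" "\<And>m c. P (Poly_Mapping.single m c)" "\<And>p q. P p \<Longrightarrow> P q \<Longrightarrow> P (p + q)"
  shows "P (p :: 'a \<Rightarrow>\<^sub>0 'b::comm_monoid_add)"
proof -
  have "P (\<Sum>m\<in>X. Poly_Mapping.single m (Poly_Mapping.lookup p m))" if "finite X" for X
    using that by induction (auto intro: assms)
  moreover have "p = (\<Sum>m\<in>Poly_Mapping.keys p. Poly_Mapping.single m (Poly_Mapping.lookup p m))"
    by (rule poly_mapping_eqI)
      (auto simp: lookup_sum lookup_single when_def not_in_keys_iff_lookup_eq_zero)
  ultimately show ?thesis by (metis finite_keys)
qed

definition monom_subst :: "(nat \<Rightarrow> 'b::comm_semiring_1) \<Rightarrow> (nat \<Rightarrow>\<^sub>0 nat) \<Rightarrow> 'b"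
  where "monom_subst v m = (\<Prod>i \<in> Poly_Mapping.keys m. v i ^ Poly_Mapping.lookup m i)"

lemma monom_subst_eq:
  assumes "finite X" "Poly_Mapping.keys m \<subseteq> X"
  shows "monom_subst v m = (\<Prod>i\<in>X. v i ^ Poly_Mapping.lookup m i)"
  unfolding monom_subst_def
  by (rule prod.mono_neutral_left[OF assms]) (auto simp: not_in_keys_iff_lookup_eq_zero)

lemma monom_subst_0 [simp]: "monom_subst v 0 = 1"
  by (simp add: monom_subst_def)

lemma monom_subst_single [simp]: "monom_subst v (Poly_Mapping.single i k) = v i ^ k"
  by (simp add: monom_subst_def)

lemma monom_subst_add: "monom_subst v (m + m') = monom_subst v m * monom_subst v m'"
proof -
  let ?X = "Poly_Mapping.keys m \<union> Poly_Mapping.keys m'"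
  have "Poly_Mapping.keys (m + m') \<subseteq> ?X" by (rule keys_add)
  then show ?thesis
    by (subst (1 2 3) monom_subst_eq[of ?X])
      (auto simp: lookup_add power_add prod.distrib)
qed

lemma monom_subst_cong:
  "(\<And>i. i \<in> Poly_Mapping.keys m \<Longrightarrow> v i = w i) \<Longrightarrow> monom_subst v m = monom_subst w m"
  by (simp add: monom_subst_def)

lemma poly_subst_monom:
  "poly_subst \<phi> v p = (\<Sum>m \<in> Poly_Mapping.keys p. \<phi> (Poly_Mapping.lookup p m) * monom_subst v m)"
  by (simp add: poly_subst_def monom_subst_def)

locale field_hom =
  fixes \<phi> :: "'a::field \<Rightarrow> 'b::field"
  assumes hom_add: "\<phi> (x + y) = \<phi> x + \<phi> y"
    and hom_mult: "\<phi> (x * y) = \<phi> x * \<phi> y"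
    and hom_one: "\<phi> 1 = 1"
begin

lemma hom_zero: "\<phi> 0 = 0"
  by (metis hom_add add_0 add_right_cancel)

lemma poly_subst_eq:
  assumes "finite X" "Poly_Mapping.keys p \<subseteq> X"
  shows "poly_subst \<phi> v p = (\<Sum>m\<in>X. \<phi> (Poly_Mapping.lookup p m) * monom_subst v m)"
  unfolding poly_subst_monom
  by (rule sum.mono_neutral_left[OF assms]) (auto simp: not_in_keys_iff_lookup_eq_zero hom_zero)

lemma poly_subst_zero: "poly_subst \<phi> v 0 = 0"
  by (simp add: poly_subst_def)

lemma poly_subst_single:
  "poly_subst \<phi> v (Poly_Mapping.single m c) = \<phi> c * monom_subst v m"
  by (simp add: poly_subst_eq[of "{m}"])

lemma poly_subst_add: "poly_subst \<phi> v (p + q) = poly_subst \<phi> v p + poly_subst \<phi> v q"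
proof -
  let ?X = "Poly_Mapping.keys p \<union> Poly_Mapping.keys q"
  have "Poly_Mapping.keys (p + q) \<subseteq> ?X" by (rule keys_add)
  then show ?thesis
    by (subst (1 2 3) poly_subst_eq[of ?X])
      (auto simp: lookup_add hom_add distrib_right sum.distrib)
qed

lemma poly_subst_sum: "poly_subst \<phi> v (sum f X) = (\<Sum>x\<in>X. poly_subst \<phi> v (f x))"
  by (induction X rule: infinite_finite_induct) (simp_all add: poly_subst_zero poly_subst_add)

lemma poly_subst_mult: "poly_subst \<phi> v (p * q) = poly_subst \<phi> v p * poly_subst \<phi> v q"
proof (induction p rule: poly_mapping_single_add_induct)
  case (2 m c)
  show ?case
  proof (induction q rule: poly_mapping_single_add_induct)
    case (2 m' c')
    then show ?case
      by (simp add: mult_single poly_subst_single hom_mult monom_subst_add)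
  qed (simp_all add: poly_subst_zero poly_subst_add distrib_left)
qed (simp_all add: poly_subst_zero poly_subst_add distrib_right)

lemma poly_subst_one: "poly_subst \<phi> v 1 = 1"
  using poly_subst_single[of v 0 1] by (simp add: hom_one)

lemma poly_subst_uminus: "poly_subst \<phi> v (- p) = - poly_subst \<phi> v p"
  using poly_subst_add[of v p "- p"] by (simp add: poly_subst_zero eq_neg_iff_add_eq_0 add.commute)

text \<open>Two fractions for the same function satisfy \<open>p * q' = p' * q\<close>. Substitution
  preserves this equation, and both substituted denominators are nonzero, so the description
  operator has exactly one candidate.\<close>

lemma ratfun_subst_Fract:
  assumes "q \<noteq> 0" "poly_subst \<phi> v q \<noteq> 0"
  shows "ratfun_subst \<phi> v (Fract p q) = poly_subst \<phi> v p / poly_subst \<phi> v q"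
  unfolding ratfun_subst_def
proof (rule the_equality)
  show "\<exists>p' q'. q' \<noteq> 0 \<and> Fract p q = Fract p' q' \<and> poly_subst \<phi> v q' \<noteq> 0 \<and>
      poly_subst \<phi> v p / poly_subst \<phi> v q = poly_subst \<phi> v p' / poly_subst \<phi> v q'"
    using assms by blast
next
  fix y assume "\<exists>p' q'. q' \<noteq> 0 \<and> Fract p q = Fract p' q' \<and> poly_subst \<phi> v q' \<noteq> 0 \<and>
      y = poly_subst \<phi> v p' / poly_subst \<phi> v q'"
  then obtain p' q' where *: "q' \<noteq> 0" "Fract p q = Fract p' q'" "poly_subst \<phi> v q' \<noteq> 0"
    and y: "y = poly_subst \<phi> v p' / poly_subst \<phi> v q'" by blast
  then have "p * q' = p' * q" using assms eq_fract by blast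
  then have "poly_subst \<phi> v p * poly_subst \<phi> v q' = poly_subst \<phi> v p' * poly_subst \<phi> v q"
    by (metis poly_subst_mult)
  then show "y = poly_subst \<phi> v p / poly_subst \<phi> v q"
    using * assms y by (simp add: frac_eq_eq)
qed

end

section \<open>Polynomials and fractions with coefficients in a subset of a type\<close>

locale subring_of =
  fixes F :: "'a::comm_ring_1 set"
  assumes zero: "0 \<in> F" and one: "1 \<in> F"
    and add: "x \<in> F \<Longrightarrow> y \<in> F \<Longrightarrow> x + y \<in> F"
    and mult: "x \<in> F \<Longrightarrow> y \<in> F \<Longrightarrow> x * y \<in> F"
    and uminus: "x \<in> F \<Longrightarrow> - x \<in> F"
begin

lemma sum_closed: "(\<And>x. x \<in> X \<Longrightarrow> f x \<in> F) \<Longrightarrow> sum f X \<in> F"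
  by (induction X rule: infinite_finite_induct) (auto intro: zero add)

end

lemma subring_of_UNIV: "subring_of UNIV"
  by (rule subring_of.intro) simp_all

lemma single_in_polys: "c \<in> F \<Longrightarrow> Poly_Mapping.keys m \<subseteq> I \<Longrightarrow> Poly_Mapping.single m c \<in> polys F I"
  by (auto simp: polys_def)

lemma polys_iff:
  assumes "0 \<in> F"
  shows "p \<in> polys F I \<longleftrightarrow> (\<forall>m. Poly_Mapping.lookup p m \<in> F) \<and>
    (\<forall>m\<in>Poly_Mapping.keys p. Poly_Mapping.keys m \<subseteq> I)"
  unfolding polys_def using assms by (auto simp: in_keys_iff)

lemma polys_subring:
  fixes F :: "'a::field set"
  assumes "subring_of F"
  shows "subring_of (polys F I)"
proof -
  interpret F: subring_of F by fact
  note iff = polys_iff[OF F.zero]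
  have plus: "p + q \<in> polys F I" if "p \<in> polys F I" "q \<in> polys F I" for p q
    using that keys_add[of p q] by (auto simp: iff lookup_add F.add subset_iff)
  have sum: "(\<And>x. x \<in> X \<Longrightarrow> f x \<in> polys F I) \<Longrightarrow> sum f X \<in> polys F I" for f :: "'x \<Rightarrow> _" and X
  proof (induction X rule: infinite_finite_induct)
    case (insert x X)
    then show ?case by (simp add: plus)
  qed (simp_all add: polys_def)
  have expand: "p = (\<Sum>m\<in>Poly_Mapping.keys p. Poly_Mapping.single m (Poly_Mapping.lookup p m))"
    for p :: "'a poly_xi"
    by (rule poly_mapping_eqI)
      (auto simp: lookup_sum lookup_single when_def not_in_keys_iff_lookup_eq_zero)
  have times: "p * q \<in> polys F I" if p: "p \<in> polys F I" and q: "q \<in> polys F I" for p q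
  proof -
    have "p * q = (\<Sum>m\<in>Poly_Mapping.keys p. \<Sum>m'\<in>Poly_Mapping.keys q.
        Poly_Mapping.single (m + m') (Poly_Mapping.lookup p m * Poly_Mapping.lookup q m'))"
      by (subst expand[of p], subst expand[of q]) (simp add: sum_product mult_single)
    moreover have "Poly_Mapping.single (m + m') (Poly_Mapping.lookup p m * Poly_Mapping.lookup q m') \<in> polys F I"
      if "m \<in> Poly_Mapping.keys p" "m' \<in> Poly_Mapping.keys q" for m m'
      using that p q keys_add[of m m']
      by (intro single_in_polys F.mult) (auto simp: polys_def subset_iff)
    ultimately show ?thesis by (auto intro!: sum)
  qed
  show ?thesis
  proof
    show "0 \<in> polys F I" by (simp add: polys_def)
    show "1 \<in> polys F I"
      using single_in_polys[of 1 F 0 I] by (simp add: F.one)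
    show "- p \<in> polys F I" if "p \<in> polys F I" for p
      using that by (auto simp: polys_def F.uminus)
  qed (fact plus times)+
qed

lemma ratfuns_cases:
  assumes "a \<in> ratfuns F I"
  obtains p q where "p \<in> polys F I" "q \<in> polys F I" "q \<noteq> 0" "a = Fract p q"
  using assms by (auto simp: ratfuns_def)

lemma ratfuns_Fract: "p \<in> polys F I \<Longrightarrow> q \<in> polys F I \<Longrightarrow> q \<noteq> 0 \<Longrightarrow> Fract p q \<in> ratfuns F I"
  by (auto simp: ratfuns_def)

lemma ratfuns_subring:
  fixes F :: "'a::field set"
  assumes "subring_of F"
  shows "subring_of (ratfuns F I)"
proof -
  interpret P: subring_of "polys F I" using assms by (rule polys_subring)
  show ?thesis
  proof
    show "0 \<in> ratfuns F I" "1 \<in> ratfuns F I"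
      using ratfuns_Fract[OF P.zero P.one] ratfuns_Fract[OF P.one P.one]
      by (simp_all add: fract_collapse)
    show "x + y \<in> ratfuns F I" if "x \<in> ratfuns F I" "y \<in> ratfuns F I" for x y
      using that by (auto elim!: ratfuns_cases intro!: ratfuns_Fract P.add P.mult)
    show "x * y \<in> ratfuns F I" if "x \<in> ratfuns F I" "y \<in> ratfuns F I" for x y
      using that by (auto elim!: ratfuns_cases intro!: ratfuns_Fract P.mult)
    show "- x \<in> ratfuns F I" if "x \<in> ratfuns F I" for x
      using that by (auto elim!: ratfuns_cases intro!: ratfuns_Fract P.uminus)
  qed
qed

lemma ratfuns_inverse:
  fixes F :: "'a::field set"
  assumes F: "subring_of F" and "a \<in> ratfuns F I"
  shows "inverse a \<in> ratfuns F I"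
proof -
  obtain p q where "p \<in> polys F I" "q \<in> polys F I" "q \<noteq> 0" "a = Fract p q"
    using assms(2) by (rule ratfuns_cases)
  then show ?thesis
    using subring_of.zero[OF ratfuns_subring[OF F, of I]]
    by (cases "p = 0") (auto simp: fract_collapse intro!: ratfuns_Fract)
qed

lemma ratfuns_UNIV: "ratfuns UNIV UNIV = UNIV"
  unfolding ratfuns_def polys_def by (auto intro: Fract_cases)

text \<open>The assumption \<open>nonvanishing\<close> says that the values \<open>v i\<close> are
  algebraically independent over the image of \<open>F\<close>. Restricting it to coefficients in
  \<open>F\<close> is essential for the shift: with all coefficients allowed, the first variable
  minus the constant \<open>xi n\<close> is a nonzero polynomial that vanishes under the
  substitution. Hence the laws below hold on \<open>ratfuns F UNIV\<close> and carry membership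
  hypotheses.\<close>

locale ratfun_hom = field_hom \<phi> + F: subring_of F
  for \<phi> :: "'a::field \<Rightarrow> 'b::field" and v :: "nat \<Rightarrow> 'b" and F :: "'a set" +
  assumes nonvanishing: "q \<in> polys F UNIV \<Longrightarrow> q \<noteq> 0 \<Longrightarrow> poly_subst \<phi> v q \<noteq> 0"
begin

abbreviation "h \<equiv> ratfun_subst \<phi> v"

sublocale P: subring_of "polys F UNIV" by (rule polys_subring) (rule F.subring_of_axioms)
sublocale R: subring_of "ratfuns F UNIV" by (rule ratfuns_subring) (rule F.subring_of_axioms)

lemma subst_Fract:
  "q \<in> polys F UNIV \<Longrightarrow> q \<noteq> 0 \<Longrightarrow> h (Fract p q) = poly_subst \<phi> v p / poly_subst \<phi> v q"
  by (rule ratfun_subst_Fract) (auto dest: nonvanishing)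

lemma subst_poly: "h (Fract p 1) = poly_subst \<phi> v p"
  by (simp add: subst_Fract[OF P.one] poly_subst_one)

lemma subst_add:
  assumes "a \<in> ratfuns F UNIV" "b \<in> ratfuns F UNIV"
  shows "h (a + b) = h a + h b"
proof -
  obtain p q where a: "q \<in> polys F UNIV" "q \<noteq> 0" "a = Fract p q"
    using assms(1) by (auto elim!: ratfuns_cases)
  obtain p' q' where b: "q' \<in> polys F UNIV" "q' \<noteq> 0" "b = Fract p' q'"
    using assms(2) by (auto elim!: ratfuns_cases)
  show ?thesis
    using a b nonvanishing[of q] nonvanishing[of q']
    by (simp add: subst_Fract P.mult poly_subst_add poly_subst_mult add_frac_eq)
qed

lemma subst_mult:
  "a \<in> ratfuns F UNIV \<Longrightarrow> b \<in> ratfuns F UNIV \<Longrightarrow> h (a * b) = h a * h b"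
  by (auto elim!: ratfuns_cases simp: subst_Fract P.mult poly_subst_mult)

lemma subst_uminus: "a \<in> ratfuns F UNIV \<Longrightarrow> h (- a) = - h a"
  by (auto elim!: ratfuns_cases simp: subst_Fract poly_subst_uminus)

lemma subst_zero: "h 0 = 0"
  using subst_poly[of 0] by (simp add: fract_collapse poly_subst_zero)

lemma subst_one: "h 1 = 1"
  using subst_poly[of 1] by (simp add: fract_collapse poly_subst_one)

lemma subst_inverse: "a \<in> ratfuns F UNIV \<Longrightarrow> h (inverse a) = inverse (h a)"
proof (elim ratfuns_cases)
  fix p q assume *: "p \<in> polys F UNIV" "q \<in> polys F UNIV" "q \<noteq> 0" "a = Fract p q"
  then show "h (inverse a) = inverse (h a)"
    by (cases "p = 0") (auto simp: subst_Fract fract_collapse subst_zero)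
qed

lemma subst_eq_0_iff:
  assumes "a \<in> ratfuns F UNIV"
  shows "h a = 0 \<longleftrightarrow> a = 0"
proof -
  obtain p q where a: "p \<in> polys F UNIV" "q \<in> polys F UNIV" "q \<noteq> 0" "a = Fract p q"
    using assms by (rule ratfuns_cases)
  show ?thesis
  proof (cases "p = 0")
    case True
    then show ?thesis using a by (simp add: fract_collapse subst_zero)
  next
    case False
    then show ?thesis
      using a nonvanishing[of q] nonvanishing[of p]
      by (simp add: subst_Fract eq_fract Zero_fract_def)
  qed
qed

lemma inj_on_subst: "inj_on h (ratfuns F UNIV)"
proof (rule inj_onI)
  fix a b assume ab: "a \<in> ratfuns F UNIV" "b \<in> ratfuns F UNIV" "h a = h b"
  have "h (a + - b) = 0" using ab by (simp add: subst_add subst_uminus R.uminus del: add_uminus_conv_diff)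
  then show "a = b" using ab subst_eq_0_iff[of "a + - b"] R.add[OF ab(1) R.uminus[OF ab(2)]] by simp
qed

lemma subst_const: "h (ratfun_const c) = \<phi> c"
  by (simp add: ratfun_const_def subst_poly poly_subst_single)

lemma subst_xi: "h (xi i) = v i"
  by (simp add: xi_def subst_poly poly_subst_single hom_one)

end

lemma ring_hom_ratfun_const: "field_hom ratfun_const"
  by unfold_locales
    (simp_all add: ratfun_const_def single_add mult_single fract_collapse)

lemma ring_hom_id: "field_hom id"
  by unfold_locales simp_all

section \<open>Renaming variables\<close>

lemma xi_power: "xi i ^ k = Fract (Poly_Mapping.single (Poly_Mapping.single i k) 1) 1"
  by (induction k) (simp_all add: fract_collapse xi_def mult_single flip: single_add)

lemma prod_Fract: "(\<Prod>i\<in>X. Fract (f i) 1) = Fract (prod f X) 1"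
  by (induction X rule: infinite_finite_induct) (simp_all add: fract_collapse)

lemma sum_Fract: "D \<noteq> 0 \<Longrightarrow> (\<Sum>i\<in>X. Fract (f i) D) = Fract (sum f X) D"
  by (induction X rule: infinite_finite_induct)
    (simp_all add: fract_collapse, simp add: eq_fract algebra_simps)

lemma prod_single:
  "(\<Prod>i\<in>X. Poly_Mapping.single (f i) (1::'a::comm_semiring_1)) = Poly_Mapping.single (\<Sum>i\<in>X. f i) 1"
  by (induction X rule: infinite_finite_induct) (simp_all add: mult_single)

definition rename_monom :: "(nat \<Rightarrow> nat) \<Rightarrow> (nat \<Rightarrow>\<^sub>0 nat) \<Rightarrow> (nat \<Rightarrow>\<^sub>0 nat)"
  where "rename_monom \<rho> m = (\<Sum>i\<in>Poly_Mapping.keys m. Poly_Mapping.single (\<rho> i) (Poly_Mapping.lookup m i))"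

lemma monom_subst_xi:
  "monom_subst (\<lambda>i. xi (\<rho> i)) m = Fract (Poly_Mapping.single (rename_monom \<rho> m) 1) 1"
  by (simp add: monom_subst_def xi_power prod_Fract prod_single rename_monom_def)

lemma lookup_rename_monom:
  assumes "inj \<rho>"
  shows "Poly_Mapping.lookup (rename_monom \<rho> m) (\<rho> i) = Poly_Mapping.lookup m i"
  using assms
  by (auto simp: rename_monom_def lookup_sum lookup_single when_def inj_eq
      not_in_keys_iff_lookup_eq_zero)

lemma keys_rename_monom: "Poly_Mapping.keys (rename_monom \<rho> m) \<subseteq> \<rho> ` Poly_Mapping.keys m"
  unfolding rename_monom_def
  by (rule order.trans[OF keys_sum]) (auto split: if_splits)

lemma inj_rename_monom: "inj \<rho> \<Longrightarrow> inj (rename_monom \<rho>)"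
  by (rule injI, rule poly_mapping_eqI) (metis lookup_rename_monom)

definition rename_poly :: "(nat \<Rightarrow> nat) \<Rightarrow> 'a::field poly_xi \<Rightarrow> 'a poly_xi"
  where "rename_poly \<rho> p =
    (\<Sum>m\<in>Poly_Mapping.keys p. Poly_Mapping.single (rename_monom \<rho> m) (Poly_Mapping.lookup p m))"

text \<open>Substituting variables for variables yields a polynomial again. For a permutation,
  \<open>nonvanishing\<close> therefore reduces to the injectivity of
  \<open>rename_poly\<close>.\<close>

lemma poly_subst_xi:
  "poly_subst ratfun_const (\<lambda>i. xi (\<rho> i)) p = Fract (rename_poly \<rho> p) 1"
  by (simp add: poly_subst_monom monom_subst_xi ratfun_const_def mult_single sum_Fract rename_poly_def)

lemma lookup_rename_poly:
  assumes "inj \<rho>"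
  shows "Poly_Mapping.lookup (rename_poly \<rho> p) (rename_monom \<rho> m) = Poly_Mapping.lookup p m"
  using inj_rename_monom[OF assms]
  by (auto simp: rename_poly_def lookup_sum lookup_single when_def inj_eq
      not_in_keys_iff_lookup_eq_zero)

lemma rename_poly_eq_0:
  assumes "inj \<rho>" "rename_poly \<rho> p = 0"
  shows "p = 0"
  by (rule poly_mapping_eqI) (metis assms lookup_rename_poly lookup_zero)

lemma rename_poly_in_polys:
  assumes "subring_of F" "p \<in> polys F UNIV"
  shows "rename_poly \<rho> p \<in> polys F UNIV"
proof -
  interpret subring_of "polys F UNIV" using assms(1) by (rule polys_subring)
  show ?thesis
    unfolding rename_poly_def
    by (intro sum_closed single_in_polys) (use assms(2) in \<open>auto simp: polys_def\<close>)
qed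

lemma Fract_one_eq_0_iff: "Fract p 1 = 0 \<longleftrightarrow> p = 0"
  by (simp add: Zero_fract_def eq_fract)

interpretation perm_hom: ratfun_hom ratfun_const "\<lambda>i. xi (\<sigma> \<langle>$\<rangle> i)" UNIV
  rewrites "ratfun_subst ratfun_const (\<lambda>i. xi (\<sigma> \<langle>$\<rangle> i)) \<equiv> perm_ratfun \<sigma>"
    and "ratfuns UNIV UNIV = UNIV"
  for \<sigma>
proof -
  interpret field_hom ratfun_const by (rule ring_hom_ratfun_const)
  have "inj ((\<langle>$\<rangle>) \<sigma>)" by (simp add: bij_is_inj)
  then show "ratfun_hom ratfun_const (\<lambda>i. xi (\<sigma> \<langle>$\<rangle> i)) UNIV"
    by unfold_locales
      (auto simp: poly_subst_xi Fract_one_eq_0_iff dest: rename_poly_eq_0)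
qed (simp_all add: perm_ratfun_def[abs_def] ratfuns_UNIV)


section \<open>The action of permutations on rational functions\<close>

lemma perm_ratfun_add: "perm_ratfun \<sigma> (a + b) = perm_ratfun \<sigma> a + perm_ratfun \<sigma> b"
  and perm_ratfun_mult: "perm_ratfun \<sigma> (a * b) = perm_ratfun \<sigma> a * perm_ratfun \<sigma> b"
  and perm_ratfun_inverse: "perm_ratfun \<sigma> (inverse a) = inverse (perm_ratfun \<sigma> a)"
  and perm_ratfun_zero: "perm_ratfun \<sigma> 0 = 0"
  and perm_ratfun_one: "perm_ratfun \<sigma> 1 = 1"
  and perm_ratfun_eq_0_iff: "perm_ratfun \<sigma> a = 0 \<longleftrightarrow> a = 0"
  and perm_ratfun_const: "perm_ratfun \<sigma> (ratfun_const c) = ratfun_const c"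
  and perm_ratfun_xi: "perm_ratfun \<sigma> (xi i) = xi (\<sigma> \<langle>$\<rangle> i)"
  by (simp_all add: perm_hom.subst_add perm_hom.subst_mult
      perm_hom.subst_inverse perm_hom.subst_zero perm_hom.subst_one perm_hom.subst_eq_0_iff
      perm_hom.subst_const perm_hom.subst_xi)

lemma perm_ratfun_Fract:
  assumes "q \<noteq> 0"
  shows "perm_ratfun \<sigma> (Fract p q) = Fract (rename_poly ((\<langle>$\<rangle>) \<sigma>) p) (rename_poly ((\<langle>$\<rangle>) \<sigma>) q)"
  using assms by (simp add: perm_hom.subst_Fract polys_def poly_subst_xi)

lemma perm_ratfun_closed:
  assumes "subring_of F" "a \<in> ratfuns F UNIV"
  shows "perm_ratfun \<sigma> a \<in> ratfuns F UNIV"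
proof -
  have "inj ((\<langle>$\<rangle>) \<sigma>)" by (simp add: bij_is_inj)
  then show ?thesis
    using assms by (auto elim!: ratfuns_cases simp: perm_ratfun_Fract
        intro!: ratfuns_Fract rename_poly_in_polys dest: rename_poly_eq_0)
qed

lemma (in field_hom) hom_sum: "\<phi> (sum f X) = (\<Sum>x\<in>X. \<phi> (f x))"
  by (induction X rule: infinite_finite_induct) (simp_all add: hom_zero hom_add)

lemma (in field_hom) hom_power: "\<phi> (x ^ k) = \<phi> x ^ k"
  by (induction k) (simp_all add: hom_one hom_mult)

lemma (in field_hom) hom_monom_subst: "\<phi> (monom_subst v m) = monom_subst (\<lambda>i. \<phi> (v i)) m"
proof -
  have "\<phi> (prod f X) = (\<Prod>x\<in>X. \<phi> (f x))" for f :: "nat \<Rightarrow> 'a" and X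
    by (induction X rule: infinite_finite_induct) (simp_all add: hom_one hom_mult)
  then show ?thesis by (simp add: monom_subst_def hom_power)
qed

lemma (in field_hom) hom_poly_subst:
  "\<phi> (poly_subst \<psi> v p) = poly_subst (\<lambda>c. \<phi> (\<psi> c)) (\<lambda>i. \<phi> (v i)) p"
  by (simp add: poly_subst_monom hom_sum hom_mult hom_monom_subst)

lemma (in field_hom) hom_inverse: "\<phi> (inverse x) = inverse (\<phi> x)"
proof (cases "x = 0")
  case False
  then have "\<phi> x * \<phi> (inverse x) = 1" by (simp flip: hom_mult add: hom_one)
  then show ?thesis by (metis inverse_unique)
qed (simp add: hom_zero)

lemma rename_monom_id: "rename_monom (\<lambda>i. i) m = m"
  by (rule poly_mapping_eqI) (use lookup_rename_monom[of "\<lambda>i. i" m] in simp)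

lemma Fract_eq_poly_subst: "Fract p 1 = poly_subst ratfun_const xi p"
proof -
  have "rename_poly (\<lambda>i. i) p = p"
    using lookup_rename_poly[of "\<lambda>i. i" p] by (auto intro!: poly_mapping_eqI simp: rename_monom_id)
  then show ?thesis using poly_subst_xi[of "\<lambda>i. i" p] by simp
qed

lemma Fract_eq_divide: "Fract p q = Fract p 1 * inverse (Fract q 1)"
  by simp

text \<open>Constants and variables generate the field of rational functions. The group action laws
  for \<open>perm_ratfun\<close> follow from this without any computation with renamed
  polynomials.\<close>

lemma ratfun_hom_eqI:
  fixes f g :: "'a::field ratfun \<Rightarrow> 'b::field"
  assumes "field_hom f" "field_hom g"
    and "\<And>c. f (ratfun_const c) = g (ratfun_const c)" "\<And>i. f (xi i) = g (xi i)"
  shows "f a = g a"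
proof -
  interpret f: field_hom f by fact
  interpret g: field_hom g by fact
  have "f (Fract p 1) = g (Fract p 1)" for p
    by (simp add: Fract_eq_poly_subst f.hom_poly_subst g.hom_poly_subst assms(3,4))
  moreover obtain p q where "a = Fract p q" by (cases a)
  ultimately show ?thesis
    by (simp only: Fract_eq_divide[of p q] f.hom_mult g.hom_mult f.hom_inverse g.hom_inverse)
qed

lemma ring_hom_perm_ratfun: "field_hom (perm_ratfun \<sigma>)"
  by unfold_locales (simp_all add: perm_ratfun_add perm_ratfun_mult perm_ratfun_one)

lemma perm_ratfun_1: "perm_ratfun 1 a = a"
proof -
  have "perm_ratfun 1 a = id a"
    by (rule ratfun_hom_eqI[OF ring_hom_perm_ratfun ring_hom_id])
      (simp_all add: perm_ratfun_const perm_ratfun_xi)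
  then show ?thesis by simp
qed

lemma perm_ratfun_times: "perm_ratfun (\<sigma> * \<tau>) a = perm_ratfun \<sigma> (perm_ratfun \<tau> a)"
proof -
  have "field_hom (\<lambda>a. perm_ratfun \<sigma> (perm_ratfun \<tau> a))"
    by unfold_locales (simp_all add: perm_ratfun_add perm_ratfun_mult perm_ratfun_one)
  then show ?thesis
    by (rule ratfun_hom_eqI[OF ring_hom_perm_ratfun])
      (simp_all add: perm_ratfun_const perm_ratfun_xi apply_times)
qed

lemma xi_eq_iff: "(xi i :: 'a::field ratfun) = xi j \<longleftrightarrow> i = j"
proof
  assume "(xi i :: 'a ratfun) = xi j"
  then have "Poly_Mapping.single (Poly_Mapping.single i (1::nat)) (1::'a) =
      Poly_Mapping.single (Poly_Mapping.single j 1) 1"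
    by (simp add: xi_def eq_fract)
  then have "Poly_Mapping.keys (Poly_Mapping.single (Poly_Mapping.single i (1::nat)) (1::'a)) =
      Poly_Mapping.keys (Poly_Mapping.single (Poly_Mapping.single j (1::nat)) (1::'a))" by simp
  then have "Poly_Mapping.keys (Poly_Mapping.single i (1::nat)) = Poly_Mapping.keys (Poly_Mapping.single j (1::nat))"
    by simp
  then show "i = j" by simp
qed simp

lemma ratfuns_const: "subring_of F \<Longrightarrow> c \<in> F \<Longrightarrow> ratfun_const c \<in> ratfuns F I"
  unfolding ratfun_const_def
  by (intro ratfuns_Fract single_in_polys subring_of.one[OF polys_subring]) simp_all

lemma ratfuns_xi:
  assumes "subring_of F" "i \<in> I"
  shows "xi i \<in> ratfuns F I"
  unfolding xi_def
  by (intro ratfuns_Fract single_in_polys subring_of.one[OF polys_subring] subring_of.one[OF assms(1)] assms(1))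
    (use assms(2) in simp_all)

text \<open>Applied with \<open>I = {..<n}\<close>, this says that the coefficients
  \<open>k(u)\<close> of the shift are constants for the permutations
  \<open>shift_perm n \<sigma>\<close>.\<close>

lemma perm_ratfun_fixes:
  fixes a :: "'a::field ratfun"
  assumes "a \<in> ratfuns UNIV I" "\<And>i. i \<in> I \<Longrightarrow> \<sigma> \<langle>$\<rangle> i = i"
  shows "perm_ratfun \<sigma> a = a"
proof -
  obtain p q where pq: "p \<in> polys UNIV I" "q \<in> polys UNIV I" "q \<noteq> 0" "a = Fract p q"
    using assms(1) by (rule ratfuns_cases)
  have "perm_ratfun \<sigma> (Fract p 1) = Fract p 1" if "p \<in> polys UNIV I" for p :: "'a poly_xi"
  proof -
    have "(monom_subst (\<lambda>i. xi (\<sigma> \<langle>$\<rangle> i)) m :: 'a ratfun) = monom_subst xi m" if "m \<in> Poly_Mapping.keys p" for m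
    proof (rule monom_subst_cong)
      fix i assume "i \<in> Poly_Mapping.keys m"
      then have "i \<in> I" using \<open>p \<in> _\<close> that by (auto simp: polys_def)
      then show "(xi (\<sigma> \<langle>$\<rangle> i) :: 'a ratfun) = xi i" by (simp add: assms(2))
    qed
    then show ?thesis
      by (subst perm_hom.subst_poly)
        (auto simp: Fract_eq_poly_subst poly_subst_monom intro!: sum.cong)
  qed
  then show ?thesis
    using pq by (simp add: Fract_eq_divide[of p q] perm_ratfun_mult perm_ratfun_inverse
        del: mult_fract inverse_fract)
qed


section \<open>The scalars of the shift\<close>

lemma common_denominator:
  fixes F :: "'a::field set"
  assumes F: "subring_of F" and "finite C" "C \<subseteq> ratfuns F I"
  shows "\<exists>D\<in>polys F I. D \<noteq> 0 \<and> (\<forall>c\<in>C. \<exists>p\<in>polys F I. c = Fract p D)"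
  using assms(2,3)
proof (induction C)
  case empty
  show ?case using subring_of.one[OF polys_subring[OF F, of I]] by (intro bexI[of _ 1]) simp_all
next
  case (insert c C)
  interpret P: subring_of "polys F I" using F by (rule polys_subring)
  obtain D where D: "D \<in> polys F I" "D \<noteq> 0" "\<forall>c\<in>C. \<exists>p\<in>polys F I. c = Fract p D"
    using insert by auto
  obtain p q where pq: "p \<in> polys F I" "q \<in> polys F I" "q \<noteq> 0" "c = Fract p q"
    using insert by (auto elim: ratfuns_cases)
  show ?case
  proof (rule bexI[of _ "q * D"], intro conjI ballI)
    show "q * D \<in> polys F I" "q * D \<noteq> 0" using pq D by (auto intro: P.mult)
    fix x assume "x \<in> insert c C"
    then consider "x = c" | p' where "p' \<in> polys F I" "x = Fract p' D" using D(3) by auto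
    then show "\<exists>p\<in>polys F I. x = Fract p (q * D)"
    proof cases
      case 1
      then show ?thesis using pq D
        by (intro bexI[of _ "p * D"]) (auto simp: eq_fract intro: P.mult)
    next
      case 2
      then show ?thesis using pq D
        by (intro bexI[of _ "q * p'"]) (auto simp: eq_fract algebra_simps intro: P.mult)
    qed
  qed
qed

lemma lookup_mult_single:
  fixes p :: "'a::comm_ring_1 poly_xi"
  shows "Poly_Mapping.lookup (p * Poly_Mapping.single r c) (k + r) = Poly_Mapping.lookup p k * c"
  by (induction p rule: poly_mapping_single_add_induct)
    (auto simp: mult_single distrib_right lookup_add lookup_single when_def)

lemma keys_mult_single: "Poly_Mapping.keys (p * Poly_Mapping.single r c) \<subseteq> (\<lambda>k. k + r) ` Poly_Mapping.keys p"
  using keys_mult[of p "Poly_Mapping.single r c"] by (auto split: if_splits)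

lemma monom_split_unique:
  fixes k k' r r' :: "nat \<Rightarrow>\<^sub>0 nat"
  assumes "k + r = k' + r'" "Poly_Mapping.keys k \<subseteq> {..<n}" "Poly_Mapping.keys k' \<subseteq> {..<n}"
    "Poly_Mapping.keys r \<subseteq> {n..}" "Poly_Mapping.keys r' \<subseteq> {n..}"
  shows "k = k'" "r = r'"
proof -
  have "Poly_Mapping.lookup k i = Poly_Mapping.lookup k' i" for i
  proof (cases "i < n")
    case True
    then have "Poly_Mapping.lookup r i = 0" "Poly_Mapping.lookup r' i = 0"
      using assms(4,5) by (auto simp: in_keys_iff subset_iff)
    then show ?thesis using assms(1) by (metis add.right_neutral lookup_add)
  next
    case False
    then have "i \<notin> Poly_Mapping.keys k" "i \<notin> Poly_Mapping.keys k'"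
      using assms(2,3) by auto
    then show ?thesis by (simp add: in_keys_iff)
  qed
  then show "k = k'" by (rule poly_mapping_eqI)
  then show "r = r'" using assms(1) by simp
qed

text \<open>After clearing denominators the claim is that the monomials in \<open>\<xi> i\<close>, \<open>i < n\<close>, and
  those in \<open>\<xi> i\<close>, \<open>i \<ge> n\<close>, have distinct products.\<close>

lemma shift_nonvanishing:
  fixes q :: "'a::field ratfun poly_xi"
  assumes q: "q \<in> polys (ratfuns UNIV {..<n}) UNIV" "q \<noteq> 0"
  shows "poly_subst id (\<lambda>i. xi (i + n)) q \<noteq> 0"
proof -
  have inj: "inj (\<lambda>i. i + n)" by (simp add: inj_def)
  let ?r = "rename_monom (\<lambda>i. i + n)"
  have "Poly_Mapping.lookup q ` Poly_Mapping.keys q \<subseteq> ratfuns UNIV {..<n}"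
    using q by (auto simp: polys_def)
  from common_denominator[OF subring_of_UNIV _ this]
  obtain D where D: "D \<noteq> 0"
    "\<And>m. m \<in> Poly_Mapping.keys q \<Longrightarrow> \<exists>p\<in>polys UNIV {..<n}. Poly_Mapping.lookup q m = Fract p D"
    by auto
  then obtain p where p: "\<And>m. m \<in> Poly_Mapping.keys q \<Longrightarrow> p m \<in> polys UNIV {..<n}"
    "\<And>m. m \<in> Poly_Mapping.keys q \<Longrightarrow> Poly_Mapping.lookup q m = Fract (p m) D" by metis
  define Q where "Q = (\<Sum>m\<in>Poly_Mapping.keys q. p m * Poly_Mapping.single (?r m) 1)"
  have "poly_subst id (\<lambda>i. xi (i + n)) q = Fract Q D"
    using p(2) D(1) by (simp add: poly_subst_monom monom_subst_xi sum_Fract Q_def)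
  moreover have "Q \<noteq> 0"
  proof -
    \<comment> \<open>The monomial \<open>m1 + ?r m0\<close> detects that \<open>Q\<close> is
      nonzero: \<open>m1\<close> involves only variables below \<open>n\<close> and
      \<open>?r m0\<close> only the others, so a product containing this monomial must come from the
      summand \<open>m0\<close>.\<close>
    obtain m0 where m0: "m0 \<in> Poly_Mapping.keys q"
      using q(2) by (metis keys_eq_empty ex_in_conv poly_mapping_eqI lookup_zero in_keys_iff)
    then have "Fract (p m0) D \<noteq> 0" using p(2) by (metis in_keys_iff)
    then have "p m0 \<noteq> 0" by (auto simp: fract_collapse)
    then obtain m1 where m1: "m1 \<in> Poly_Mapping.keys (p m0)"
      by (metis poly_mapping_eqI lookup_zero in_keys_iff)
    have sub: "Poly_Mapping.keys (?r m) \<subseteq> {n..}" for m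
      using keys_rename_monom[of "\<lambda>i. i + n" m] by auto
    have small: "Poly_Mapping.keys k \<subseteq> {..<n}"
      if "m \<in> Poly_Mapping.keys q" "k \<in> Poly_Mapping.keys (p m)" for m k
      using p(1)[OF that(1)] that(2) by (auto simp: polys_def)
    have "Poly_Mapping.lookup (p m * Poly_Mapping.single (?r m) 1) (m1 + ?r m0) = 0"
      if m: "m \<in> Poly_Mapping.keys q" "m \<noteq> m0" for m
    proof (rule ccontr)
      assume "Poly_Mapping.lookup (p m * Poly_Mapping.single (?r m) 1) (m1 + ?r m0) \<noteq> 0"
      then obtain k where k: "k \<in> Poly_Mapping.keys (p m)" "m1 + ?r m0 = k + ?r m"
        using keys_mult_single[of "p m" "?r m" 1] by (auto simp: in_keys_iff[symmetric])
      have "?r m0 = ?r m"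
        by (rule monom_split_unique(2)[OF k(2)])
          (use small[OF m0 m1] small[OF m(1) k(1)] sub in auto)
      then show False using m(2) inj_rename_monom[OF inj] by (simp add: inj_eq)
    qed
    then have "(\<Sum>m\<in>Poly_Mapping.keys q.
        Poly_Mapping.lookup (p m * Poly_Mapping.single (?r m) 1) (m1 + ?r m0)) = Poly_Mapping.lookup (p m0) m1"
      by (subst sum.remove[OF _ m0]) (simp_all add: lookup_mult_single)
    then have "Poly_Mapping.lookup Q (m1 + ?r m0) = Poly_Mapping.lookup (p m0) m1"
      by (simp add: Q_def lookup_sum)
    then show ?thesis using m1 by (auto simp: in_keys_iff)
  qed
  ultimately show ?thesis using D(1) by (simp add: Zero_fract_def eq_fract)
qed

lemma subring_coeff: "subring_of (ratfuns UNIV I)"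
  by (rule ratfuns_subring[OF subring_of_UNIV])

interpretation shift_hom: ratfun_hom id "\<lambda>i. xi (i + n)" "ratfuns UNIV {..<n}"
  rewrites "ratfun_subst id (\<lambda>i. xi (i + n)) = shift_scalar n"
  for n
proof -
  interpret field_hom id by (rule ring_hom_id)
  interpret subring_of "ratfuns UNIV {..<n}" by (rule subring_coeff)
  show "ratfun_hom id (\<lambda>i. xi (i + n)) (ratfuns UNIV {..<n})"
    by unfold_locales (rule shift_nonvanishing)
qed (simp add: shift_scalar_def)

text \<open>The image is closed under the field operations and contains all generators:
  \<open>xi i\<close> comes from a coefficient if \<open>i < n\<close> and from the variable
  \<open>xi (i - n)\<close> otherwise. Together with \<open>inj_on_subst\<close> this identifies the
  scalars of the shift with those of \<open>M\<close>, so that subspaces over the two fields are the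
  same.\<close>

lemma shift_scalar_surj:
  fixes b :: "'a::field ratfun"
  shows "\<exists>a\<in>ratfuns (ratfuns UNIV {..<n}) UNIV. shift_scalar n a = b"
proof -
  let ?F = "ratfuns (UNIV::'a set) {..<n}"
  let ?R = "ratfuns ?F UNIV"
  let ?S = "shift_scalar n ` ?R"
  have F: "subring_of ?F" by (rule subring_coeff)
  have S: "subring_of ?S"
  proof
    show "0 \<in> ?S" by (rule image_eqI[of _ _ 0]) (simp_all add: shift_hom.subst_zero shift_hom.R.zero)
    show "1 \<in> ?S" by (rule image_eqI[of _ _ 1]) (simp_all add: shift_hom.subst_one shift_hom.R.one)
    show "x + y \<in> ?S" if "x \<in> ?S" "y \<in> ?S" for x y
      using that by (auto simp flip: shift_hom.subst_add intro!: imageI shift_hom.R.add)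
    show "x * y \<in> ?S" if "x \<in> ?S" "y \<in> ?S" for x y
      using that by (auto simp flip: shift_hom.subst_mult intro!: imageI shift_hom.R.mult)
    show "- x \<in> ?S" if "x \<in> ?S" for x
      using that by (auto simp flip: shift_hom.subst_uminus intro!: imageI shift_hom.R.uminus)
  qed
  interpret S: subring_of ?S by (rule S)
  have inverse: "inverse x \<in> ?S" if "x \<in> ?S" for x
    using that by (auto simp flip: shift_hom.subst_inverse intro!: imageI ratfuns_inverse F)
  have xi: "xi i \<in> ?S" for i
  proof (cases "i < n")
    case True
    then have "shift_scalar n (ratfun_const (xi i)) = xi i" by (simp add: shift_hom.subst_const)
    moreover have "ratfun_const (xi i) \<in> ?R"
      using True by (intro ratfuns_const F ratfuns_xi subring_of_UNIV) auto
    ultimately show ?thesis by (metis imageI)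
  next
    case False
    then have "shift_scalar n (xi (i - n)) = xi i" by (simp add: shift_hom.subst_xi)
    then show ?thesis using ratfuns_xi[OF F, of "i - n" UNIV] by (metis UNIV_I imageI)
  qed
  have const: "ratfun_const c \<in> ?S" for c
  proof -
    have "shift_scalar n (ratfun_const (ratfun_const c)) = ratfun_const c"
      by (simp add: shift_hom.subst_const)
    then show ?thesis
      using ratfuns_const[OF F ratfuns_const[OF subring_of_UNIV], of c UNIV] by (metis UNIV_I imageI)
  qed
  have power: "x ^ k \<in> ?S" if "x \<in> ?S" for x k
    using that by (induction k) (auto intro: S.one S.mult)
  have prod: "(\<And>i. i \<in> X \<Longrightarrow> f i \<in> ?S) \<Longrightarrow> prod f X \<in> ?S" for f and X :: "nat set"
    by (induction X rule: infinite_finite_induct) (auto intro: S.one S.mult)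
  have poly: "Fract p 1 \<in> ?S" for p :: "'a poly_xi"
    unfolding Fract_eq_poly_subst poly_subst_monom monom_subst_def
    by (intro S.sum_closed S.mult const prod power xi)
  obtain p q where "b = Fract p q" by (cases b)
  then have "b = Fract p 1 * inverse (Fract q 1)" by simp
  then have "b \<in> ?S" by (simp only: S.mult inverse poly)
  then show ?thesis by auto
qed

lemma shift_perm_apply: "shift_perm n \<sigma> \<langle>$\<rangle> i = (if i < n then i else \<sigma> \<langle>$\<rangle> (i - n) + n)"
  by transfer simp

lemma shift_perm_1: "shift_perm n 1 = 1"
  by (rule perm_eqI) (simp add: shift_perm_apply)

lemma shift_perm_times: "shift_perm n (\<sigma> * \<tau>) = shift_perm n \<sigma> * shift_perm n \<tau>"
  by (rule perm_eqI) (simp add: shift_perm_apply apply_times)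

text \<open>The shifted permutation fixes the coefficients and sends \<open>xi (i + n)\<close> to
  \<open>xi (\<sigma> \<langle>$\<rangle> i + n)\<close>. Since \<open>shift_scalar\<close> is
  controlled only on \<open>ratfuns (ratfuns UNIV {..<n}) UNIV\<close>, the comparison of
  homomorphisms on generators does not apply, and numerator and denominator are compared directly.
  The result is the semilinearity of the action on the shift.\<close>

lemma shift_scalar_perm:
  assumes "a \<in> ratfuns (ratfuns UNIV {..<n}) UNIV"
  shows "shift_scalar n (perm_ratfun \<sigma> a) = perm_ratfun (shift_perm n \<sigma>) (shift_scalar n a)"
proof -
  let ?F = "ratfuns (UNIV::'a set) {..<n}"
  let ?\<sigma> = "shift_perm n \<sigma>"
  interpret hom: field_hom "perm_ratfun ?\<sigma>" by (rule ring_hom_perm_ratfun)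
  have F: "subring_of ?F" by (rule subring_coeff)
  have inj: "inj ((\<langle>$\<rangle>) \<sigma>)" by (simp add: bij_is_inj)
  have coeff: "perm_ratfun ?\<sigma> c = c" if "c \<in> ?F" for c :: "'a ratfun"
    using that by (rule perm_ratfun_fixes) (simp add: shift_perm_apply)
  have poly: "poly_subst id (\<lambda>i. xi (i + n)) (rename_poly ((\<langle>$\<rangle>) \<sigma>) p) =
      perm_ratfun ?\<sigma> (poly_subst id (\<lambda>i. xi (i + n)) p)" if p: "p \<in> polys ?F UNIV" for p
  proof -
    have ren: "monom_subst (\<lambda>i. xi (i + n)) (rename_monom ((\<langle>$\<rangle>) \<sigma>) m) =
        monom_subst (\<lambda>i. xi (\<sigma> \<langle>$\<rangle> i + n)) m" for m
    proof -
      have "monom_subst (\<lambda>i. xi (i + n)) (rename_monom ((\<langle>$\<rangle>) \<sigma>) m) =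
          (\<Prod>i\<in>(\<langle>$\<rangle>) \<sigma> ` Poly_Mapping.keys m. xi (i + n) ^ Poly_Mapping.lookup (rename_monom ((\<langle>$\<rangle>) \<sigma>) m) i)"
        by (rule monom_subst_eq) (auto simp: keys_rename_monom)
      also have "\<dots> = monom_subst (\<lambda>i. xi (\<sigma> \<langle>$\<rangle> i + n)) m"
        using inj by (simp add: prod.reindex inj_on_def apply_inj lookup_rename_monom monom_subst_def)
      finally show ?thesis .
    qed
    have "poly_subst id (\<lambda>i. xi (i + n)) (rename_poly ((\<langle>$\<rangle>) \<sigma>) p) =
        (\<Sum>m\<in>Poly_Mapping.keys p. Poly_Mapping.lookup p m * monom_subst (\<lambda>i. xi (\<sigma> \<langle>$\<rangle> i + n)) m)"
      by (simp add: rename_poly_def shift_hom.poly_subst_sum shift_hom.poly_subst_single ren)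
    also have "\<dots> = (\<Sum>m\<in>Poly_Mapping.keys p.
        perm_ratfun ?\<sigma> (Poly_Mapping.lookup p m) * monom_subst (\<lambda>i. perm_ratfun ?\<sigma> (xi (i + n))) m)"
      using p by (intro sum.cong) (auto simp: coeff polys_def perm_ratfun_xi shift_perm_apply)
    also have "\<dots> = perm_ratfun ?\<sigma> (poly_subst id (\<lambda>i. xi (i + n)) p)"
      by (simp add: poly_subst_monom hom.hom_sum hom.hom_mult hom.hom_monom_subst)
    finally show ?thesis .
  qed
  obtain p q where pq: "p \<in> polys ?F UNIV" "q \<in> polys ?F UNIV" "q \<noteq> 0" "a = Fract p q"
    using assms by (rule ratfuns_cases)
  then have q': "rename_poly ((\<langle>$\<rangle>) \<sigma>) q \<noteq> 0" using inj by (auto dest: rename_poly_eq_0)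
  show ?thesis
    using pq q'
    by (simp add: perm_ratfun_Fract shift_hom.subst_Fract rename_poly_in_polys[OF F] poly
        divide_inverse hom.hom_mult hom.hom_inverse)
qed


section \<open>Finitary permutations\<close>

definition fix_below :: "nat \<Rightarrow> nat perm set"
  where "fix_below n = {\<sigma>. \<forall>i<n. \<sigma> \<langle>$\<rangle> i = i}"

lemma inverse_apply [simp]: "inverse \<sigma> \<langle>$\<rangle> (\<sigma> \<langle>$\<rangle> i) = i" "\<sigma> \<langle>$\<rangle> (inverse \<sigma> \<langle>$\<rangle> i) = i"
  by (simp_all add: apply_sequence)

lemma fix_below_antimono: "n \<le> m \<Longrightarrow> fix_below m \<subseteq> fix_below n"
  by (auto simp: fix_below_def)

lemma fix_below_image:
  assumes "\<sigma> \<in> fix_below n"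
  shows "U \<subseteq> {..<n} \<Longrightarrow> (\<langle>$\<rangle>) \<sigma> ` U = U" "S \<subseteq> {n..} \<Longrightarrow> (\<langle>$\<rangle>) \<sigma> ` S \<subseteq> {n..}"
proof -
  have *: "\<sigma> \<langle>$\<rangle> i = i" if "i < n" for i using assms that by (simp add: fix_below_def)
  show "(\<langle>$\<rangle>) \<sigma> ` U = U" if "U \<subseteq> {..<n}"
  proof -
    have "(\<langle>$\<rangle>) \<sigma> ` U = id ` U" by (rule image_cong) (use that * in auto)
    then show ?thesis by simp
  qed
  show "(\<langle>$\<rangle>) \<sigma> ` S \<subseteq> {n..}" if "S \<subseteq> {n..}"
  proof (rule image_subsetI)
    fix i assume "i \<in> S"
    then have "\<not> i < n" using that by auto
    then have "\<not> \<sigma> \<langle>$\<rangle> i < n" using *[of "\<sigma> \<langle>$\<rangle> i"] by (auto simp: apply_inj)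
    then show "\<sigma> \<langle>$\<rangle> i \<in> {n..}" by simp
  qed
qed

lemma perm_image_times: "(\<langle>$\<rangle>) (\<sigma> * \<tau>) ` S = (\<langle>$\<rangle>) \<sigma> ` ((\<langle>$\<rangle>) \<tau> ` S)"
  by (simp add: apply_times image_image)

lemma perm_image_inverse [simp]: "(\<langle>$\<rangle>) (inverse \<sigma>) ` ((\<langle>$\<rangle>) \<sigma> ` S) = S"
  by (simp add: image_image)

lemma card_perm_image [simp]: "card ((\<langle>$\<rangle>) \<sigma> ` S) = card S"
  by (rule card_image) (simp add: inj_on_def apply_inj)

lemma perm_of_bij:
  assumes "bij f" "finite {a. f a \<noteq> a}"
  obtains \<sigma> where "\<And>a. \<sigma> \<langle>$\<rangle> a = f a"
proof -
  have "apply (Perm f) = f" using assms by (intro Perm.Perm_inverse) simp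
  then show thesis by (intro that[of "Perm f"]) simp
qed

lemma perm_of_involution:
  assumes "\<And>a. f (f a) = a" "finite {a. f a \<noteq> a}"
  obtains \<sigma> where "\<And>a. \<sigma> \<langle>$\<rangle> a = f a"
  by (rule perm_of_bij[of f]) (use assms in \<open>auto intro: involuntory_imp_bij\<close>)

text \<open>An involution exchanging \<open>S - T\<close> with \<open>T - S\<close> and fixing all
  other points does this; as an involution it is automatically a bijection.\<close>

lemma ex_perm_image:
  assumes "finite S" "finite T" "card S = card T" "S \<subseteq> {n..}" "T \<subseteq> {n..}"
  shows "\<exists>\<sigma>\<in>fix_below n. (\<langle>$\<rangle>) \<sigma> ` S = T"
proof -
  have "card (S - T) = card (T - S)"
    using assms(1-3) by (simp add: card_Diff_subset_Int Int_commute)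
  then obtain h where h: "bij_betw h (S - T) (T - S)"
    using assms(1,2) by (meson finite_Diff finite_same_card_bij)
  define k where "k = inv_into (S - T) h"
  have h': "h i \<in> T - S" "k (h i) = i" if "i \<in> S - T" for i
    using that bij_betw_inv_into_left[OF h] bij_betwE[OF h] by (auto simp: k_def)
  have k': "k i \<in> S - T" "h (k i) = i" if "i \<in> T - S" for i
    using that bij_betw_inv_into_right[OF h] bij_betwE[OF bij_betw_inv_into[OF h]]
    by (auto simp: k_def)
  define f where "f i = (if i \<in> S - T then h i else if i \<in> T - S then k i else i)" for i
  have "f (f i) = i" for i
    using h'[of i] k'[of i] by (auto simp: f_def)
  moreover have "finite {i. f i \<noteq> i}"
    by (rule finite_subset[of _ "S \<union> T"]) (use assms(1,2) in \<open>auto simp: f_def\<close>)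
  ultimately obtain \<sigma> where \<sigma>: "\<And>i. \<sigma> \<langle>$\<rangle> i = f i" using perm_of_involution by metis
  have sub: "(\<langle>$\<rangle>) \<sigma> ` S \<subseteq> T"
    using h' by (auto simp: \<sigma> f_def)
  have "(\<langle>$\<rangle>) \<sigma> ` S = T"
    by (rule card_subset_eq[OF assms(2) sub]) (simp add: assms(3))
  moreover have "\<sigma> \<in> fix_below n"
    using assms(4,5) by (auto simp: fix_below_def \<sigma> f_def)
  ultimately show ?thesis by blast
qed

text \<open>Exchange \<open>i\<close> with \<open>i + N\<close> for \<open>i \<in> S\<close>. As
  \<open>S\<close> lies below \<open>N\<close>, the two copies of \<open>S\<close> are disjoint, and
  no point below \<open>N\<close> outside \<open>S\<close> is touched.\<close>

lemma ex_perm_away: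
  assumes "finite S" "S \<subseteq> {n..}" "S \<subseteq> {..<N}" "n \<le> N"
  shows "\<exists>\<sigma>\<in>fix_below n. (\<forall>i<N. i \<notin> S \<longrightarrow> \<sigma> \<langle>$\<rangle> i = i) \<and> (\<langle>$\<rangle>) \<sigma> ` S \<subseteq> {N..}"
proof -
  define f where "f i = (if i \<in> S then i + N else if N \<le> i \<and> i - N \<in> S then i - N else i)" for i
  have "f (f i) = i" for i
    using assms(3) by (auto simp: f_def subset_iff)
  moreover have "{i. f i \<noteq> i} \<subseteq> S \<union> (\<lambda>i. i + N) ` S"
  proof
    fix i assume "i \<in> {i. f i \<noteq> i}"
    then have "i \<in> S \<or> i - N \<in> S \<and> i = (i - N) + N" by (auto simp: f_def split: if_splits)
    then show "i \<in> S \<union> (\<lambda>i. i + N) ` S" by blast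
  qed
  then have "finite {i. f i \<noteq> i}"
    using assms(1) by (meson finite_UnI finite_imageI finite_subset)
  ultimately obtain \<sigma> where \<sigma>: "\<And>i. \<sigma> \<langle>$\<rangle> i = f i" using perm_of_involution by metis
  show ?thesis
    by (rule bexI[of _ \<sigma>]) (use assms in \<open>auto simp: \<sigma> f_def fix_below_def subset_iff\<close>)
qed


section \<open>Semilinear actions on vector spaces and Galois descent\<close>

text \<open>The representation of interest is the quotient by \<open>A\<^sub>0\<close>. It is never
  formed here: computing upstairs keeps all subspaces inside a vector space that is a whole type, at
  the price of congruences modulo \<open>A\<^sub>0\<close>.\<close>

locale semilinear = vector_space scale
  for scale :: "'k::field ratfun \<Rightarrow> 'v::ab_group_add \<Rightarrow> 'v"  (infixr \<open>*s\<close> 75) +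
  fixes ac :: "nat perm \<Rightarrow> 'v \<Rightarrow> 'v" and A\<^sub>0 :: "'v set"
  assumes ac_add: "ac \<sigma> (v + w) = ac \<sigma> v + ac \<sigma> w"
    and ac_scale: "ac \<sigma> (a *s v) = perm_ratfun \<sigma> a *s ac \<sigma> v"
    and ac_one: "ac 1 v = v"
    and ac_times: "ac (\<sigma> * \<tau>) v = ac \<sigma> (ac \<tau> v)"
    and subspace_base: "subspace A\<^sub>0"
    and base_stable: "v \<in> A\<^sub>0 \<Longrightarrow> ac \<sigma> v \<in> A\<^sub>0"
begin

lemma ac_zero: "ac \<sigma> 0 = 0"
  using ac_add[of \<sigma> 0 0] by simp

lemma ac_diff: "ac \<sigma> (v - w) = ac \<sigma> v - ac \<sigma> w"
  using ac_add[of \<sigma> "v - w" w] by (simp add: eq_diff_eq)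

lemma ac_sum: "ac \<sigma> (sum f X) = (\<Sum>x\<in>X. ac \<sigma> (f x))"
  by (induction X rule: infinite_finite_induct) (simp_all add: ac_zero ac_add)

lemma subspace_diff_iff: "subspace A \<Longrightarrow> v - w \<in> A \<Longrightarrow> v \<in> A \<longleftrightarrow> w \<in> A"
  using subspace_add[of A "v - w" w] subspace_diff[of A v "v - w"] by auto

definition stable :: "nat \<Rightarrow> 'v set \<Rightarrow> bool"
  where "stable n B \<longleftrightarrow> (\<forall>\<sigma>\<in>fix_below n. \<forall>v\<in>B. ac \<sigma> v \<in> B)"

lemma subspace_vimage_ac: "subspace B \<Longrightarrow> subspace {v. ac \<sigma> v \<in> B}"
  by (auto simp: subspace_def ac_add ac_scale ac_zero)

lemma stable_spanI:
  assumes "\<And>\<sigma> v. \<sigma> \<in> fix_below n \<Longrightarrow> v \<in> X \<Longrightarrow> ac \<sigma> v \<in> span X"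
  shows "stable n (span X)"
proof -
  have "span X \<subseteq> {v. ac \<sigma> v \<in> span X}" if "\<sigma> \<in> fix_below n" for \<sigma>
    by (rule span_minimal) (use assms that in \<open>auto intro: subspace_vimage_ac\<close>)
  then show ?thesis by (auto simp: stable_def)
qed

section \<open>Descent along the symmetric group on the first points\<close>

definition setstab :: "nat \<Rightarrow> nat perm set"
  where "setstab d = {\<sigma>. (\<langle>$\<rangle>) \<sigma> ` {..<d} = {..<d}}"

text \<open>The group is the setwise stabiliser of \<open>{..<d}\<close>, so the translates of an
  invariant vector are indexed, modulo \<open>A\<^sub>0\<close>, by the \<open>d\<close>-element
  sets.\<close>

definition invariants :: "nat \<Rightarrow> 'v set"
  where "invariants d = {v. \<forall>\<sigma>\<in>setstab d. ac \<sigma> v - v \<in> A\<^sub>0}"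

definition perms_below :: "nat \<Rightarrow> nat perm set"
  where "perms_below d = {g. \<forall>i\<ge>d. g \<langle>$\<rangle> i = i}"

lemma finite_perms_below: "finite (perms_below d)"
proof -
  have "apply ` perms_below d \<subseteq> {p. p permutes {..<d}}"
    by (auto simp: perms_below_def permutes_def bij_iff[symmetric])
  then have "finite (apply ` perms_below d)"
    by (rule finite_subset) (simp add: finite_permutations)
  then show ?thesis
    by (rule finite_imageD) (auto simp: inj_on_def perm_eq_iff)
qed

lemma perms_below_eqI:
  assumes "g \<in> perms_below d" "g' \<in> perms_below d" "\<And>i. i < d \<Longrightarrow> g \<langle>$\<rangle> i = g' \<langle>$\<rangle> i"
  shows "g = g'"
proof (rule perm_eqI)
  show "g \<langle>$\<rangle> i = g' \<langle>$\<rangle> i" for i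
    using assms by (cases "i < d") (auto simp: perms_below_def)
qed

lemma setstab_less: "\<sigma> \<in> setstab d \<Longrightarrow> i < d \<Longrightarrow> \<sigma> \<langle>$\<rangle> i < d"
  by (auto simp: setstab_def)

lemma setstab_times: "\<sigma> \<in> setstab d \<Longrightarrow> \<tau> \<in> setstab d \<Longrightarrow> \<sigma> * \<tau> \<in> setstab d"
  by (simp add: setstab_def perm_image_times)

lemma perms_below_setstab: "g \<in> perms_below d \<Longrightarrow> g \<in> setstab d"
proof -
  assume g: "g \<in> perms_below d"
  have "g \<langle>$\<rangle> i < d" if "i < d" for i
  proof (rule ccontr)
    assume "\<not> g \<langle>$\<rangle> i < d"
    then have "g \<langle>$\<rangle> (g \<langle>$\<rangle> i) = g \<langle>$\<rangle> i" using g by (simp add: perms_below_def)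
    then show False using \<open>\<not> _\<close> that by (simp add: apply_inj)
  qed
  then have "(\<langle>$\<rangle>) g ` {..<d} \<subseteq> {..<d}" by auto
  then have "(\<langle>$\<rangle>) g ` {..<d} = {..<d}" by (rule card_subset_eq[rotated]) simp_all
  then show ?thesis by (simp add: setstab_def)
qed

text \<open>With \<open>g\<close> so chosen, \<open>inverse g * \<sigma>\<close> lies in
  \<open>fix_below d\<close>. Thus the setwise stabiliser is the finite group
  \<open>perms_below d\<close> times the pointwise one, and finite sums over
  \<open>perms_below d\<close> can produce invariants.\<close>

lemma setstab_restrict:
  assumes "\<sigma> \<in> setstab d"
  shows "\<exists>g\<in>perms_below d. \<forall>i<d. g \<langle>$\<rangle> i = \<sigma> \<langle>$\<rangle> i"
proof -
  define f where "f i = (if i \<in> {..<d} then \<sigma> \<langle>$\<rangle> i else i)" for i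
  have "bij_betw ((\<langle>$\<rangle>) \<sigma>) {..<d} {..<d}"
    using assms by (auto simp: bij_betw_def setstab_def inj_on_def apply_inj)
  then have "bij_betw f {..<d} {..<d}"
    by (rule bij_betw_cong[THEN iffD1, rotated]) (simp add: f_def)
  then have "f permutes {..<d}"
    by (rule bij_imp_permutes) (simp add: f_def)
  then have "bij f" by (rule permutes_bij)
  moreover have "finite {i. f i \<noteq> i}"
    by (rule finite_subset[of _ "{..<d}"]) (auto simp: f_def)
  ultimately obtain g where g: "\<And>i. g \<langle>$\<rangle> i = f i" using perm_of_bij by metis
  then show ?thesis by (intro bexI[of _ g]) (auto simp: perms_below_def f_def)
qed

context
  fixes d :: nat and x :: 'v
  assumes x_fixed: "\<sigma> \<in> fix_below d \<Longrightarrow> ac \<sigma> x - x \<in> A\<^sub>0"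
begin

text \<open>By semilinearity the summand is \<open>ac g (a *s x)\<close>: this is the trace of
  \<open>a *s x\<close> over the symmetric group on \<open>d\<close> points.\<close>

definition trace :: "'k ratfun \<Rightarrow> 'v"
  where "trace a = (\<Sum>g\<in>perms_below d. perm_ratfun g a *s ac g x)"

text \<open>Left multiplication by \<sigma> permutes the cosets of \<open>fix_below d\<close> in the
  setwise stabiliser, and hence the summands of the trace modulo \<open>A\<^sub>0\<close>. Here
  \<open>r g\<close> is the representative in \<open>perms_below d\<close> of the coset of
  \<open>\<sigma> * g\<close>.\<close>

lemma trace_invariant:
  assumes a: "\<And>\<sigma>. \<sigma> \<in> fix_below d \<Longrightarrow> perm_ratfun \<sigma> a = a"
  shows "trace a \<in> invariants d"
  unfolding invariants_def
proof (intro CollectI ballI)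
  fix \<sigma> assume \<sigma>: "\<sigma> \<in> setstab d"
  then have "\<forall>g\<in>perms_below d. \<exists>g'. g' \<in> perms_below d \<and> (\<forall>i<d. g' \<langle>$\<rangle> i = (\<sigma> * g) \<langle>$\<rangle> i)"
    using setstab_restrict[OF setstab_times[OF _ perms_below_setstab]] by blast
  from bchoice[OF this] obtain r where r: "\<And>g. g \<in> perms_below d \<Longrightarrow> r g \<in> perms_below d"
    "\<And>g i. g \<in> perms_below d \<Longrightarrow> i < d \<Longrightarrow> r g \<langle>$\<rangle> i = \<sigma> \<langle>$\<rangle> (g \<langle>$\<rangle> i)"
    by (auto simp: apply_times)
  have "inj_on r (perms_below d)"
  proof (rule inj_onI)
    fix g g' assume g: "g \<in> perms_below d" "g' \<in> perms_below d" "r g = r g'"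
    show "g = g'"
    proof (rule perms_below_eqI[OF g(1,2)])
      fix i assume "i < d"
      then have "\<sigma> \<langle>$\<rangle> (g \<langle>$\<rangle> i) = \<sigma> \<langle>$\<rangle> (g' \<langle>$\<rangle> i)"
        using r(2)[OF g(1)] r(2)[OF g(2)] g(3) by simp
      then show "g \<langle>$\<rangle> i = g' \<langle>$\<rangle> i" by (simp add: apply_inj)
    qed
  qed
  then have bij: "bij_betw r (perms_below d) (perms_below d)"
    using r(1) finite_perms_below by (simp add: bij_betw_def endo_inj_surj image_subset_iff)
  have "ac \<sigma> (perm_ratfun g a *s ac g x) - perm_ratfun (r g) a *s ac (r g) x \<in> A\<^sub>0" if g: "g \<in> perms_below d" for g
  proof -
    \<comment> \<open>The error in replacing \<open>\<sigma> * g\<close> by \<open>r g\<close> is a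
      factor \<open>h\<close> in \<open>fix_below d\<close>, which fixes \<open>a\<close> exactly
      and \<open>x\<close> modulo \<open>A\<^sub>0\<close>.\<close>
    define h where "h = inverse (r g) * (\<sigma> * g)"
    have h: "\<sigma> * g = r g * h"
      by (simp add: h_def mult.assoc[symmetric])
    have "h \<in> fix_below d"
      by (auto simp: h_def fix_below_def apply_times r(2)[OF g, symmetric])
    then have "perm_ratfun (r g) (perm_ratfun h a) = perm_ratfun (r g) a" and xh: "ac h x - x \<in> A\<^sub>0"
      using a x_fixed by simp_all
    moreover have "ac \<sigma> (perm_ratfun g a *s ac g x) = perm_ratfun (\<sigma> * g) a *s ac (\<sigma> * g) x"
      by (simp add: ac_scale perm_ratfun_times ac_times)
    ultimately have "ac \<sigma> (perm_ratfun g a *s ac g x) - perm_ratfun (r g) a *s ac (r g) x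
        = perm_ratfun (r g) a *s ac (r g) (ac h x - x)"
      unfolding h by (simp add: perm_ratfun_times ac_times ac_diff scale_right_diff_distrib)
    then show ?thesis using xh base_stable subspace_base by (simp add: subspace_scale)
  qed
  then have "(\<Sum>g\<in>perms_below d. ac \<sigma> (perm_ratfun g a *s ac g x) - perm_ratfun (r g) a *s ac (r g) x) \<in> A\<^sub>0"
    by (intro subspace_sum subspace_base)
  moreover have "(\<Sum>g\<in>perms_below d. perm_ratfun (r g) a *s ac (r g) x) = trace a"
    unfolding trace_def using bij by (rule sum.reindex_bij_betw)
  ultimately show "ac \<sigma> (trace a) - trace a \<in> A\<^sub>0"
    by (simp add: sum_subtractf) (simp add: trace_def ac_sum)
qed

text \<open>Expanding the product writes the sum as a combination of traces. For \<open>L\<close> the list of all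
  pairs \<open>t \<noteq> s\<close> below \<open>d\<close> the product vanishes unless \<open>g = 1\<close>.\<close>

lemma twisted_sum_in_span_invariants:
  assumes "set L \<subseteq> {..<d} \<times> UNIV" "\<And>\<sigma>. \<sigma> \<in> fix_below d \<Longrightarrow> perm_ratfun \<sigma> a = a"
  shows "(\<Sum>g\<in>perms_below d. (perm_ratfun g a * (\<Prod>(t, s)\<leftarrow>L. xi (g \<langle>$\<rangle> t) - xi s)) *s ac g x)
    \<in> span (invariants d)"
  using assms
proof (induction L arbitrary: a)
  case Nil
  then show ?case using trace_invariant[OF Nil(2)] by (simp add: trace_def span_base)
next
  case (Cons ts L)
  obtain t s where ts: "ts = (t, s)" by (cases ts)
  let ?P = "\<lambda>g. \<Prod>(t, s)\<leftarrow>L. xi (g \<langle>$\<rangle> t) - xi s"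
  \<comment> \<open>The first factor is split as a difference. Its part
    \<open>xi (g \<langle>$\<rangle> t)\<close> is absorbed into the twisted scalar, replacing
    \<open>a\<close> by \<open>a * xi t\<close>, which is still fixed by \<open>fix_below d\<close>
    because \<open>t < d\<close>; its part \<open>xi s\<close> does not depend on \<open>g\<close>
    and leaves the sum.\<close>
  have "(\<Sum>g\<in>perms_below d. (perm_ratfun g (a * xi t) * ?P g) *s ac g x) \<in> span (invariants d)"
    using Cons.prems ts
    by (intro Cons.IH) (auto simp: perm_ratfun_mult perm_ratfun_xi fix_below_def)
  moreover have "xi s *s (\<Sum>g\<in>perms_below d. (perm_ratfun g a * ?P g) *s ac g x) \<in> span (invariants d)"
    using Cons.prems by (intro span_scale Cons.IH) auto
  ultimately have "(\<Sum>g\<in>perms_below d. (perm_ratfun g (a * xi t) * ?P g) *s ac g x) -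
      xi s *s (\<Sum>g\<in>perms_below d. (perm_ratfun g a * ?P g) *s ac g x) \<in> span (invariants d)"
    by (rule span_diff)
  also have "(\<Sum>g\<in>perms_below d. (perm_ratfun g (a * xi t) * ?P g) *s ac g x) -
      xi s *s (\<Sum>g\<in>perms_below d. (perm_ratfun g a * ?P g) *s ac g x) =
      (\<Sum>g\<in>perms_below d. (perm_ratfun g a * (\<Prod>(t, s)\<leftarrow>ts # L. xi (g \<langle>$\<rangle> t) - xi s)) *s ac g x)"
    unfolding scale_sum_right sum_subtractf[symmetric]
    by (rule sum.cong)
      (simp_all add: ts perm_ratfun_mult perm_ratfun_xi algebra_simps)
  finally show ?case .
qed

text \<open>An explicit substitute for the linear independence of characters: for
  \<open>a = 1\<close> the twisted sum collapses to \<open>P 1 *s x\<close>. Up to sign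
  \<open>P 1\<close> is the discriminant of the first \<open>d\<close> variables, so it can be
  divided out.\<close>

lemma in_span_invariants: "x \<in> span (invariants d)"
proof -
  define L where "L = filter (\<lambda>(t, s). s \<noteq> t) (List.product [0..<d] [0..<d])"
  have L: "set L = {(t, s). t < d \<and> s < d \<and> s \<noteq> t}"
    by (auto simp: L_def)
  define P where "P g = (\<Prod>(t, s)\<leftarrow>L. xi (g \<langle>$\<rangle> t) - xi s :: 'k ratfun)" for g
  have P_1: "P 1 \<noteq> 0"
  proof
    assume "P 1 = 0"
    then obtain t s where "(t, s) \<in> set L" "xi t - xi s = (0 :: 'k ratfun)"
      unfolding P_def prod_list_zero_iff by auto
    then show False unfolding L by (simp add: xi_eq_iff)
  qed
  have P: "P g = 0" if g: "g \<in> perms_below d" "g \<noteq> 1" for g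
  proof -
    have "1 \<in> perms_below d" by (simp add: perms_below_def)
    have "\<exists>t<d. g \<langle>$\<rangle> t \<noteq> t"
    proof (rule ccontr)
      assume "\<not> (\<exists>t<d. g \<langle>$\<rangle> t \<noteq> t)"
      then have "g = 1" by (intro perms_below_eqI[OF g(1) \<open>1 \<in> _\<close>]) auto
      then show False using g(2) by simp
    qed
    \<comment> \<open>A moved point \<open>t\<close> supplies the vanishing factor, namely that of
      the pair \<open>(t, g \<langle>$\<rangle> t)\<close>; the pair belongs to \<open>L\<close>
      because \<open>g\<close> preserves \<open>{..<d}\<close>.\<close>
    then obtain t where t: "t < d" "g \<langle>$\<rangle> t \<noteq> t" by blast
    then have "(t, g \<langle>$\<rangle> t) \<in> set L"
      using setstab_less[OF perms_below_setstab[OF g(1)]] by (simp add: L)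
    then have "xi (g \<langle>$\<rangle> t) - xi (g \<langle>$\<rangle> t) \<in> (\<lambda>(t, s). xi (g \<langle>$\<rangle> t) - xi s :: 'k ratfun) ` set L"
      by (rule image_eqI[rotated]) simp
    then show ?thesis unfolding P_def prod_list_zero_iff by simp
  qed
  have "(\<Sum>g\<in>perms_below d. (perm_ratfun g 1 * P g) *s ac g x) \<in> span (invariants d)"
    unfolding P_def by (rule twisted_sum_in_span_invariants) (auto simp: L perm_ratfun_one)
  moreover have "(\<Sum>g\<in>perms_below d. (perm_ratfun g 1 * P g) *s ac g x) =
      (\<Sum>g\<in>{1}. (perm_ratfun g 1 * P g) *s ac g x)"
    by (rule sum.mono_neutral_right[OF finite_perms_below]) (auto simp: P perms_below_def)
  ultimately have "P 1 *s x \<in> span (invariants d)"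
    by (simp add: perm_ratfun_one ac_one)
  then have "inverse (P 1) *s P 1 *s x \<in> span (invariants d)" by (rule span_scale)
  then show ?thesis using P_1 by simp
qed

end

end

section \<open>Families indexed by finite sets, obtained from invariant vectors\<close>

context semilinear begin

text \<open>The quotient \<open>inverse \<tau> * \<sigma>\<close> stabilises \<open>{..<d}\<close>,
  and applying \<tau> to the resulting congruence is harmless since \<open>A\<^sub>0\<close> is
  stable. It follows that the arbitrary choice in \<open>carry\<close> does not matter modulo
  \<open>A\<^sub>0\<close>.\<close>

lemma invariant_cong:
  assumes "v \<in> invariants d" "(\<langle>$\<rangle>) \<sigma> ` {..<d} = (\<langle>$\<rangle>) \<tau> ` {..<d}"
  shows "ac \<sigma> v - ac \<tau> v \<in> A\<^sub>0"
proof -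
  have "(\<langle>$\<rangle>) (inverse \<tau> * \<sigma>) ` {..<d} = {..<d}"
    by (simp add: perm_image_times assms(2))
  then have "ac (inverse \<tau> * \<sigma>) v - v \<in> A\<^sub>0"
    using assms(1) by (simp add: invariants_def setstab_def)
  then have "ac \<tau> (ac (inverse \<tau> * \<sigma>) v - v) \<in> A\<^sub>0" by (rule base_stable)
  then show ?thesis by (simp add: ac_diff ac_times[symmetric] mult.assoc[symmetric])
qed

definition carry :: "nat \<Rightarrow> nat set \<Rightarrow> nat perm"
  where "carry d S = (SOME \<sigma>. (\<langle>$\<rangle>) \<sigma> ` {..<d} = S)"

lemma carry_image:
  assumes "finite S" "card S = d"
  shows "(\<langle>$\<rangle>) (carry d S) ` {..<d} = S"
  unfolding carry_def
proof (rule someI_ex)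
  show "\<exists>\<sigma>. (\<langle>$\<rangle>) \<sigma> ` {..<d} = S"
    using ex_perm_image[of "{..<d}" S 0] assms by auto
qed

text \<open>The value 0 for vectors that are not invariant makes the family equivariant for every
  \<open>v\<close>, so that all vectors may serve as labels.\<close>

definition orbit_family :: "nat \<Rightarrow> 'v \<Rightarrow> nat set \<Rightarrow> 'v"
  where "orbit_family d v S = (if v \<in> invariants d then ac (carry d S) v else 0)"

lemma orbit_family_ac:
  assumes "finite S" "card S = d"
  shows "ac \<sigma> (orbit_family d v S) - orbit_family d v ((\<langle>$\<rangle>) \<sigma> ` S) \<in> A\<^sub>0"
proof (cases "v \<in> invariants d")
  case True
  have "(\<langle>$\<rangle>) (\<sigma> * carry d S) ` {..<d} = (\<langle>$\<rangle>) (carry d ((\<langle>$\<rangle>) \<sigma> ` S)) ` {..<d}"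
    using assms by (simp add: perm_image_times carry_image)
  from invariant_cong[OF True this] True show ?thesis
    by (simp add: orbit_family_def ac_times)
qed (simp add: orbit_family_def ac_zero subspace_0[OF subspace_base])

end


section \<open>Equivariant families and their refinements\<close>

text \<open>
  At level \<open>n\<close>, a family \<open>b j\<close> indexed by the \<open>d\<close>-element sets splits into families
  indexed by sets \<open>S \<subseteq> {n..}\<close>: the label \<open>(j, U)\<close> stands for \<open>S \<mapsto> b j (U \<union> S)\<close>, where
  \<open>U \<subseteq> {..<n}\<close> and \<open>S\<close> has \<open>d - card U\<close> elements. Passing from level \<open>n\<close> to level \<open>m\<close>
  refines the labels but does not change the members of the family.
\<close>

type_synonym 'i label = "'i \<times> nat set"

definition admissible :: "nat \<Rightarrow> nat \<Rightarrow> 'i label set \<Rightarrow> bool"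
  where "admissible d n J \<longleftrightarrow> finite J \<and> (\<forall>(j, U)\<in>J. U \<subseteq> {..<n} \<and> card U \<le> d)"

definition indices :: "nat \<Rightarrow> nat \<Rightarrow> 'i label set \<Rightarrow> ('i label \<times> nat set) set"
  where "indices d n J = {((j, U), S). (j, U) \<in> J \<and> finite S \<and> S \<subseteq> {n..} \<and> card U + card S = d}"

definition refine :: "nat \<Rightarrow> nat \<Rightarrow> nat \<Rightarrow> 'i label set \<Rightarrow> 'i label set"
  where "refine d n m J = {(j, V). V \<subseteq> {..<m} \<and> card V \<le> d \<and> (j, V \<inter> {..<n}) \<in> J}"

text \<open>Coarsening moves the points of a label that lie beyond \<open>n\<close> into the index
  set, and \<open>refine_index\<close> moves them back. The union of both sets stays the same, so
  the two indices name the same member of a family.\<close>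

definition coarsen_index :: "nat \<Rightarrow> 'i label \<times> nat set \<Rightarrow> 'i label \<times> nat set"
  where "coarsen_index n = (\<lambda>((j, V), S). ((j, V \<inter> {..<n}), V \<inter> {n..} \<union> S))"

definition refine_index :: "nat \<Rightarrow> 'i label \<times> nat set \<Rightarrow> 'i label \<times> nat set"
  where "refine_index m = (\<lambda>((j, U), S). ((j, U \<union> S \<inter> {..<m}), S \<inter> {m..}))"

lemma admissibleD:
  assumes "admissible d n J" "(j, U) \<in> J"
  shows "U \<subseteq> {..<n}" "card U \<le> d" "finite U"
proof -
  show "U \<subseteq> {..<n}" "card U \<le> d" using assms by (auto simp: admissible_def)
  then show "finite U" by (meson finite_lessThan finite_subset)
qed

lemma admissible_subset:
  assumes "admissible d n J" "J' \<subseteq> J"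
  shows "admissible d n J'"
  using assms unfolding admissible_def by (meson finite_subset subsetD)

lemma admissible_refine:
  assumes "admissible d n J"
  shows "admissible d m (refine d n m J)"
proof -
  have "finite (fst ` J \<times> Pow {..<m})" using assms by (simp add: admissible_def)
  moreover have "refine d n m J \<subseteq> fst ` J \<times> Pow {..<m}"
    by (auto simp: refine_def image_iff Bex_def)
  ultimately have "finite (refine d n m J)" by (rule finite_subset[rotated])
  then show ?thesis by (auto simp: admissible_def refine_def)
qed

lemma coarsen_index_in:
  assumes "n \<le> m" "t \<in> indices d m (refine d n m J)"
  shows "coarsen_index n t \<in> indices d n J"
proof -
  obtain j V S where t: "t = ((j, V), S)" by (metis surj_pair)
  have *: "V \<subseteq> {..<m}" "(j, V \<inter> {..<n}) \<in> J" "finite S" "S \<subseteq> {m..}" "card V + card S = d"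
    using assms(2) by (auto simp: t indices_def refine_def)
  have V: "finite V" using *(1) by (rule finite_subset) simp
  have "V \<inter> S = {}" using *(1,4) by (force simp: disjoint_iff)
  then have "card ((V \<inter> {n..}) \<union> S) = card (V \<inter> {n..}) + card S"
    using *(3) V by (intro card_Un_disjoint) auto
  moreover have "card ((V \<inter> {..<n}) \<union> (V \<inter> {n..})) = card (V \<inter> {..<n}) + card (V \<inter> {n..})"
    by (rule card_Un_disjoint) (use V in auto)
  moreover have "(V \<inter> {..<n}) \<union> (V \<inter> {n..}) = V" by auto
  ultimately show ?thesis
    using * V assms(1) by (auto simp: t indices_def coarsen_index_def)
qed

lemma refine_index_in:
  assumes "n \<le> m" "admissible d n J" "t \<in> indices d n J"
  shows "refine_index m t \<in> indices d m (refine d n m J)"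
proof -
  obtain j U S where t: "t = ((j, U), S)" by (metis surj_pair)
  have *: "(j, U) \<in> J" "finite S" "S \<subseteq> {n..}" "card U + card S = d"
    using assms(3) by (auto simp: t indices_def)
  have U: "U \<subseteq> {..<n}" "finite U" by (rule admissibleD[OF assms(2) *(1)])+
  have disj: "U \<inter> S = {}" using *(3) U(1) by (force simp: disjoint_iff)
  have "card (U \<union> S \<inter> {..<m}) = card U + card (S \<inter> {..<m})"
    using *(2) U(2) disj by (intro card_Un_disjoint) auto
  moreover have "card ((S \<inter> {..<m}) \<union> (S \<inter> {m..})) = card (S \<inter> {..<m}) + card (S \<inter> {m..})"
    by (rule card_Un_disjoint) (use *(2) in auto)
  moreover have "(S \<inter> {..<m}) \<union> (S \<inter> {m..}) = S" by auto
  moreover have "(U \<union> S \<inter> {..<m}) \<inter> {..<n} = U" using U(1) *(3) by auto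
  ultimately show ?thesis
    using * U assms(1) by (auto simp: t indices_def refine_def refine_index_def)
qed

lemma coarsen_refine:
  assumes "admissible d n J" "t \<in> indices d n J"
  shows "coarsen_index n (refine_index m t) = t"
proof -
  obtain j U S where t: "t = ((j, U), S)" by (metis surj_pair)
  have *: "(j, U) \<in> J" "S \<subseteq> {n..}" using assms(2) by (auto simp: t indices_def)
  then have U: "U \<subseteq> {..<n}" using admissibleD(1)[OF assms(1)] by blast
  show ?thesis
    unfolding t coarsen_index_def refine_index_def using * U by (auto simp: not_less)
qed

lemma refine_coarsen:
  assumes "n \<le> m" "t \<in> indices d m (refine d n m J)"
  shows "refine_index m (coarsen_index n t) = t"
proof -
  obtain j V S where t: "t = ((j, V), S)" by (metis surj_pair)
  have *: "V \<subseteq> {..<m}" "S \<subseteq> {m..}"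
    using assms(2) by (auto simp: t indices_def refine_def)
  show ?thesis
    unfolding t coarsen_index_def refine_index_def using * by (auto simp: not_less)
qed

lemma bij_betw_coarsen_index:
  assumes "n \<le> m" "admissible d n J"
  shows "bij_betw (coarsen_index n) (indices d m (refine d n m J)) (indices d n J)"
  by (rule bij_betw_byWitness[where f' = "refine_index m"])
    (use assms in \<open>auto simp: refine_coarsen coarsen_refine coarsen_index_in refine_index_in\<close>)

context vector_space
begin

text \<open>For a subspace \<open>A\<close> this is linear independence in the quotient by
  \<open>A\<close>. It is a property of an indexed family: two indices with congruent members
  already violate it.\<close>

definition independent_mod :: "'b set \<Rightarrow> ('t \<Rightarrow> 'b) \<Rightarrow> 't set \<Rightarrow> bool"
  where "independent_mod A f T \<longleftrightarrow>
    (\<forall>X c. finite X \<longrightarrow> X \<subseteq> T \<longrightarrow> (\<Sum>t\<in>X. scale (c t) (f t)) \<in> A \<longrightarrow> (\<forall>t\<in>X. c t = 0))"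

lemma independent_mod_reindex:
  assumes "independent_mod A f T" "bij_betw \<phi> T' T" "\<And>t. t \<in> T' \<Longrightarrow> f (\<phi> t) = g t"
  shows "independent_mod A g T'"
  unfolding independent_mod_def
proof (intro allI impI ballI)
  fix X c t assume X: "finite X" "X \<subseteq> T'" "(\<Sum>t\<in>X. scale (c t) (g t)) \<in> A" and t: "t \<in> X"
  have inj: "inj_on \<phi> X" using assms(2) X(2) by (meson bij_betw_def inj_on_subset)
  let ?c = "\<lambda>s. c (inv_into X \<phi> s)"
  have "(\<Sum>s\<in>\<phi> ` X. scale (?c s) (f s)) = (\<Sum>t\<in>X. scale (c t) (g t))"
    unfolding sum.reindex[OF inj] using X(2) assms(3) inj by (intro sum.cong) auto
  moreover have "\<phi> ` X \<subseteq> T" using assms(2) X(2) by (auto simp: bij_betw_def)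
  ultimately have "\<forall>s\<in>\<phi> ` X. ?c s = 0"
    using assms(1) X unfolding independent_mod_def by (metis finite_imageI)
  then show "c t = 0" using t inj by force
qed

end

text \<open>Each \<open>b j\<close> amounts to a morphism from the standard object on
  \<open>d\<close>-element sets to the quotient by \<open>A\<^sub>0\<close>, given by its values on
  the basis vectors.\<close>

locale equivariant_family = semilinear scale ac A\<^sub>0
  for scale :: "'k::field ratfun \<Rightarrow> 'v::ab_group_add \<Rightarrow> 'v"  (infixr \<open>*s\<close> 75) and ac A\<^sub>0 +
  fixes d :: nat and b :: "'i \<Rightarrow> nat set \<Rightarrow> 'v"
  assumes family_ac: "finite S \<Longrightarrow> card S = d \<Longrightarrow> ac \<sigma> (b j S) - b j ((\<langle>$\<rangle>) \<sigma> ` S) \<in> A\<^sub>0"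
begin

definition \<beta> :: "'i label \<times> nat set \<Rightarrow> 'v"
  where "\<beta> = (\<lambda>((j, U), S). b j (U \<union> S))"

lemma \<beta>_coarsen: "\<beta> (coarsen_index n t) = \<beta> t"
proof -
  obtain j V S where t: "t = ((j, V), S)" by (metis surj_pair)
  have "V \<inter> {..<n} \<union> (V \<inter> {n..} \<union> S) = V \<union> S" by auto
  then show ?thesis by (simp add: t \<beta>_def coarsen_index_def)
qed

text \<open>A permutation in \<open>fix_below n\<close> fixes the set of the label pointwise. It
  therefore acts within one label and moves only the index set.\<close>

lemma \<beta>_ac:
  assumes "admissible d n J" "(\<iota>, S) \<in> indices d n J" "\<sigma> \<in> fix_below n"
  shows "(\<iota>, (\<langle>$\<rangle>) \<sigma> ` S) \<in> indices d n J"
    and "ac \<sigma> (\<beta> (\<iota>, S)) - \<beta> (\<iota>, (\<langle>$\<rangle>) \<sigma> ` S) \<in> A\<^sub>0"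
proof -
  obtain j U where \<iota>: "\<iota> = (j, U)" by (cases \<iota>)
  have *: "(j, U) \<in> J" "finite S" "S \<subseteq> {n..}" "card U + card S = d"
    using assms(2) by (auto simp: \<iota> indices_def)
  have U: "U \<subseteq> {..<n}" "finite U" by (rule admissibleD[OF assms(1) *(1)])+
  have disj: "U \<inter> S = {}" using *(3) U(1) by (force simp: disjoint_iff)
  show "(\<iota>, (\<langle>$\<rangle>) \<sigma> ` S) \<in> indices d n J"
    using * fix_below_image(2)[OF assms(3)] by (simp add: \<iota> indices_def)
  have "card (U \<union> S) = card U + card S"
    by (rule card_Un_disjoint[OF U(2) *(2) disj])
  then have "ac \<sigma> (b j (U \<union> S)) - b j ((\<langle>$\<rangle>) \<sigma> ` (U \<union> S)) \<in> A\<^sub>0"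
    using * U by (intro family_ac) auto
  then show "ac \<sigma> (\<beta> (\<iota>, S)) - \<beta> (\<iota>, (\<langle>$\<rangle>) \<sigma> ` S) \<in> A\<^sub>0"
    by (simp add: \<iota> \<beta>_def image_Un fix_below_image(1)[OF assms(3) U(1)])
qed

text \<open>The subspace \<open>A\<^sub>0\<close> is included so that congruent vectors are in
  \<open>Sp n J\<close> together.\<close>

definition Sp :: "nat \<Rightarrow> 'i label set \<Rightarrow> 'v set"
  where "Sp n J = span (A\<^sub>0 \<union> \<beta> ` indices d n J)"

lemma stable_span_family:
  assumes "subspace A" "A\<^sub>0 \<subseteq> A" "stable n A" "admissible d n J"
  shows "stable n (span (A \<union> \<beta> ` indices d n J))"
proof (rule stable_spanI)
  fix \<sigma> v assume \<sigma>: "\<sigma> \<in> fix_below n" and v: "v \<in> A \<union> \<beta> ` indices d n J"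
  show "ac \<sigma> v \<in> span (A \<union> \<beta> ` indices d n J)"
  proof (cases "v \<in> A")
    case True
    then show ?thesis using assms(3) \<sigma> by (auto simp: stable_def intro: span_base)
  next
    case False
    then obtain \<iota> S where t: "(\<iota>, S) \<in> indices d n J" "v = \<beta> (\<iota>, S)" using v by auto
    have "ac \<sigma> v - \<beta> (\<iota>, (\<langle>$\<rangle>) \<sigma> ` S) \<in> span (A \<union> \<beta> ` indices d n J)"
      using \<beta>_ac(2)[OF assms(4) t(1) \<sigma>] assms(2) t(2) by (auto intro: span_base)
    moreover have "\<beta> (\<iota>, (\<langle>$\<rangle>) \<sigma> ` S) \<in> span (A \<union> \<beta> ` indices d n J)"
      using \<beta>_ac(1)[OF assms(4) t(1) \<sigma>] by (auto intro: span_base)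
    ultimately show ?thesis
      by (simp add: subspace_diff_iff[OF subspace_span])
  qed
qed

lemma stable_base: "stable n A\<^sub>0"
  by (simp add: stable_def base_stable)

lemma Sp_stable: "admissible d n J \<Longrightarrow> stable n (Sp n J)"
  unfolding Sp_def by (intro stable_span_family subspace_base stable_base order_refl)

lemma base_subset_Sp: "A\<^sub>0 \<subseteq> Sp n J"
  unfolding Sp_def by (auto intro: span_base)

lemma subspace_Sp: "subspace (Sp n J)"
  by (simp add: Sp_def)

lemma Sp_minimal:
  assumes "subspace B" "A\<^sub>0 \<subseteq> B" "\<And>t. t \<in> indices d n J \<Longrightarrow> \<beta> t \<in> B"
  shows "Sp n J \<subseteq> B"
  unfolding Sp_def using assms by (intro span_minimal) auto

lemma \<beta>_in_Sp: "t \<in> indices d n J \<Longrightarrow> \<beta> t \<in> Sp n J"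
  unfolding Sp_def by (auto intro: span_base)

text \<open>A linear relation at level \<open>n\<close> involves sets below some \<open>N\<close>. A permutation moving one of them,
  \<open>S\<^sub>0\<close>, beyond \<open>N\<close> and fixing all other points below \<open>N\<close> makes every other set of the relation
  meet \<open>{..<N}\<close>, that is, turns it into a set of smaller size at level \<open>N\<close>.\<close>

lemma drop_dependent_label:
  assumes J: "admissible d n J" "\<forall>\<iota>\<in>J. d \<le> card (snd \<iota>) + k"
    and dep: "\<not> independent_mod (Sp n {\<iota>\<in>J. card (snd \<iota>) + k \<noteq> d}) \<beta>
      (indices d n {\<iota>\<in>J. card (snd \<iota>) + k = d})"
  obtains m J' where "n \<le> m" "admissible d m J'" "Sp m J' = Sp n J"
    "\<forall>\<iota>\<in>J'. d \<le> card (snd \<iota>) + k"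
    "card {\<iota>\<in>J'. card (snd \<iota>) + k = d} < card {\<iota>\<in>J. card (snd \<iota>) + k = d}"
proof -
  let ?Jl = "{\<iota>\<in>J. card (snd \<iota>) + k \<noteq> d}" and ?Jt = "{\<iota>\<in>J. card (snd \<iota>) + k = d}"
  have finJ: "finite J" using J(1) by (simp add: admissible_def)
  obtain X c t\<^sub>0 where X: "finite X" "X \<subseteq> indices d n ?Jt" "(\<Sum>t\<in>X. c t *s \<beta> t) \<in> Sp n ?Jl"
    and t\<^sub>0: "t\<^sub>0 \<in> X" "c t\<^sub>0 \<noteq> 0"
    using dep unfolding independent_mod_def by blast
  obtain j\<^sub>0 U\<^sub>0 S\<^sub>0 where t\<^sub>0_eq: "t\<^sub>0 = ((j\<^sub>0, U\<^sub>0), S\<^sub>0)" by (metis surj_pair)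
  let ?\<iota>\<^sub>0 = "(j\<^sub>0, U\<^sub>0)"
  have "finite (\<Union>(snd ` X))"
    using X(1,2) by (auto simp: indices_def)
  then obtain N0 where N0: "\<And>i. i \<in> \<Union>(snd ` X) \<Longrightarrow> i < N0"
    using finite_nat_set_iff_bounded by metis
  define m where "m = max n N0"
  have nm: "n \<le> m" by (simp add: m_def)
  have below: "S \<subseteq> {..<m}" if "(\<iota>, S) \<in> X" for \<iota> S
  proof
    fix i assume "i \<in> S"
    then have "i < N0" using that by (intro N0) force
    then show "i \<in> {..<m}" by (simp add: m_def)
  qed
  have t\<^sub>0_in: "((j\<^sub>0, U\<^sub>0), S\<^sub>0) \<in> indices d n ?Jt" using t\<^sub>0 X(2) t\<^sub>0_eq by auto
  then have \<iota>\<^sub>0: "?\<iota>\<^sub>0 \<in> J" "card U\<^sub>0 + k = d" and S\<^sub>0: "finite S\<^sub>0" "S\<^sub>0 \<subseteq> {n..}" "card U\<^sub>0 + card S\<^sub>0 = d"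
    by (auto simp: indices_def)
  have U\<^sub>0: "U\<^sub>0 \<subseteq> {..<n}" by (rule admissibleD(1)[OF J(1) \<iota>\<^sub>0(1)])
  have S\<^sub>0m: "S\<^sub>0 \<subseteq> {..<m}" using below t\<^sub>0 t\<^sub>0_eq by blast
  \<comment> \<open>Refinement keeps \<open>?\<iota>\<^sub>0\<close> itself as a label, now with
    index sets beyond \<open>m\<close>. This single label is discarded; the other refinements of
    \<open>?\<iota>\<^sub>0\<close> have smaller size and remain.\<close>
  define J' where "J' = refine d n m J - {?\<iota>\<^sub>0}"
  have adm': "admissible d m J'"
    unfolding J'_def by (rule admissible_subset[OF admissible_refine[OF J(1)]]) auto
  \<comment> \<open>An index refines to the discarded label only if it carries the label
    \<open>?\<iota>\<^sub>0\<close> and its set avoids \<open>{..<m}\<close>. All other members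
    remain available.\<close>
  have in_Sp: "\<beta> t \<in> Sp m J'" if t: "t \<in> indices d n J" and ne: "fst t \<noteq> ?\<iota>\<^sub>0 \<or> \<not> snd t \<subseteq> {m..}" for t
  proof -
    obtain j U S where t_eq: "t = ((j, U), S)" by (metis surj_pair)
    have jU: "(j, U) \<in> J" "S \<subseteq> {n..}" using t by (auto simp: t_eq indices_def)
    have "(j, U \<union> S \<inter> {..<m}) \<noteq> ?\<iota>\<^sub>0"
    proof
      assume eq: "(j, U \<union> S \<inter> {..<m}) = ?\<iota>\<^sub>0"
      then have "S \<inter> {..<m} \<subseteq> {..<n}" using U\<^sub>0 by auto
      then have S: "S \<inter> {..<m} = {}" using jU(2) by fastforce
      then have "S \<subseteq> {m..}" by (auto simp: disjoint_iff not_less)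
      moreover have "(j, U) = ?\<iota>\<^sub>0" using eq S by simp
      ultimately show False using ne by (simp add: t_eq)
    qed
    then have "refine_index m t \<in> indices d m J'"
      using refine_index_in[OF nm J(1) t] by (auto simp: J'_def indices_def t_eq refine_index_def)
    moreover have "\<beta> (refine_index m t) = \<beta> t"
      using \<beta>_coarsen[of n "refine_index m t"] coarsen_refine[OF J(1) t] by simp
    ultimately show ?thesis using \<beta>_in_Sp by metis
  qed
  have low: "Sp n ?Jl \<subseteq> Sp m J'"
  proof (rule Sp_minimal[OF subspace_Sp base_subset_Sp])
    fix t assume "t \<in> indices d n ?Jl"
    then show "\<beta> t \<in> Sp m J'"
      using \<iota>\<^sub>0(2) by (intro in_Sp) (auto simp: indices_def)
  qed
  obtain \<sigma> where \<sigma>: "\<sigma> \<in> fix_below n" "\<And>i. i < m \<Longrightarrow> i \<notin> S\<^sub>0 \<Longrightarrow> \<sigma> \<langle>$\<rangle> i = i" "(\<langle>$\<rangle>) \<sigma> ` S\<^sub>0 \<subseteq> {m..}"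
    using ex_perm_away[OF S\<^sub>0(1,2) S\<^sub>0m nm] by blast
  let ?S\<^sub>1 = "(\<langle>$\<rangle>) \<sigma> ` S\<^sub>0"
  have t\<^sub>0J: "(?\<iota>\<^sub>0, S\<^sub>0) \<in> indices d n J" using t\<^sub>0_in by (auto simp: indices_def)
  have Sp_cong: "v \<in> Sp m J' \<longleftrightarrow> w \<in> Sp m J'" if "v - w \<in> A\<^sub>0" for v w
    using that base_subset_Sp by (intro subspace_diff_iff[OF subspace_Sp]) blast
  have "ac \<sigma> (\<Sum>t\<in>X. c t *s \<beta> t) \<in> Sp m J'"
    using Sp_stable[OF admissible_subset[OF J(1), of ?Jl]] X(3) \<sigma>(1) low
    by (auto simp: stable_def)
  also have "ac \<sigma> (\<Sum>t\<in>X. c t *s \<beta> t) = perm_ratfun \<sigma> (c t\<^sub>0) *s ac \<sigma> (\<beta> t\<^sub>0) +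
      (\<Sum>t\<in>X - {t\<^sub>0}. perm_ratfun \<sigma> (c t) *s ac \<sigma> (\<beta> t))"
    using X(1) t\<^sub>0(1) by (simp add: ac_sum ac_scale ac_add sum.remove)
  finally have rel: "perm_ratfun \<sigma> (c t\<^sub>0) *s ac \<sigma> (\<beta> t\<^sub>0) +
      (\<Sum>t\<in>X - {t\<^sub>0}. perm_ratfun \<sigma> (c t) *s ac \<sigma> (\<beta> t)) \<in> Sp m J'" .
  have "ac \<sigma> (\<beta> t) \<in> Sp m J'" if t: "t \<in> X - {t\<^sub>0}" for t
  proof -
    obtain j U S where t_eq: "t = ((j, U), S)" by (metis surj_pair)
    have tJt: "((j, U), S) \<in> indices d n ?Jt" using t X(2) by (auto simp: t_eq)
    then have tJ: "((j, U), S) \<in> indices d n J" and S: "finite S" "card S = card S\<^sub>0"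
      using S\<^sub>0(3) \<iota>\<^sub>0(2) by (auto simp: indices_def)
    \<comment> \<open>If the moved set avoided \<open>{..<m}\<close>, then \<open>S\<close> would
      lie in \<open>S\<^sub>0\<close>, because \<sigma> fixes every other point below
      \<open>m\<close>. Both sets have \<open>k\<close> elements, so they would coincide, and equal
      labels would give \<open>t = t\<^sub>0\<close>.\<close>
    have "\<not> ((j, U) = ?\<iota>\<^sub>0 \<and> (\<langle>$\<rangle>) \<sigma> ` S \<subseteq> {m..})"
    proof
      assume *: "(j, U) = ?\<iota>\<^sub>0 \<and> (\<langle>$\<rangle>) \<sigma> ` S \<subseteq> {m..}"
      have "S \<subseteq> S\<^sub>0"
      proof
        fix i assume i: "i \<in> S"
        then have im: "i < m" using below t t_eq by blast
        have "\<sigma> \<langle>$\<rangle> i \<ge> m" using * i by auto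
        then show "i \<in> S\<^sub>0" using \<sigma>(2)[OF im] im by force
      qed
      then have "S = S\<^sub>0" using S S\<^sub>0(1) by (intro card_subset_eq) auto
      then show False using * t by (simp add: t_eq t\<^sub>0_eq)
    qed
    then have "\<beta> ((j, U), (\<langle>$\<rangle>) \<sigma> ` S) \<in> Sp m J'"
      using \<beta>_ac(1)[OF J(1) tJ \<sigma>(1)] by (intro in_Sp) auto
    then show ?thesis using Sp_cong[OF \<beta>_ac(2)[OF J(1) tJ \<sigma>(1)]] by (simp add: t_eq)
  qed
  then have "(\<Sum>t\<in>X - {t\<^sub>0}. perm_ratfun \<sigma> (c t) *s ac \<sigma> (\<beta> t)) \<in> Sp m J'"
    by (intro subspace_sum subspace_scale subspace_Sp)
  with rel have "perm_ratfun \<sigma> (c t\<^sub>0) *s ac \<sigma> (\<beta> t\<^sub>0) \<in> Sp m J'"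
    using subspace_diff[OF subspace_Sp rel, of "\<Sum>t\<in>X - {t\<^sub>0}. perm_ratfun \<sigma> (c t) *s ac \<sigma> (\<beta> t)"] by simp
  \<comment> \<open>The relation is solved for its distinguished term; its coefficient stays nonzero
    because permutations act injectively on scalars.\<close>
  then have "inverse (perm_ratfun \<sigma> (c t\<^sub>0)) *s perm_ratfun \<sigma> (c t\<^sub>0) *s ac \<sigma> (\<beta> t\<^sub>0) \<in> Sp m J'"
    by (rule subspace_scale[OF subspace_Sp])
  then have "ac \<sigma> (\<beta> (?\<iota>\<^sub>0, S\<^sub>0)) \<in> Sp m J'"
    using t\<^sub>0(2) by (simp add: t\<^sub>0_eq perm_ratfun_eq_0_iff)
  then have S\<^sub>1: "\<beta> (?\<iota>\<^sub>0, ?S\<^sub>1) \<in> Sp m J'"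
    using Sp_cong[OF \<beta>_ac(2)[OF J(1) t\<^sub>0J \<sigma>(1)]] by simp
  have S\<^sub>1J: "(?\<iota>\<^sub>0, ?S\<^sub>1) \<in> indices d n J" by (rule \<beta>_ac(1)[OF J(1) t\<^sub>0J \<sigma>(1)])
  \<comment> \<open>One member of the discarded family has been recovered. Since
    \<open>fix_below m\<close> is transitive on the sets of a given size beyond \<open>m\<close> and
    preserves \<open>Sp m J'\<close>, all other members follow.\<close>
  have all: "\<beta> t \<in> Sp m J'" if t: "t \<in> indices d n J" for t
  proof (cases "fst t = ?\<iota>\<^sub>0 \<and> snd t \<subseteq> {m..}")
    case True
    then obtain S where t_eq: "t = (?\<iota>\<^sub>0, S)" "S \<subseteq> {m..}" by (cases t) auto
    have "finite S" "card U\<^sub>0 + card S = d" using t by (auto simp: t_eq indices_def)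
    then obtain \<tau> where \<tau>: "\<tau> \<in> fix_below m" "(\<langle>$\<rangle>) \<tau> ` ?S\<^sub>1 = S"
      using ex_perm_image[of ?S\<^sub>1 S m] S\<^sub>0 \<sigma>(3) t_eq(2) by auto
    have "ac \<tau> (\<beta> (?\<iota>\<^sub>0, ?S\<^sub>1)) \<in> Sp m J'"
      using Sp_stable[OF adm'] \<tau>(1) S\<^sub>1 by (auto simp: stable_def)
    moreover have "\<tau> \<in> fix_below n" using \<tau>(1) fix_below_antimono[OF nm] by auto
    ultimately show ?thesis
      using Sp_cong[OF \<beta>_ac(2)[OF J(1) S\<^sub>1J]] \<tau>(2) by (metis t_eq(1))
  next
    case False
    then show ?thesis using t by (intro in_Sp) auto
  qed
  show thesis
  proof (rule that[OF nm adm'])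
    show "Sp m J' = Sp n J"
    proof
      show "Sp n J \<subseteq> Sp m J'"
        by (rule Sp_minimal[OF subspace_Sp base_subset_Sp]) (rule all)
      show "Sp m J' \<subseteq> Sp n J"
      proof (rule Sp_minimal[OF subspace_Sp base_subset_Sp])
        fix t assume "t \<in> indices d m J'"
        then have "t \<in> indices d m (refine d n m J)" by (auto simp: J'_def indices_def)
        then have "\<beta> (coarsen_index n t) \<in> Sp n J" by (rule \<beta>_in_Sp[OF coarsen_index_in[OF nm]])
        then show "\<beta> t \<in> Sp n J" by (simp add: \<beta>_coarsen)
      qed
    qed
    have V: "(j, V \<inter> {..<n}) \<in> J" "finite V" if "(j, V) \<in> J'" for j V
      using that by (auto simp: J'_def refine_def intro: finite_subset)
    have le: "d \<le> card (V \<inter> {..<n}) + k" if "(j, V) \<in> J'" for j V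
      using bspec[OF J(2) V(1)[OF that]] by simp
    show "\<forall>\<iota>\<in>J'. d \<le> card (snd \<iota>) + k"
    proof
      fix \<iota> assume \<iota>: "\<iota> \<in> J'"
      obtain j V where \<iota>_eq: "\<iota> = (j, V)" by (cases \<iota>)
      show "d \<le> card (snd \<iota>) + k"
        using \<iota> le[of j V] card_mono[OF V(2), of j V "V \<inter> {..<n}"] by (simp add: \<iota>_eq)
    qed
    \<comment> \<open>If \<open>card V = d - k\<close>, then the coarser label
      \<open>V \<inter> {..<n}\<close> has at least as many points by \<open>le\<close>, so
      \<open>V\<close> is contained in \<open>{..<n}\<close>. A refined label of size
      \<open>k\<close> is thus an old one, and \<open>?\<iota>\<^sub>0\<close> is missing among
      them.\<close>
    have "{\<iota>\<in>J'. card (snd \<iota>) + k = d} \<subseteq> ?Jt - {?\<iota>\<^sub>0}"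
    proof
      fix \<iota> assume \<iota>: "\<iota> \<in> {\<iota>\<in>J'. card (snd \<iota>) + k = d}"
      obtain j V where \<iota>_eq: "\<iota> = (j, V)" by (cases \<iota>)
      have jV: "(j, V) \<in> J'" "card V + k = d" using \<iota> by (auto simp: \<iota>_eq)
      have "V \<inter> {..<n} = V"
        by (rule card_seteq[OF V(2)[OF jV(1)]]) (use le[OF jV(1)] jV(2) in auto)
      then show "\<iota> \<in> ?Jt - {?\<iota>\<^sub>0}" using V(1)[OF jV(1)] jV by (auto simp: \<iota>_eq J'_def)
    qed
    then have "card {\<iota>\<in>J'. card (snd \<iota>) + k = d} \<le> card (?Jt - {?\<iota>\<^sub>0})"
      by (rule card_mono[rotated]) (use finJ in auto)
    also have "\<dots> < card ?Jt"
      by (rule card_Diff1_less) (use finJ \<iota>\<^sub>0 in auto)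
    finally show "card {\<iota>\<in>J'. card (snd \<iota>) + k = d} < card ?Jt" .
  qed
qed

text \<open>This expresses that the quotient of \<open>B\<close> by \<open>A\<close> is a finite
  direct sum of standard objects, by a basis modulo \<open>A\<close> that the group permutes modulo
  \<open>A\<^sub>0\<close>. Stated inside one vector space, it can be compared between
  levels.\<close>

definition std_step :: "nat \<Rightarrow> 'v set \<Rightarrow> 'v set \<Rightarrow> bool"
  where "std_step n A B \<longleftrightarrow> (\<exists>J. admissible d n J \<and> B = span (A \<union> \<beta> ` indices d n J) \<and>
    independent_mod A \<beta> (indices d n J))"

inductive filtered :: "nat \<Rightarrow> 'v set \<Rightarrow> bool" for n
  where base: "filtered n A\<^sub>0"
  | step: "filtered n A \<Longrightarrow> std_step n A B \<Longrightarrow> filtered n B"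

text \<open>Shifting a standard object further gives a standard object: the sets indexing the basis
  are sorted by their intersection with the newly fixed points. Refinement only reindexes the
  family, so its span and its independence are kept. Steps found at different levels can thus be
  lifted to a common one.\<close>

lemma std_step_mono:
  assumes "std_step n A B" "n \<le> m"
  shows "std_step m A B"
proof -
  obtain J where J: "admissible d n J" "B = span (A \<union> \<beta> ` indices d n J)"
    "independent_mod A \<beta> (indices d n J)"
    using assms(1) by (auto simp: std_step_def)
  note bij = bij_betw_coarsen_index[OF assms(2) J(1)]
  have "\<beta> ` indices d m (refine d n m J) = \<beta> ` (coarsen_index n ` indices d m (refine d n m J))"
    by (simp add: image_image \<beta>_coarsen)
  also have "\<dots> = \<beta> ` indices d n J" using bij by (simp add: bij_betw_def)
  finally show ?thesis
    unfolding std_step_def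
    using J(2) admissible_refine[OF J(1)] independent_mod_reindex[OF J(3) bij] \<beta>_coarsen by metis
qed

lemma Sp_empty: "Sp n {} = A\<^sub>0"
proof -
  have "indices d n ({} :: 'i label set) = {}" by (auto simp: indices_def)
  then show ?thesis using subspace_base by (simp add: Sp_def)
qed

text \<open>Lexicographic induction on a strict bound \<open>k\<close> for the sizes \<open>d - card U\<close> and the number of
  labels of the largest size.\<close>

lemma eventually_filtered:
  assumes "admissible d n J" "\<forall>\<iota>\<in>J. d < card (snd \<iota>) + k"
  shows "\<exists>m\<ge>n. filtered m (Sp n J)"
  using assms
proof (induction k arbitrary: n J)
  case 0
  \<comment> \<open>For \<open>k = 0\<close> the strict bound asks for labels with more than
    \<open>d\<close> points, which admissibility excludes.\<close>
  then have "J = {}" by (force simp: admissible_def)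
  then show ?case by (auto simp: Sp_empty intro: filtered.base)
next
  case (Suc k)
  note outer = Suc.IH
  from Suc.prems show ?case
  proof (induction "card {\<iota>\<in>J. card (snd \<iota>) + k = d}" arbitrary: n J rule: less_induct)
    case less
    let ?Jl = "{\<iota>\<in>J. card (snd \<iota>) + k \<noteq> d}" and ?Jt = "{\<iota>\<in>J. card (snd \<iota>) + k = d}"
    have le: "\<forall>\<iota>\<in>J. d \<le> card (snd \<iota>) + k" using less.prems(2) by auto
    show ?case
    proof (cases "independent_mod (Sp n ?Jl) \<beta> (indices d n ?Jt)")
      case True
      have "Sp n J = span (Sp n ?Jl \<union> \<beta> ` indices d n ?Jt)"
      proof
        have "indices d n J = indices d n ?Jl \<union> indices d n ?Jt" by (auto simp: indices_def)
        then have "\<beta> t \<in> span (Sp n ?Jl \<union> \<beta> ` indices d n ?Jt)" if "t \<in> indices d n J" for t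
          using that \<beta>_in_Sp[of t n ?Jl] by (intro span_base) blast
        moreover have "A\<^sub>0 \<subseteq> span (Sp n ?Jl \<union> \<beta> ` indices d n ?Jt)"
          using base_subset_Sp[of n ?Jl] span_superset by blast
        ultimately show "Sp n J \<subseteq> span (Sp n ?Jl \<union> \<beta> ` indices d n ?Jt)"
          by (intro Sp_minimal) simp_all
        have "Sp n ?Jl \<subseteq> Sp n J"
          by (rule Sp_minimal[OF subspace_Sp base_subset_Sp]) (auto intro!: \<beta>_in_Sp simp: indices_def)
        then show "span (Sp n ?Jl \<union> \<beta> ` indices d n ?Jt) \<subseteq> Sp n J"
          by (intro span_minimal subspace_Sp Un_least) (auto intro!: \<beta>_in_Sp simp: indices_def)
      qed
      then have step: "std_step n (Sp n ?Jl) (Sp n J)"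
        using True admissible_subset[OF less.prems(1), of ?Jt] by (auto simp: std_step_def)
      have "\<exists>m\<ge>n. filtered m (Sp n ?Jl)"
      proof (rule outer)
        show "admissible d n ?Jl" using less.prems(1) by (rule admissible_subset) auto
        show "\<forall>\<iota>\<in>?Jl. d < card (snd \<iota>) + k" using le by force
      qed
      then obtain m where "n \<le> m" "filtered m (Sp n ?Jl)" by blast
      \<comment> \<open>The smaller families may need a level \<open>m\<close> beyond
        \<open>n\<close>. Their span is still the same subspace, and the step on top of it is raised
        to level \<open>m\<close>.\<close>
      then show ?thesis using step by (blast intro: filtered.step std_step_mono)
    next
      case False
      obtain m J' where *: "n \<le> m" "admissible d m J'" "Sp m J' = Sp n J"
        "\<forall>\<iota>\<in>J'. d \<le> card (snd \<iota>) + k"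
        "card {\<iota>\<in>J'. card (snd \<iota>) + k = d} < card ?Jt"
        using drop_dependent_label[OF less.prems(1) le False] by blast
      have "\<exists>l\<ge>m. filtered l (Sp m J')"
        by (rule less.hyps[OF *(5,2)]) (use *(4) in \<open>simp add: less_Suc_eq_le\<close>)
      then show ?thesis using * by (metis order_trans)
    qed
  qed
qed

lemma filtered_properties:
  assumes "filtered n B"
  shows "subspace B" "A\<^sub>0 \<subseteq> B" "stable n B"
proof -
  from assms have "subspace B \<and> A\<^sub>0 \<subseteq> B \<and> stable n B"
  proof induction
    case base
    then show ?case by (simp add: subspace_base stable_base)
  next
    case (step A B)
    then obtain J where "admissible d n J" "B = span (A \<union> \<beta> ` indices d n J)"
      by (auto simp: std_step_def)
    then show ?case using step.IH stable_span_family by (auto intro: span_base)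
  qed
  then show "subspace B" "A\<^sub>0 \<subseteq> B" "stable n B" by auto
qed

lemma filtered_sequence:
  assumes "filtered n B"
  shows "\<exists>(s::nat) N. N 0 = A\<^sub>0 \<and> N s = B \<and> (\<forall>i\<le>s. filtered n (N i)) \<and>
    (\<forall>i<s. std_step n (N i) (N (Suc i)))"
  using assms
proof induction
  case base
  show ?case by (intro exI[of _ 0] exI[of _ "\<lambda>_. A\<^sub>0"]) (auto intro: filtered.base)
next
  case (step A B)
  then obtain s :: nat and N where N: "N 0 = A\<^sub>0" "N s = A" "\<forall>i\<le>s. filtered n (N i)"
    "\<forall>i<s. std_step n (N i) (N (Suc i))" by blast
  show ?case
  proof (intro exI conjI allI impI)
    show "(N(Suc s := B)) 0 = A\<^sub>0" "(N(Suc s := B)) (Suc s) = B" using N by simp_all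
    show "filtered n ((N(Suc s := B)) i)" if "i \<le> Suc s" for i
      using that N(3) filtered.step[OF step.hyps] by (auto simp: le_Suc_eq)
    show "std_step n ((N(Suc s := B)) i) ((N(Suc s := B)) (Suc i))" if "i < Suc s" for i
      using that N(2,4) step.hyps by (auto simp: less_Suc_eq)
  qed
qed

end

text \<open>The number \<open>d\<close> has two roles: it is a common smoothness level for all
  generators, and hence the size of the sets that index every family derived from them.\<close>

locale generated_semilinear = semilinear scale ac A\<^sub>0
  for scale :: "'k::field ratfun \<Rightarrow> 'v::ab_group_add \<Rightarrow> 'v"  (infixr \<open>*s\<close> 75) and ac A\<^sub>0 +
  fixes d :: nat and X :: "'v set"
  assumes finite_X: "finite X"
    and X_fixed: "x \<in> X \<Longrightarrow> \<sigma> \<in> fix_below d \<Longrightarrow> ac \<sigma> x - x \<in> A\<^sub>0"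
    and X_span: "span (A\<^sub>0 \<union> {ac \<sigma> x |\<sigma> x. x \<in> X}) = UNIV"
begin

text \<open>Here the families are labelled by the vectors themselves; only finitely many invariant
  ones are selected afterwards.\<close>

sublocale equivariant_family scale ac A\<^sub>0 d "orbit_family d"
  by unfold_locales (rule orbit_family_ac)

text \<open>Descent expresses each generator through finitely many invariant vectors. Every
  translate of such a vector is, modulo \<open>A\<^sub>0\<close>, a member of its orbit family, so
  finitely many families span the whole space.\<close>

lemma ex_filtered_UNIV: "\<exists>n. filtered n UNIV"
proof -
  have "\<exists>t. finite t \<and> t \<subseteq> invariants d \<and> x \<in> span t" if x: "x \<in> X" for x
  proof -
    have "x \<in> span (invariants d)" using X_fixed[OF x] by (rule in_span_invariants)
    then obtain t r where t: "finite t" "t \<subseteq> invariants d" "x = (\<Sum>a\<in>t. r a *s a)"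
      unfolding span_explicit by blast
    then have "x \<in> span t" by (metis (no_types, lifting) span_base span_scale span_sum)
    then show ?thesis using t by blast
  qed
  then have "\<forall>x\<in>X. \<exists>t. finite t \<and> t \<subseteq> invariants d \<and> x \<in> span t" by blast
  from bchoice[OF this] obtain t where
    t: "\<And>x. x \<in> X \<Longrightarrow> finite (t x) \<and> t x \<subseteq> invariants d \<and> x \<in> span (t x)" by blast
  define Z where "Z = (\<Union>x\<in>X. t x)"
  have Z: "finite Z" "Z \<subseteq> invariants d" using t finite_X by (auto simp: Z_def)
  have XZ: "x \<in> span Z" if "x \<in> X" for x
    using t[OF that] span_mono[of "t x" Z] that by (auto simp: Z_def)
  \<comment> \<open>At level 0 no point is fixed, so labels carry the empty set and all families
    have the full size \<open>d\<close>; this is why the strict bound below is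
    \<open>Suc d\<close>.\<close>
  define J where "J = (\<lambda>z. (z, {} :: nat set)) ` Z"
  have J: "admissible d 0 J" using Z(1) by (auto simp: J_def admissible_def)
  have "Sp 0 J = UNIV"
  proof -
    have Z_Sp: "ac \<sigma> z \<in> Sp 0 J" if z: "z \<in> Z" for \<sigma> z
    proof -
      let ?S = "(\<langle>$\<rangle>) \<sigma> ` {..<d}"
      have S: "finite ?S" "card ?S = d" by simp_all
      have "((z, {}), ?S) \<in> indices d 0 J" using z S by (auto simp: J_def indices_def)
      then have "\<beta> ((z, {}), ?S) \<in> Sp 0 J" by (rule \<beta>_in_Sp)
      then have "orbit_family d z ?S \<in> Sp 0 J" by (simp add: \<beta>_def)
      moreover have "ac \<sigma> z - orbit_family d z ?S \<in> Sp 0 J"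
        using invariant_cong[of z d \<sigma> "carry d ?S"] carry_image[OF S] z Z(2) base_subset_Sp[of 0 J]
        by (auto simp: orbit_family_def)
      ultimately show ?thesis using subspace_diff_iff[OF subspace_Sp] by blast
    qed
    have X_Sp: "ac \<sigma> x \<in> Sp 0 J" if "x \<in> X" for \<sigma> x
    proof -
      have "span Z \<subseteq> {v. ac \<sigma> v \<in> Sp 0 J}"
        by (rule span_minimal[OF _ subspace_vimage_ac[OF subspace_Sp]]) (use Z_Sp in auto)
      then show ?thesis using XZ[OF that] by auto
    qed
    have "span (A\<^sub>0 \<union> {ac \<sigma> x |\<sigma> x. x \<in> X}) \<subseteq> Sp 0 J"
      by (rule span_minimal[OF _ subspace_Sp]) (use X_Sp base_subset_Sp in auto)
    then show ?thesis using X_span by auto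
  qed
  moreover have "\<exists>m\<ge>0. filtered m (Sp 0 J)"
    by (rule eventually_filtered[OF J, of "Suc d"]) (simp add: J_def)
  ultimately show ?thesis by auto
qed

end


section \<open>Transport, shifts and quotients of representations\<close>

lemma ratfun_field_simps [simp]:
  "carrier (ratfun_field F) = ratfuns F UNIV"
  "monoid.mult (ratfun_field F) = (*)" "add (ratfun_field F) = (+)"
  "one (ratfun_field F) = 1" "zero (ratfun_field F) = 0"
  by (simp_all add: ratfun_field_def)

lemma cring_ratfun_field:
  assumes "subring_of F"
  shows "cring (ratfun_field F)"
proof -
  interpret R: subring_of "ratfuns F UNIV" using assms by (rule ratfuns_subring)
  show ?thesis
  proof (rule cringI)
    show "abelian_group (ratfun_field F)"
    proof (rule abelian_groupI)
      show "\<exists>y\<in>carrier (ratfun_field F). y \<oplus>\<^bsub>ratfun_field F\<^esub> x = \<zero>\<^bsub>ratfun_field F\<^esub>"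
        if "x \<in> carrier (ratfun_field F)" for x
        using that R.uminus[of x] by (intro bexI[of _ "- x"]) simp_all
    qed (simp_all add: R.add R.zero add.assoc add.commute)
    show "comm_monoid (ratfun_field F)"
      by (rule comm_monoidI) (simp_all add: R.mult R.one mult.assoc mult.commute)
  qed (simp_all add: distrib_right)
qed

text \<open>The natural map goes out of the direct sum \<open>D\<close>, while
  \<open>rep_iso F Q D\<close> asks for a map into it. The closure hypotheses make each operation of
  \<open>D\<close> land where the inverse undoes \<open>g\<close>.\<close>

lemma rep_iso_inverse:
  assumes g: "g \<in> rep_hom F D Q" and bij: "bij_betw g (carrier D) (carrier Q)"
    and add: "\<And>x y. x \<in> carrier D \<Longrightarrow> y \<in> carrier D \<Longrightarrow> x \<oplus>\<^bsub>D\<^esub> y \<in> carrier D"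
    and smult: "\<And>a x. a \<in> ratfuns F UNIV \<Longrightarrow> x \<in> carrier D \<Longrightarrow> a \<odot>\<^bsub>D\<^esub> x \<in> carrier D"
    and act: "\<And>\<sigma> x. x \<in> carrier D \<Longrightarrow> act D \<sigma> x \<in> carrier D"
  shows "rep_iso F Q D"
proof -
  define h where "h = inv_into (carrier D) g"
  have h_bij: "bij_betw h (carrier Q) (carrier D)"
    unfolding h_def using bij by (rule bij_betw_inv_into)
  have hC: "h u \<in> carrier D" if "u \<in> carrier Q" for u using h_bij that by (auto simp: bij_betw_def)
  have gh: "g (h u) = u" if "u \<in> carrier Q" for u
    using bij that unfolding h_def by (rule bij_betw_inv_into_right)
  have hg: "h (g x) = x" if "x \<in> carrier D" for x
    using bij that unfolding h_def by (rule bij_betw_inv_into_left)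
  have g_hom: "\<And>x y. x \<in> carrier D \<Longrightarrow> y \<in> carrier D \<Longrightarrow> g (x \<oplus>\<^bsub>D\<^esub> y) = g x \<oplus>\<^bsub>Q\<^esub> g y"
    "\<And>a x. a \<in> ratfuns F UNIV \<Longrightarrow> x \<in> carrier D \<Longrightarrow> g (a \<odot>\<^bsub>D\<^esub> x) = a \<odot>\<^bsub>Q\<^esub> g x"
    "\<And>\<sigma> x. x \<in> carrier D \<Longrightarrow> g (act D \<sigma> x) = act Q \<sigma> (g x)"
    using g by (auto simp: rep_hom_def)
  have "h \<in> rep_hom F Q D"
    unfolding rep_hom_def
  proof (intro CollectI conjI ballI allI)
    show "h \<in> carrier Q \<rightarrow> carrier D" using hC by auto
    show "h (u \<oplus>\<^bsub>Q\<^esub> v) = h u \<oplus>\<^bsub>D\<^esub> h v" if "u \<in> carrier Q" "v \<in> carrier Q" for u v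
      using hg[OF add[OF hC[OF that(1)] hC[OF that(2)]]] that by (simp add: g_hom hC gh)
    show "h (a \<odot>\<^bsub>Q\<^esub> u) = a \<odot>\<^bsub>D\<^esub> h u" if "a \<in> carrier (ratfun_field F)" "u \<in> carrier Q" for a u
      using hg[OF smult[OF _ hC[OF that(2)], of a]] that by (simp add: g_hom hC gh)
    show "h (act Q \<sigma> u) = act D \<sigma> (h u)" if "u \<in> carrier Q" for \<sigma> u
      using hg[OF act[OF hC[OF that]], of \<sigma>] that by (simp add: g_hom hC gh)
  qed
  then show ?thesis using h_bij by (auto simp: rep_iso_def)
qed

text \<open>Every axiom is an equation between operations or an existence statement, and both pass
  along a surjection compatible with the operations. The map \<open>q\<close> will be the projection
  onto cosets.\<close>

lemma smooth_semilinear_rep_image: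
  fixes M :: "('f::field ratfun, 'm, 'y) semirep_scheme" and Q :: "('f ratfun, 'q, 'z) semirep_scheme"
  assumes F: "subring_of F" and M: "smooth_semilinear_rep F M"
    and surj: "q ` carrier M = carrier Q"
    and add: "\<And>x y. x \<in> carrier M \<Longrightarrow> y \<in> carrier M \<Longrightarrow> q (x \<oplus>\<^bsub>M\<^esub> y) = q x \<oplus>\<^bsub>Q\<^esub> q y"
    and zero: "q \<zero>\<^bsub>M\<^esub> = \<zero>\<^bsub>Q\<^esub>"
    and smult: "\<And>a x. a \<in> ratfuns F UNIV \<Longrightarrow> x \<in> carrier M \<Longrightarrow> q (a \<odot>\<^bsub>M\<^esub> x) = a \<odot>\<^bsub>Q\<^esub> q x"
    and act: "\<And>\<sigma> x. x \<in> carrier M \<Longrightarrow> q (act M \<sigma> x) = act Q \<sigma> (q x)"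
  shows "smooth_semilinear_rep F Q"
proof -
  interpret M: smooth_semilinear_rep F M by fact
  have qC: "q x \<in> carrier Q" if "x \<in> carrier M" for x using surj that by blast
  have ex: "\<exists>x\<in>carrier M. u = q x" if "u \<in> carrier Q" for u using surj that by blast
  have neg: "\<exists>v\<in>carrier Q. v \<oplus>\<^bsub>Q\<^esub> u = \<zero>\<^bsub>Q\<^esub>" if u: "u \<in> carrier Q" for u
  proof -
    obtain x where x: "x \<in> carrier M" "u = q x" using ex[OF u] by blast
    then have "q (\<ominus>\<^bsub>M\<^esub> x) \<oplus>\<^bsub>Q\<^esub> u = \<zero>\<^bsub>Q\<^esub>"
      using add[of "\<ominus>\<^bsub>M\<^esub> x" x] by (simp add: M.M.l_neg zero)
    then show ?thesis using qC[of "\<ominus>\<^bsub>M\<^esub> x"] x(1) by (intro bexI[of _ "q (\<ominus>\<^bsub>M\<^esub> x)"]) simp_all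
  qed
  have "abelian_group Q"
  proof (rule abelian_groupI)
    fix u v w assume uvw: "u \<in> carrier Q" "v \<in> carrier Q" "w \<in> carrier Q"
    obtain x where x: "x \<in> carrier M" "u = q x" using ex[OF uvw(1)] by blast
    obtain y where y: "y \<in> carrier M" "v = q y" using ex[OF uvw(2)] by blast
    obtain z where z: "z \<in> carrier M" "w = q z" using ex[OF uvw(3)] by blast
    show "u \<oplus>\<^bsub>Q\<^esub> v \<in> carrier Q"
      using x y by (simp add: add[symmetric] qC)
    show "u \<oplus>\<^bsub>Q\<^esub> v = v \<oplus>\<^bsub>Q\<^esub> u"
      using x y by (simp add: add[symmetric] M.M.a_comm)
    show "u \<oplus>\<^bsub>Q\<^esub> v \<oplus>\<^bsub>Q\<^esub> w = u \<oplus>\<^bsub>Q\<^esub> (v \<oplus>\<^bsub>Q\<^esub> w)"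
      using x y z by (simp add: add[symmetric] M.M.a_assoc)
    show "\<zero>\<^bsub>Q\<^esub> \<oplus>\<^bsub>Q\<^esub> u = u"
      using x by (simp add: add[symmetric] zero[symmetric])
  next
    show "\<zero>\<^bsub>Q\<^esub> \<in> carrier Q" using qC[of "\<zero>\<^bsub>M\<^esub>"] zero by simp
  qed (rule neg)
  moreover have "module_axioms (ratfun_field F) Q"
  proof
    fix a u assume a: "a \<in> carrier (ratfun_field F)" and u: "u \<in> carrier Q"
    obtain x where x: "x \<in> carrier M" "u = q x" using ex[OF u] by blast
    show "a \<odot>\<^bsub>Q\<^esub> u \<in> carrier Q"
      using a x M.smult_closed[of a x] by (simp add: smult[symmetric] qC)
    show "(a \<oplus>\<^bsub>ratfun_field F\<^esub> b) \<odot>\<^bsub>Q\<^esub> u = a \<odot>\<^bsub>Q\<^esub> u \<oplus>\<^bsub>Q\<^esub> b \<odot>\<^bsub>Q\<^esub> u"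
      if "b \<in> carrier (ratfun_field F)" for b
      using a x that M.smult_l_distr[of a b x] M.R.a_closed[of a b] M.smult_closed[of _ x]
      by (simp add: smult[symmetric] add[symmetric])
    show "(a \<otimes>\<^bsub>ratfun_field F\<^esub> b) \<odot>\<^bsub>Q\<^esub> u = a \<odot>\<^bsub>Q\<^esub> (b \<odot>\<^bsub>Q\<^esub> u)"
      if "b \<in> carrier (ratfun_field F)" for b
      using a x that M.smult_assoc1[of a b x] M.R.m_closed[of a b] M.smult_closed[of _ x]
      by (simp add: smult[symmetric])
    show "a \<odot>\<^bsub>Q\<^esub> (u \<oplus>\<^bsub>Q\<^esub> v) = a \<odot>\<^bsub>Q\<^esub> u \<oplus>\<^bsub>Q\<^esub> a \<odot>\<^bsub>Q\<^esub> v" if v: "v \<in> carrier Q" for v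
    proof -
      obtain y where "y \<in> carrier M" "v = q y" using ex[OF v] by blast
      then show ?thesis
        using a x M.smult_r_distr[of a x y] M.smult_closed[of a] by (simp add: smult[symmetric] add[symmetric])
    qed
  next
    fix u assume u: "u \<in> carrier Q"
    obtain x where x: "x \<in> carrier M" "u = q x" using ex[OF u] by blast
    show "\<one>\<^bsub>ratfun_field F\<^esub> \<odot>\<^bsub>Q\<^esub> u = u"
      using x M.smult_one[of x] M.R.one_closed by (simp add: smult[symmetric])
  qed
  moreover have "smooth_semilinear_rep_axioms F Q"
  proof
    fix u \<sigma> assume u: "u \<in> carrier Q"
    obtain x where x: "x \<in> carrier M" "u = q x" using ex[OF u] by blast
    show "act Q \<sigma> u \<in> carrier Q" using x by (simp add: act[symmetric] qC M.act_closed)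
    show "act Q 1 u = u" using x by (simp add: act[symmetric] M.act_one)
    show "act Q (\<sigma> * \<tau>) u = act Q \<sigma> (act Q \<tau> u)" for \<tau>
      using x by (simp add: act[symmetric] M.act_mult M.act_closed)
    show "act Q \<sigma> (u \<oplus>\<^bsub>Q\<^esub> v) = act Q \<sigma> u \<oplus>\<^bsub>Q\<^esub> act Q \<sigma> v" if v: "v \<in> carrier Q" for v
    proof -
      obtain y where "y \<in> carrier M" "v = q y" using ex[OF v] by blast
      then show ?thesis using x by (simp add: act[symmetric] add[symmetric] M.act_add M.act_closed)
    qed
    show "act Q \<sigma> (a \<odot>\<^bsub>Q\<^esub> u) = perm_ratfun \<sigma> a \<odot>\<^bsub>Q\<^esub> act Q \<sigma> u"
      if a: "a \<in> carrier (ratfun_field F)" for a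
    proof -
      have "perm_ratfun \<sigma> a \<in> ratfuns F UNIV" using perm_ratfun_closed[OF F, of a] a by simp
      then show ?thesis
        using a x M.act_smult[of a x \<sigma>] M.act_closed[OF x(1)] M.smult_closed[of a x]
        by (simp add: smult[symmetric] act[symmetric])
    qed
    show "\<exists>m. \<forall>\<sigma>. (\<forall>i<m. \<sigma> \<langle>$\<rangle> i = i) \<longrightarrow> act Q \<sigma> u = u"
    proof -
      obtain m where m: "\<And>\<sigma>. (\<forall>i<m. \<sigma> \<langle>$\<rangle> i = i) \<Longrightarrow> act M \<sigma> x = x"
        using M.smooth[OF x(1)] by blast
      show ?thesis by (intro exI[of _ m] allI impI) (simp add: x act[OF x(1), symmetric] m)
    qed
  qed
  ultimately show ?thesis
    unfolding smooth_semilinear_rep_def Module.module_def using M.R.is_cring by blast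
qed

lemma smooth_semilinear_rep_shift:
  fixes M :: "('k::field ratfun, 'm, 'z) semirep_scheme"
  assumes "smooth_semilinear_rep UNIV M"
  shows "smooth_semilinear_rep (ratfuns UNIV {..<n}) (shift n M)"
proof -
  interpret M: smooth_semilinear_rep UNIV M by fact
  let ?F = "ratfuns (UNIV :: 'k set) {..<n}"
  have UNIV: "carrier (ratfun_field (UNIV :: 'k set)) = UNIV" by (simp add: ratfuns_UNIV)
  have [simp]: "carrier (shift n M) = carrier M" "add (shift n M) = add M" "zero (shift n M) = zero M"
    "smult (shift n M) = (\<lambda>a x. shift_scalar n a \<odot>\<^bsub>M\<^esub> x)"
    "act (shift n M) = (\<lambda>\<sigma>. act M (shift_perm n \<sigma>))"
    by (simp_all add: shift_def)
  have "abelian_group (shift n M)"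
    by (rule abelian_groupI) (auto simp: M.M.a_ac intro: bexI[of _ "\<ominus>\<^bsub>M\<^esub> _"] M.M.l_neg)
  moreover have "module_axioms (ratfun_field ?F) (shift n M)"
    by unfold_locales
      (simp_all add: UNIV M.smult_closed M.smult_l_distr[unfolded ratfun_field_simps] M.smult_r_distr
        M.smult_assoc1[unfolded ratfun_field_simps] M.smult_one[unfolded ratfun_field_simps]
        shift_hom.subst_add shift_hom.subst_mult shift_hom.subst_one ratfuns_UNIV)
  moreover have "smooth_semilinear_rep_axioms ?F (shift n M)"
  proof
    fix x \<sigma> assume x: "x \<in> carrier (shift n M)"
    show "act (shift n M) \<sigma> x \<in> carrier (shift n M)" using x by (simp add: M.act_closed)
    show "act (shift n M) 1 x = x" using x by (simp add: M.act_one shift_perm_1)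
    show "act (shift n M) (\<sigma> * \<tau>) x = act (shift n M) \<sigma> (act (shift n M) \<tau> x)" for \<tau>
      using x by (simp add: M.act_mult shift_perm_times)
    show "act (shift n M) \<sigma> (x \<oplus>\<^bsub>shift n M\<^esub> y) =
        act (shift n M) \<sigma> x \<oplus>\<^bsub>shift n M\<^esub> act (shift n M) \<sigma> y" if "y \<in> carrier (shift n M)" for y
      using x that by (simp add: M.act_add)
    show "act (shift n M) \<sigma> (a \<odot>\<^bsub>shift n M\<^esub> x) =
        perm_ratfun \<sigma> a \<odot>\<^bsub>shift n M\<^esub> act (shift n M) \<sigma> x"
      if "a \<in> carrier (ratfun_field ?F)" for a
      using x that by (simp add: M.act_smult ratfuns_UNIV shift_scalar_perm)
    obtain m where m: "\<And>\<sigma>. (\<forall>i<m. \<sigma> \<langle>$\<rangle> i = i) \<Longrightarrow> act M \<sigma> x = x"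
      using M.smooth[of x] x by auto
    \<comment> \<open>If \<sigma> fixes all points below \<open>m\<close>, then
      \<open>shift_perm n \<sigma>\<close> fixes them too, so the smoothness level in
      \<open>M\<close> serves for the shift.\<close>
    show "\<exists>m. \<forall>\<sigma>. (\<forall>i<m. \<sigma> \<langle>$\<rangle> i = i) \<longrightarrow> act (shift n M) \<sigma> x = x"
      by (intro exI[of _ m] allI impI) (simp add: m shift_perm_apply)
  qed
  ultimately show ?thesis
    unfolding smooth_semilinear_rep_def Module.module_def
    using cring_ratfun_field[OF subring_coeff] by blast
qed

lemma smooth_semilinear_rep_subrep:
  assumes M: "smooth_semilinear_rep F M" and N: "subrep F N M"
  shows "smooth_semilinear_rep F (M\<lparr>carrier := N\<rparr>)"
proof -
  interpret M: smooth_semilinear_rep F M by fact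
  have sub: "submodule N (ratfun_field F) M" using N by (simp add: subrep_def)
  have "N \<subseteq> carrier M" by (rule M.submoduleE(1)[OF sub])
  then have NM: "x \<in> carrier M" if "x \<in> N" for x using that by blast
  have "Module.module (ratfun_field F) (M\<lparr>carrier := N\<rparr>)"
    by (rule submodule.submodule_is_module[OF sub]) (rule M.module_axioms)
  moreover have "smooth_semilinear_rep_axioms F (M\<lparr>carrier := N\<rparr>)"
    using N by unfold_locales
      (simp_all add: NM M.act_one M.act_mult M.act_add M.act_smult M.smooth subrep_def)
  ultimately show ?thesis by (rule smooth_semilinear_rep.intro)
qed

section \<open>Quotients by subrepresentations\<close>

context
  fixes F :: "'f::field set" and M :: "('f ratfun, 'm, 'z) semirep_scheme" and N
  assumes F: "subring_of F" and M: "smooth_semilinear_rep F M" and N: "subrep F N M"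
begin

interpretation M: smooth_semilinear_rep F M by (rule M)

lemma subrep_abelian_subgroup: "abelian_subgroup N M"
proof -
  have "submodule N (ratfun_field F) M" using N by (simp add: subrep_def)
  then have "subgroup N (add_monoid M)" by (simp add: submodule_def)
  then show ?thesis
    by (intro abelian_subgroupI3 additive_subgroup.intro) (auto intro: M.M.abelian_group_axioms)
qed

interpretation N: abelian_subgroup N M by (rule subrep_abelian_subgroup)

lemma coset_eq_iff:
  assumes "x \<in> carrier M" "y \<in> carrier M"
  shows "N +>\<^bsub>M\<^esub> x = N +>\<^bsub>M\<^esub> y \<longleftrightarrow> x \<ominus>\<^bsub>M\<^esub> y \<in> N"
proof -
  have "x \<in> N +>\<^bsub>M\<^esub> y \<longleftrightarrow> x \<ominus>\<^bsub>M\<^esub> y \<in> N"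
    using N.a_rcos_module[OF assms(2,1)] by (simp add: a_minus_def)
  moreover have "N +>\<^bsub>M\<^esub> y = N +>\<^bsub>M\<^esub> x" if "x \<in> N +>\<^bsub>M\<^esub> y"
    by (rule M.M.a_repr_independence[OF that assms(2) N.a_subgroup])
  moreover have "x \<in> N +>\<^bsub>M\<^esub> x" using assms(1) by (rule N.a_rcos_self)
  ultimately show ?thesis by metis
qed

lemma quot_rep_add:
  assumes "x \<in> carrier M" "y \<in> carrier M"
  shows "N +>\<^bsub>M\<^esub> (x \<oplus>\<^bsub>M\<^esub> y) = (N +>\<^bsub>M\<^esub> x) \<oplus>\<^bsub>quot_rep M N\<^esub> (N +>\<^bsub>M\<^esub> y)"
  using N.a_rcos_sum assms by (simp add: quot_rep_def)

text \<open>The operations of \<open>quot_rep\<close> are unions over all representatives of a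
  coset. An additive map preserving \<open>N\<close> sends them all into one coset, so the union is
  that coset; scalars and permutations are both instances.\<close>

lemma union_coset_image:
  assumes f_closed: "\<And>y. y \<in> carrier M \<Longrightarrow> f y \<in> carrier M"
    and f_add: "\<And>y z. y \<in> carrier M \<Longrightarrow> z \<in> carrier M \<Longrightarrow> f (y \<oplus>\<^bsub>M\<^esub> z) = f y \<oplus>\<^bsub>M\<^esub> f z"
    and f_N: "\<And>y. y \<in> N \<Longrightarrow> f y \<in> N" and x: "x \<in> carrier M"
  shows "(\<Union>y \<in> N +>\<^bsub>M\<^esub> x. N +>\<^bsub>M\<^esub> f y) = N +>\<^bsub>M\<^esub> f x"
proof -
  have "N +>\<^bsub>M\<^esub> f y = N +>\<^bsub>M\<^esub> f x" if y: "y \<in> N +>\<^bsub>M\<^esub> x" for y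
  proof -
    obtain h where h: "h \<in> N" "y = h \<oplus>\<^bsub>M\<^esub> x"
      using y by (auto simp: a_r_coset_def')
    then have hM: "h \<in> carrier M" using N.a_subset by blast
    have "f y = f h \<oplus>\<^bsub>M\<^esub> f x" using h hM x f_add by simp
    then have "f y \<in> N +>\<^bsub>M\<^esub> f x" using f_N[OF h(1)] by (auto simp: a_r_coset_def')
    then show ?thesis using M.M.a_repr_independence[OF _ f_closed[OF x] N.a_subgroup] by metis
  qed
  moreover have "x \<in> N +>\<^bsub>M\<^esub> x" using x by (rule N.a_rcos_self)
  ultimately show ?thesis by blast
qed

lemma quot_rep_smult:
  assumes "a \<in> ratfuns F UNIV" "x \<in> carrier M"
  shows "N +>\<^bsub>M\<^esub> (a \<odot>\<^bsub>M\<^esub> x) = a \<odot>\<^bsub>quot_rep M N\<^esub> (N +>\<^bsub>M\<^esub> x)"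
proof -
  have sub: "submodule N (ratfun_field F) M" using N by (simp add: subrep_def)
  show ?thesis
    using assms union_coset_image[of "\<lambda>y. a \<odot>\<^bsub>M\<^esub> y" x] M.smult_closed[of a] M.smult_r_distr[of a]
      submodule.smult_closed[OF sub, of a]
    by (simp add: quot_rep_def)
qed

lemma quot_rep_act:
  assumes "x \<in> carrier M"
  shows "N +>\<^bsub>M\<^esub> (act M \<sigma> x) = act (quot_rep M N) \<sigma> (N +>\<^bsub>M\<^esub> x)"
  using assms union_coset_image[of "act M \<sigma>" x] N
  by (simp add: quot_rep_def M.act_closed M.act_add subrep_def)

lemma quot_rep_carrier: "(\<lambda>x. N +>\<^bsub>M\<^esub> x) ` carrier M = carrier (quot_rep M N)"
  by (auto simp: quot_rep_def A_RCOSETS_def')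

lemma quot_rep_zero: "N +>\<^bsub>M\<^esub> \<zero>\<^bsub>M\<^esub> = \<zero>\<^bsub>quot_rep M N\<^esub>"
  using N.a_subset M.M.a_coset_add_zero by (simp add: quot_rep_def)

lemma smooth_semilinear_rep_quot: "smooth_semilinear_rep F (quot_rep M N)"
  by (rule smooth_semilinear_rep_image[OF F M quot_rep_carrier quot_rep_add quot_rep_zero
        quot_rep_smult quot_rep_act])

end


section \<open>Standard quotients\<close>

lemma lookup_map_mult: "Poly_Mapping.lookup (Poly_Mapping.map ((*) a) p) x = a * Poly_Mapping.lookup p x"
  for a :: "'a::mult_zero"
  by transfer (simp add: when_def)

lemma keys_map_mult: "Poly_Mapping.keys (Poly_Mapping.map ((*) a) p) \<subseteq> Poly_Mapping.keys p"
  for a :: "'a::mult_zero"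
  by (auto simp: in_keys_iff lookup_map_mult)

definition perm_std :: "nat perm \<Rightarrow> (nat set \<Rightarrow>\<^sub>0 'f::field ratfun) \<Rightarrow> (nat set \<Rightarrow>\<^sub>0 'f ratfun)"
  where "perm_std \<sigma> p = (\<Sum>S \<in> Poly_Mapping.keys p.
      Poly_Mapping.single ((\<langle>$\<rangle>) \<sigma> ` S) (perm_ratfun \<sigma> (Poly_Mapping.lookup p S)))"

lemma perm_image_eq_iff: "(\<langle>$\<rangle>) \<sigma> ` S = (\<langle>$\<rangle>) \<sigma> ` T \<longleftrightarrow> S = T"
  by (rule inj_image_eq_iff) (simp add: bij_is_inj)

lemma lookup_perm_std:
  "Poly_Mapping.lookup (perm_std \<sigma> p) ((\<langle>$\<rangle>) \<sigma> ` S) = perm_ratfun \<sigma> (Poly_Mapping.lookup p S)"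
  by (auto simp: perm_std_def lookup_sum lookup_single when_def perm_image_eq_iff in_keys_iff
      perm_ratfun_zero)

lemma keys_perm_std: "Poly_Mapping.keys (perm_std \<sigma> p) \<subseteq> (`) ((\<langle>$\<rangle>) \<sigma>) ` Poly_Mapping.keys p"
  unfolding perm_std_def by (rule order.trans[OF keys_sum]) (auto split: if_splits)

context
  fixes F :: "'f::field set"
  assumes F: "subring_of F"
begin

interpretation R: subring_of "ratfuns F UNIV" using F by (rule ratfuns_subring)

lemma lookup_std_rep:
  assumes "p \<in> carrier (std_rep F r)"
  shows "Poly_Mapping.lookup p S \<in> ratfuns F UNIV"
proof (cases "S \<in> Poly_Mapping.keys p")
  case True
  then show ?thesis using assms by (simp add: std_rep_def)
next
  case False
  then show ?thesis by (simp add: in_keys_iff R.zero)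
qed

lemma keys_std_rep:
  "p \<in> carrier (std_rep F r) \<Longrightarrow> S \<in> Poly_Mapping.keys p \<Longrightarrow> finite S \<and> card S = r"
  by (simp add: std_rep_def)

lemma std_rep_carrierI:
  assumes "\<And>S. Poly_Mapping.lookup p S \<in> ratfuns F UNIV"
    and "\<And>S. S \<in> Poly_Mapping.keys p \<Longrightarrow> finite S \<and> card S = r"
  shows "p \<in> carrier (std_rep F r)"
  using assms by (simp add: std_rep_def)

lemma std_rep_add_closed:
  assumes "p \<in> carrier (std_rep F r)" "q \<in> carrier (std_rep F r)"
  shows "p + q \<in> carrier (std_rep F r)"
proof (rule std_rep_carrierI)
  show "Poly_Mapping.lookup (p + q) S \<in> ratfuns F UNIV" for S
    using assms by (simp add: lookup_add R.add lookup_std_rep)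
  show "finite S \<and> card S = r" if "S \<in> Poly_Mapping.keys (p + q)" for S
    using that keys_add[of p q] keys_std_rep assms by blast
qed

lemma std_rep_smult_closed:
  assumes "a \<in> ratfuns F UNIV" "p \<in> carrier (std_rep F r)"
  shows "Poly_Mapping.map ((*) a) p \<in> carrier (std_rep F r)"
proof (rule std_rep_carrierI)
  show "Poly_Mapping.lookup (Poly_Mapping.map ((*) a) p) S \<in> ratfuns F UNIV" for S
    using assms by (simp add: lookup_map_mult R.mult lookup_std_rep)
  show "finite S \<and> card S = r" if "S \<in> Poly_Mapping.keys (Poly_Mapping.map ((*) a) p)" for S
    using that keys_map_mult[of a p] keys_std_rep assms by blast
qed

lemma std_rep_act_closed:
  assumes "p \<in> carrier (std_rep F r)"
  shows "perm_std \<sigma> p \<in> carrier (std_rep F r)"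
proof (rule std_rep_carrierI)
  show "Poly_Mapping.lookup (perm_std \<sigma> p) S \<in> ratfuns F UNIV" for S
  proof -
    have "S = (\<langle>$\<rangle>) \<sigma> ` ((\<langle>$\<rangle>) (inverse \<sigma>) ` S)" by (simp add: image_image)
    then show ?thesis
      using lookup_perm_std[of \<sigma> p] perm_ratfun_closed[OF F lookup_std_rep[OF assms]] by metis
  qed
  show "finite S \<and> card S = r" if "S \<in> Poly_Mapping.keys (perm_std \<sigma> p)" for S
  proof -
    obtain S' where "S' \<in> Poly_Mapping.keys p" "S = (\<langle>$\<rangle>) \<sigma> ` S'"
      using \<open>S \<in> _\<close> keys_perm_std by blast
    then show ?thesis using keys_std_rep[OF assms] by simp
  qed
qed

lemma std_rep_zero_closed: "0 \<in> carrier (std_rep F r)"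
  by (simp add: std_rep_def)

lemma std_rep_single_closed:
  "finite S \<Longrightarrow> card S = r \<Longrightarrow> a \<in> ratfuns F UNIV \<Longrightarrow> Poly_Mapping.single S a \<in> carrier (std_rep F r)"
  by (auto simp: std_rep_def)

end

lemma std_rep_ops [simp]:
  "add (std_rep F r) = (+)" "zero (std_rep F r) = 0"
  "smult (std_rep F r) = (\<lambda>a. Poly_Mapping.map ((*) a))" "act (std_rep F r) = perm_std"
  by (simp_all add: std_rep_def perm_std_def[abs_def])

lemma carrier_direct_sum: "finite J \<Longrightarrow> carrier (direct_sum J N) = (\<Pi>\<^sub>E j\<in>J. carrier (N j))"
  by (simp add: direct_sum_def)

lemma direct_sum_ops [simp]:
  "add (direct_sum J N) = (\<lambda>x y. \<lambda>j\<in>J. x j \<oplus>\<^bsub>N j\<^esub> y j)"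
  "smult (direct_sum J N) = (\<lambda>a x. \<lambda>j\<in>J. a \<odot>\<^bsub>N j\<^esub> x j)"
  "act (direct_sum J N) = (\<lambda>\<sigma> x. \<lambda>j\<in>J. act (N j) \<sigma> (x j))"
  by (simp_all add: direct_sum_def)

lemma shift_perm_image: "(\<langle>$\<rangle>) (shift_perm n \<sigma>) ` (\<lambda>i. i + n) ` S = (\<lambda>i. i + n) ` (\<langle>$\<rangle>) \<sigma> ` S"
  unfolding image_image by (rule image_cong) (simp_all add: shift_perm_apply)

lemma shift_perm_fix_below: "shift_perm n \<sigma> \<in> fix_below n"
  by (simp add: fix_below_def shift_perm_apply)

section \<open>Linear maps out of standard objects of the shifted category\<close>

context semilinear
begin

text \<open>On \<open>std_rep (ratfuns UNIV {..<n}) r\<close> this is the linear map that sends the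
  basis vector of \<open>S\<close> to \<open>f S\<close>, scalars being translated by
  \<open>shift_scalar\<close>.\<close>

definition lin_comb :: "nat \<Rightarrow> (nat set \<Rightarrow> 'v) \<Rightarrow> (nat set \<Rightarrow>\<^sub>0 'k ratfun ratfun) \<Rightarrow> 'v"
  where "lin_comb n f p = (\<Sum>S\<in>Poly_Mapping.keys p. shift_scalar n (Poly_Mapping.lookup p S) *s f S)"

lemma lin_comb_superset:
  assumes "finite X" "Poly_Mapping.keys p \<subseteq> X"
  shows "lin_comb n f p = (\<Sum>S\<in>X. shift_scalar n (Poly_Mapping.lookup p S) *s f S)"
  unfolding lin_comb_def
  by (rule sum.mono_neutral_left[OF assms]) (auto simp: in_keys_iff shift_hom.subst_zero)

abbreviation coeff_field :: "nat \<Rightarrow> 'k ratfun set"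
  where "coeff_field n \<equiv> ratfuns UNIV {..<n}"

lemma lin_comb_add:
  assumes "p \<in> carrier (std_rep (coeff_field n) r)" "q \<in> carrier (std_rep (coeff_field n) r)"
  shows "lin_comb n f (p + q) = lin_comb n f p + lin_comb n f q"
proof -
  let ?X = "Poly_Mapping.keys p \<union> Poly_Mapping.keys q"
  have "lin_comb n f (p + q) = (\<Sum>S\<in>?X. shift_scalar n (Poly_Mapping.lookup (p + q) S) *s f S)"
    by (rule lin_comb_superset) (simp_all add: keys_add)
  also have "\<dots> = (\<Sum>S\<in>?X. shift_scalar n (Poly_Mapping.lookup p S) *s f S) +
      (\<Sum>S\<in>?X. shift_scalar n (Poly_Mapping.lookup q S) *s f S)"
    using lookup_std_rep[OF subring_coeff assms(1)] lookup_std_rep[OF subring_coeff assms(2)]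
    by (simp add: lookup_add shift_hom.subst_add scale_left_distrib sum.distrib)
  also have "\<dots> = lin_comb n f p + lin_comb n f q"
    by (simp add: lin_comb_superset[of ?X])
  finally show ?thesis .
qed

lemma lin_comb_smult:
  assumes "p \<in> carrier (std_rep (coeff_field n) r)" "a \<in> ratfuns (coeff_field n) UNIV"
  shows "lin_comb n f (Poly_Mapping.map ((*) a) p) = shift_scalar n a *s lin_comb n f p"
proof -
  have "lin_comb n f (Poly_Mapping.map ((*) a) p) =
      (\<Sum>S\<in>Poly_Mapping.keys p. shift_scalar n (a * Poly_Mapping.lookup p S) *s f S)"
    by (subst lin_comb_superset[OF finite_keys keys_map_mult]) (simp add: lookup_map_mult)
  also have "\<dots> = shift_scalar n a *s lin_comb n f p"
    using lookup_std_rep[OF subring_coeff assms(1)] assms(2)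
    by (simp add: lin_comb_def shift_hom.subst_mult scale_sum_right)
  finally show ?thesis .
qed

lemma lin_comb_act:
  assumes p: "p \<in> carrier (std_rep (coeff_field n) r)"
    and f: "\<And>S. S \<in> Poly_Mapping.keys p \<Longrightarrow> ac (shift_perm n \<sigma>) (f S) - f ((\<langle>$\<rangle>) \<sigma> ` S) \<in> A\<^sub>0"
  shows "ac (shift_perm n \<sigma>) (lin_comb n f p) - lin_comb n f (perm_std \<sigma> p) \<in> A\<^sub>0"
proof -
  let ?\<tau> = "shift_perm n \<sigma>"
  have inj: "inj_on ((`) ((\<langle>$\<rangle>) \<sigma>)) (Poly_Mapping.keys p)"
    by (simp add: inj_on_def perm_image_eq_iff)
  have "lin_comb n f (perm_std \<sigma> p) = (\<Sum>S\<in>(`) ((\<langle>$\<rangle>) \<sigma>) ` Poly_Mapping.keys p.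
      shift_scalar n (Poly_Mapping.lookup (perm_std \<sigma> p) S) *s f S)"
    by (rule lin_comb_superset) (simp_all add: keys_perm_std)
  also have "\<dots> = (\<Sum>S\<in>Poly_Mapping.keys p.
      perm_ratfun ?\<tau> (shift_scalar n (Poly_Mapping.lookup p S)) *s f ((\<langle>$\<rangle>) \<sigma> ` S))"
    using lookup_std_rep[OF subring_coeff p]
    by (simp add: sum.reindex[OF inj] lookup_perm_std shift_scalar_perm)
  finally have "ac ?\<tau> (lin_comb n f p) - lin_comb n f (perm_std \<sigma> p) =
      (\<Sum>S\<in>Poly_Mapping.keys p. perm_ratfun ?\<tau> (shift_scalar n (Poly_Mapping.lookup p S)) *s
        (ac ?\<tau> (f S) - f ((\<langle>$\<rangle>) \<sigma> ` S)))"
    by (simp add: lin_comb_def ac_sum ac_scale scale_right_diff_distrib sum_subtractf)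
  then show ?thesis
    using f by (simp add: subspace_sum subspace_scale subspace_base)
qed

end

context equivariant_family
begin

text \<open>The map \<open>h\<close> presents \<open>Q\<close> as the quotient of \<open>B\<close>
  by \<open>A\<close>. The families of the step define a linear map \<open>G\<close> from a direct
  sum of standard objects to \<open>B\<close>; after composition with \<open>h\<close>, independence
  modulo \<open>A\<close> gives injectivity and the span condition gives surjectivity.\<close>

lemma std_step_rep_iso:
  fixes Q :: "('k ratfun ratfun, 'q, 'z) semirep_scheme" and h :: "'v \<Rightarrow> 'q"
  assumes step: "std_step n A B" and A: "subspace A" "A\<^sub>0 \<subseteq> A"
    and h_surj: "h ` B = carrier Q"
    and h_eq: "\<And>v w. v \<in> B \<Longrightarrow> w \<in> B \<Longrightarrow> h v = h w \<longleftrightarrow> v - w \<in> A"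
    and h_add: "\<And>v w. v \<in> B \<Longrightarrow> w \<in> B \<Longrightarrow> h (v + w) = h v \<oplus>\<^bsub>Q\<^esub> h w"
    and h_smult: "\<And>a v. a \<in> ratfuns (coeff_field n) UNIV \<Longrightarrow> v \<in> B \<Longrightarrow>
      h (shift_scalar n a *s v) = a \<odot>\<^bsub>Q\<^esub> h v"
    and h_act: "\<And>\<sigma> v. v \<in> B \<Longrightarrow> h (ac (shift_perm n \<sigma>) v) = act Q \<sigma> (h v)"
  shows "\<exists>(J :: 'q set) r. rep_iso (coeff_field n) Q (direct_sum J (\<lambda>j. std_rep (coeff_field n) (r j)))"
proof -
  let ?F = "coeff_field n"
  have F: "subring_of ?F" by (rule subring_coeff)
  obtain J where J: "admissible d n J" "B = span (A \<union> \<beta> ` indices d n J)"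
    "independent_mod A \<beta> (indices d n J)"
    using step by (auto simp: std_step_def)
  have finJ: "finite J" using J(1) by (simp add: admissible_def)
  have B: "subspace B" by (simp add: J(2))
  have AB: "A \<subseteq> B" and \<beta>B: "\<And>t. t \<in> indices d n J \<Longrightarrow> \<beta> t \<in> B"
    unfolding J(2) by (auto intro: span_base)
  define rk where "rk \<iota> = d - card (snd \<iota>)" for \<iota> :: "'i label"
  have indices_iff: "(\<iota>, S) \<in> indices d n J \<longleftrightarrow> \<iota> \<in> J \<and> finite S \<and> S \<subseteq> {n..} \<and> card S = rk \<iota>" for \<iota> S
  proof (cases \<iota>)
    case (Pair j U)
    show ?thesis
      using admissibleD(2)[OF J(1), of j U] by (auto simp: Pair indices_def rk_def)
  qed
  \<comment> \<open>The definition of \<open>standard\<close> wants an index set inside the type of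
    \<open>Q\<close>. Each label is encoded by the class of one member of its family, at the first
    \<open>rk \<iota>\<close> points from \<open>n\<close> on; independence, tested with
    coefficients 1 and -1, makes these classes distinct.\<close>
  define \<epsilon> where "\<epsilon> \<iota> = h (\<beta> (\<iota>, {n..<n + rk \<iota>}))" for \<iota>
  have inj: "inj_on \<epsilon> J"
  proof (rule inj_onI, rule ccontr)
    fix \<iota> \<kappa> assume *: "\<iota> \<in> J" "\<kappa> \<in> J" "\<epsilon> \<iota> = \<epsilon> \<kappa>" "\<iota> \<noteq> \<kappa>"
    let ?s = "(\<iota>, {n..<n + rk \<iota>})" and ?t = "(\<kappa>, {n..<n + rk \<kappa>})"
    have in_T: "?s \<in> indices d n J" "?t \<in> indices d n J" using * by (auto simp: indices_iff)
    then have "\<beta> ?s - \<beta> ?t \<in> A"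
      using h_eq[OF \<beta>B \<beta>B] *(3) by (simp add: \<epsilon>_def)
    moreover have "?s \<noteq> ?t" using *(4) by simp
    moreover define c where "c t = (if t = ?s then 1 else - 1 :: 'k ratfun)" for t
    ultimately have "(\<Sum>t\<in>{?s, ?t}. c t *s \<beta> t) \<in> A" by simp
    then have "c ?s = 0"
      using J(3)[unfolded independent_mod_def, rule_format, of "{?s, ?t}" c] in_T by blast
    then show False by (simp add: c_def)
  qed
  define J' where "J' = \<epsilon> ` J"
  define \<delta> where "\<delta> = inv_into J \<epsilon>"
  have finJ': "finite J'" using finJ by (simp add: J'_def)
  have \<delta>: "\<delta> j \<in> J" "\<epsilon> (\<delta> j) = j" if "j \<in> J'" for j
    using that unfolding J'_def \<delta>_def by (auto intro: inv_into_into f_inv_into_f)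
  have \<delta>_\<epsilon>: "\<delta> (\<epsilon> \<iota>) = \<iota>" if "\<iota> \<in> J" for \<iota>
    using inj that by (simp add: \<delta>_def)
  define r where "r j = rk (\<delta> j)" for j
  \<comment> \<open>Standard objects are indexed by arbitrary finite sets, families at level
    \<open>n\<close> by sets in \<open>{n..}\<close>; translation by \<open>n\<close> matches them
    and turns \<sigma> into \<open>shift_perm n \<sigma>\<close>.\<close>
  define f where "f j S = \<beta> (\<delta> j, (\<lambda>i. i + n) ` S)" for j S
  define T where "T = {(j, S :: nat set). j \<in> J' \<and> finite S \<and> card S = r j}"
  have card_shift: "card ((\<lambda>i. i + n) ` S) = card S" for S :: "nat set"
    by (rule card_image) simp
  have bij: "bij_betw (\<lambda>(j, S). (\<delta> j, (\<lambda>i. i + n) ` S)) T (indices d n J)"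
  proof (rule bij_betw_byWitness[where f' = "\<lambda>(\<iota>, S). (\<epsilon> \<iota>, (\<lambda>i. i - n) ` S)"])
    show "\<forall>t\<in>T. (case case t of (j, S) \<Rightarrow> (\<delta> j, (\<lambda>i. i + n) ` S) of (\<iota>, S) \<Rightarrow> (\<epsilon> \<iota>, (\<lambda>i. i - n) ` S)) = t"
      by (auto simp: T_def \<delta> image_image)
    have unshift: "(\<lambda>i. i + n) ` (\<lambda>i. i - n) ` S = S" if "S \<subseteq> {n..}" for S
    proof -
      have "(\<lambda>i. i - n + n) ` S = id ` S" by (rule image_cong) (use that in auto)
      then show ?thesis by (simp add: image_image)
    qed
    show "\<forall>t\<in>indices d n J. (case case t of (\<iota>, S) \<Rightarrow> (\<epsilon> \<iota>, (\<lambda>i. i - n) ` S) of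
        (j, S) \<Rightarrow> (\<delta> j, (\<lambda>i. i + n) ` S)) = t"
    proof
      fix t assume t: "t \<in> indices d n J"
      obtain \<iota> S where "t = (\<iota>, S)" by (cases t)
      then show "(case case t of (\<iota>, S) \<Rightarrow> (\<epsilon> \<iota>, (\<lambda>i. i - n) ` S) of
        (j, S) \<Rightarrow> (\<delta> j, (\<lambda>i. i + n) ` S)) = t"
        using t by (simp add: indices_iff \<delta>_\<epsilon> unshift del: image_image)
    qed
    show "(\<lambda>(j, S). (\<delta> j, (\<lambda>i. i + n) ` S)) ` T \<subseteq> indices d n J"
      using \<delta>(1) by (auto simp: T_def r_def indices_iff card_shift)
    have "card ((\<lambda>i. i - n) ` S) = card S" if "S \<subseteq> {n..}" for S
      using unshift[OF that] card_shift[of "(\<lambda>i. i - n) ` S"] by simp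
    then show "(\<lambda>(\<iota>, S). (\<epsilon> \<iota>, (\<lambda>i. i - n) ` S)) ` indices d n J \<subseteq> T"
      using indices_iff by (auto simp: T_def J'_def r_def \<delta>_\<epsilon>)
  qed
  have ind: "independent_mod A (\<lambda>(j, S). f j S) T"
    by (rule independent_mod_reindex[OF J(3) bij]) (auto simp: f_def)
  have T_indices: "(\<delta> j, (\<lambda>i. i + n) ` S) \<in> indices d n J" if "(j, S) \<in> T" for j S
    using bij that by (force simp: bij_betw_def)
  have fB: "f j S \<in> B" if "(j, S) \<in> T" for j S
    unfolding f_def by (rule \<beta>B[OF T_indices[OF that]])
  define D where "D = direct_sum J' (\<lambda>j. std_rep ?F (r j))"
  have carrier_D: "carrier D = (\<Pi>\<^sub>E j\<in>J'. carrier (std_rep ?F (r j)))"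
    unfolding D_def by (rule carrier_direct_sum[OF finJ'])
  have D_ops: "x \<oplus>\<^bsub>D\<^esub> y = (\<lambda>j\<in>J'. x j + y j)" "a \<odot>\<^bsub>D\<^esub> x = (\<lambda>j\<in>J'. Poly_Mapping.map ((*) a) (x j))"
    "act D \<sigma> x = (\<lambda>j\<in>J'. perm_std \<sigma> (x j))" for x y a \<sigma>
    by (simp_all add: D_def)
  have D_std: "x j \<in> carrier (std_rep ?F (r j))" if "x \<in> carrier D" "j \<in> J'" for x j
    using that by (auto simp: carrier_D)
  have D_keys: "(j, S) \<in> T" if "x \<in> carrier D" "j \<in> J'" "S \<in> Poly_Mapping.keys (x j)" for x j S
    using keys_std_rep[OF F D_std[OF that(1,2)] that(3)] that(2) by (simp add: T_def)
  have D_closed: "x \<oplus>\<^bsub>D\<^esub> y \<in> carrier D" if "x \<in> carrier D" "y \<in> carrier D" for x y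
    using that D_std by (auto simp: carrier_D D_ops intro: std_rep_add_closed[OF F])
  have D_smult: "a \<odot>\<^bsub>D\<^esub> x \<in> carrier D" if "a \<in> ratfuns ?F UNIV" "x \<in> carrier D" for a x
    using that D_std by (auto simp: carrier_D D_ops intro: std_rep_smult_closed[OF F])
  have D_act: "act D \<sigma> x \<in> carrier D" if "x \<in> carrier D" for \<sigma> x
    using that D_std by (auto simp: carrier_D D_ops intro: std_rep_act_closed[OF F])
  define G where "G x = (\<Sum>j\<in>J'. lin_comb n (f j) (x j))" for x
  have GB: "G x \<in> B" if "x \<in> carrier D" for x
    unfolding G_def lin_comb_def
    by (intro subspace_sum[OF B] subspace_scale[OF B] fB D_keys[OF that])
  have G_add: "G (x \<oplus>\<^bsub>D\<^esub> y) = G x + G y" if "x \<in> carrier D" "y \<in> carrier D" for x y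
    using lin_comb_add[OF D_std[OF that(1)] D_std[OF that(2)]]
    by (simp add: G_def D_ops sum.distrib)
  have G_smult: "G (a \<odot>\<^bsub>D\<^esub> x) = shift_scalar n a *s G x"
    if "a \<in> ratfuns ?F UNIV" "x \<in> carrier D" for a x
    using lin_comb_smult[OF D_std[OF that(2)] that(1)]
    by (simp add: G_def D_ops scale_sum_right)
  have G_act: "ac (shift_perm n \<sigma>) (G x) - G (act D \<sigma> x) \<in> A" if x: "x \<in> carrier D" for \<sigma> x
  proof -
    have "ac (shift_perm n \<sigma>) (lin_comb n (f j) (x j)) - lin_comb n (f j) (perm_std \<sigma> (x j)) \<in> A\<^sub>0"
      if j: "j \<in> J'" for j
    proof (rule lin_comb_act[OF D_std[OF x j]])
      fix S assume "S \<in> Poly_Mapping.keys (x j)"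
      then have "(j, S) \<in> T" by (rule D_keys[OF x j])
      from \<beta>_ac(2)[OF J(1) T_indices[OF this] shift_perm_fix_below]
      show "ac (shift_perm n \<sigma>) (f j S) - f j ((\<langle>$\<rangle>) \<sigma> ` S) \<in> A\<^sub>0"
        by (simp add: f_def shift_perm_image)
    qed
    then have "(\<Sum>j\<in>J'. ac (shift_perm n \<sigma>) (lin_comb n (f j) (x j)) -
        lin_comb n (f j) (perm_std \<sigma> (x j))) \<in> A\<^sub>0"
      by (intro subspace_sum subspace_base)
    moreover have "(\<Sum>j\<in>J'. ac (shift_perm n \<sigma>) (lin_comb n (f j) (x j)) -
        lin_comb n (f j) (perm_std \<sigma> (x j))) = ac (shift_perm n \<sigma>) (G x) - G (act D \<sigma> x)"
      by (simp add: G_def D_ops ac_sum sum_subtractf)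
    ultimately show ?thesis using A(2) by auto
  qed
  have G_inj: "x = y" if x: "x \<in> carrier D" and y: "y \<in> carrier D" and xy: "G x - G y \<in> A" for x y
  proof -
    define X where "X = (SIGMA j:J'. Poly_Mapping.keys (x j) \<union> Poly_Mapping.keys (y j))"
    have X: "finite X" "X \<subseteq> T"
      using finJ' D_keys[OF x] D_keys[OF y] by (auto simp: X_def)
    let ?c = "\<lambda>(j, S). shift_scalar n (Poly_Mapping.lookup (x j) S) - shift_scalar n (Poly_Mapping.lookup (y j) S)"
    have "(\<Sum>t\<in>X. ?c t *s (\<lambda>(j, S). f j S) t) = G x - G y"
    proof -
      have "(\<Sum>t\<in>X. ?c t *s (\<lambda>(j, S). f j S) t) = (\<Sum>j\<in>J'. \<Sum>S\<in>Poly_Mapping.keys (x j) \<union> Poly_Mapping.keys (y j).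
          ?c (j, S) *s f j S)"
        unfolding X_def by (subst sum.Sigma) (use finJ' in \<open>auto simp: split_def\<close>)
      also have "\<dots> = (\<Sum>j\<in>J'. lin_comb n (f j) (x j) - lin_comb n (f j) (y j))"
      proof (rule sum.cong[OF refl])
        fix j
        let ?Y = "Poly_Mapping.keys (x j) \<union> Poly_Mapping.keys (y j)"
        have "lin_comb n (f j) (x j) = (\<Sum>S\<in>?Y. shift_scalar n (Poly_Mapping.lookup (x j) S) *s f j S)"
          "lin_comb n (f j) (y j) = (\<Sum>S\<in>?Y. shift_scalar n (Poly_Mapping.lookup (y j) S) *s f j S)"
          by (rule lin_comb_superset; simp)+
        then show "(\<Sum>S\<in>?Y. ?c (j, S) *s f j S) = lin_comb n (f j) (x j) - lin_comb n (f j) (y j)"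
          by (simp add: scale_left_diff_distrib sum_subtractf)
      qed
      also have "\<dots> = G x - G y" by (simp add: G_def sum_subtractf)
      finally show ?thesis .
    qed
    with xy have "\<forall>t\<in>X. ?c t = 0"
      using ind[unfolded independent_mod_def, rule_format, OF X, of ?c] by simp
    then have eq: "shift_scalar n (Poly_Mapping.lookup (x j) S) = shift_scalar n (Poly_Mapping.lookup (y j) S)"
      if "(j, S) \<in> X" for j S using that by auto
    have "x j = y j" if j: "j \<in> J'" for j
    proof (rule poly_mapping_eqI)
      fix S
      show "Poly_Mapping.lookup (x j) S = Poly_Mapping.lookup (y j) S"
      proof (cases "(j, S) \<in> X")
        case True
        then show ?thesis
          using eq inj_onD[OF shift_hom.inj_on_subst] lookup_std_rep[OF F D_std[OF x j]]
            lookup_std_rep[OF F D_std[OF y j]] by blast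
      next
        case False
        then show ?thesis using j by (simp add: X_def in_keys_iff)
      qed
    qed
    then show ?thesis using x y by (auto simp: carrier_D intro: PiE_ext)
  qed
  have G_surj: "\<exists>x\<in>carrier D. v - G x \<in> A" if "v \<in> B" for v
  proof -
    \<comment> \<open>The vectors congruent modulo \<open>A\<close> to a value of \<open>G\<close>
      form a subspace, so it suffices to treat \<open>A\<close> and the family members. Closure
      under an arbitrary scalar of \<open>M\<close> is where the surjectivity of
      \<open>shift_scalar\<close> enters.\<close>
    let ?P = "{v. \<exists>x\<in>carrier D. v - G x \<in> A}"
    have zero: "(\<lambda>j\<in>J'. 0) \<in> carrier D" "G (\<lambda>j\<in>J'. 0) = 0"
      using std_rep_zero_closed[OF F] by (auto simp: carrier_D G_def lin_comb_def)
    have "subspace ?P"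
    proof (rule subspaceI)
      show "0 \<in> ?P" using zero subspace_0[OF A(1)] by (auto intro!: bexI[of _ "\<lambda>j\<in>J'. 0"])
      show "v + w \<in> ?P" if vw: "v \<in> ?P" "w \<in> ?P" for v w
      proof -
        obtain x y where x: "x \<in> carrier D" "v - G x \<in> A" and y: "y \<in> carrier D" "w - G y \<in> A"
          using vw by blast
        have "v + w - G (x \<oplus>\<^bsub>D\<^esub> y) \<in> A"
          using subspace_add[OF A(1) x(2) y(2)] by (simp add: G_add x y algebra_simps)
        then show ?thesis using D_closed[OF x(1) y(1)] by blast
      qed
      show "c *s v \<in> ?P" if v: "v \<in> ?P" for c v
      proof -
        obtain x where x: "x \<in> carrier D" "v - G x \<in> A" using v by blast
        obtain a where a: "a \<in> ratfuns ?F UNIV" "shift_scalar n a = c"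
          using shift_scalar_surj by blast
        have "c *s v - G (a \<odot>\<^bsub>D\<^esub> x) \<in> A"
          using subspace_scale[OF A(1) x(2), of c] by (simp add: G_smult a x scale_right_diff_distrib)
        then show ?thesis using D_smult[OF a(1) x(1)] by blast
      qed
    qed
    moreover have "A \<subseteq> ?P"
      using zero by (auto intro!: bexI[of _ "\<lambda>j\<in>J'. 0"])
    moreover have "\<beta> t \<in> ?P" if t: "t \<in> indices d n J" for t
    proof -
      have "t \<in> (\<lambda>(j, S). (\<delta> j, (\<lambda>i. i + n) ` S)) ` T"
        using bij_betw_imp_surj_on[OF bij] t by simp
      then obtain j S where jS: "(j, S) \<in> T" "t = (\<delta> j, (\<lambda>i. i + n) ` S)"
        by (elim imageE) (auto split: prod.splits)
      \<comment> \<open>The basis vector of \<open>S\<close> in the summand \<open>j\<close>, whose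
        value under \<open>G\<close> is the required member.\<close>
      define x where "x = (\<lambda>k\<in>J'. if k = j then Poly_Mapping.single S (1 :: 'k ratfun ratfun) else 0)"
      have one: "(1 :: 'k ratfun ratfun) \<in> ratfuns ?F UNIV" by (rule shift_hom.R.one)
      have xD: "x \<in> carrier D"
        using jS(1) std_rep_zero_closed[OF F] std_rep_single_closed[OF F _ _ one]
        by (auto simp: carrier_D x_def T_def)
      have "G x = (\<Sum>k\<in>J'. if k = j then f j S else 0)"
        unfolding G_def
        by (rule sum.cong) (auto simp: x_def lin_comb_def shift_hom.subst_one)
      also have "\<dots> = \<beta> t" using jS finJ' by (simp add: T_def f_def)
      finally have "\<beta> t - G x \<in> A" using subspace_0[OF A(1)] by simp
      then show ?thesis using xD by blast
    qed
    ultimately have "B \<subseteq> ?P" unfolding J(2) by (intro span_minimal) auto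
    then show ?thesis using that by blast
  qed
  have "rep_iso ?F Q D"
  proof (rule rep_iso_inverse)
    show "(\<lambda>x. h (G x)) \<in> rep_hom ?F D Q"
      unfolding rep_hom_def
    proof (intro CollectI conjI ballI allI)
      show "(\<lambda>x. h (G x)) \<in> carrier D \<rightarrow> carrier Q" using GB h_surj by auto
      show "h (G (x \<oplus>\<^bsub>D\<^esub> y)) = h (G x) \<oplus>\<^bsub>Q\<^esub> h (G y)" if "x \<in> carrier D" "y \<in> carrier D" for x y
        using that by (simp add: G_add h_add GB)
      show "h (G (a \<odot>\<^bsub>D\<^esub> x)) = a \<odot>\<^bsub>Q\<^esub> h (G x)"
        if "a \<in> carrier (ratfun_field ?F)" "x \<in> carrier D" for a x
        using that by (simp add: G_smult h_smult GB)
      show "h (G (act D \<sigma> x)) = act Q \<sigma> (h (G x))" if x: "x \<in> carrier D" for \<sigma> x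
      proof -
        \<comment> \<open>Equality of values of \<open>h\<close> is controlled only on
          \<open>B\<close>; the moved vector lies there because it differs from a value of
          \<open>G\<close> by an element of \<open>A\<close>.\<close>
        have diff: "ac (shift_perm n \<sigma>) (G x) - G (act D \<sigma> x) \<in> A" by (rule G_act[OF x])
        then have "ac (shift_perm n \<sigma>) (G x) \<in> B"
          using subspace_diff_iff[OF B] AB GB[OF D_act[OF x]] by blast
        then have "h (ac (shift_perm n \<sigma>) (G x)) = h (G (act D \<sigma> x))"
          using h_eq GB[OF D_act[OF x]] diff by blast
        then show ?thesis using h_act[OF GB[OF x]] by simp
      qed
    qed
    show "bij_betw (\<lambda>x. h (G x)) (carrier D) (carrier Q)"
      unfolding bij_betw_def
    proof
      show "inj_on (\<lambda>x. h (G x)) (carrier D)"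
        using G_inj GB h_eq by (auto intro!: inj_onI)
      show "(\<lambda>x. h (G x)) ` carrier D = carrier Q"
      proof
        show "(\<lambda>x. h (G x)) ` carrier D \<subseteq> carrier Q" using GB h_surj by auto
        show "carrier Q \<subseteq> (\<lambda>x. h (G x)) ` carrier D"
        proof
          fix u assume "u \<in> carrier Q"
          then obtain v where v: "v \<in> B" "u = h v" using h_surj by blast
          obtain x where x: "x \<in> carrier D" "v - G x \<in> A" using G_surj[OF v(1)] by blast
          then have "u = h (G x)" using h_eq v GB by blast
          then show "u \<in> (\<lambda>x. h (G x)) ` carrier D" using x(1) by blast
        qed
      qed
    qed
  qed (fact D_closed D_smult D_act)+
  then show ?thesis unfolding D_def by blast
qed

end


section \<open>Presentation by a free vector space\<close>

text \<open>The carrier of \<open>M\<close> is a subset of a type. To apply the results on vector spaces that are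
  types, \<open>M\<close> is replaced by the vector space on all elements of \<open>'m\<close>; elements outside the
  carrier are sent to zero, and all subspaces contain the relations.\<close>

locale rep_presentation = smooth_semilinear_rep UNIV M
  for M :: "('k::field ratfun, 'm, 'z) semirep_scheme"
begin

text \<open>Acting trivially outside the carrier gives a group action on the whole type, as required
  for permuting the basis of the free vector space.\<close>

definition point_act :: "nat perm \<Rightarrow> 'm \<Rightarrow> 'm"
  where "point_act \<sigma> x = (if x \<in> carrier M then act M \<sigma> x else x)"

definition scaleP :: "'k ratfun \<Rightarrow> ('m \<Rightarrow>\<^sub>0 'k ratfun) \<Rightarrow> ('m \<Rightarrow>\<^sub>0 'k ratfun)"
  where "scaleP a = Poly_Mapping.map ((*) a)"

text \<open>The semilinear extension of \<open>point_act\<close>, with the coefficient at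
  \<open>y\<close> taken from the preimage of \<open>y\<close>. Its support is finite because it
  lies in the image of the support of \<open>p\<close>.\<close>

definition actP :: "nat perm \<Rightarrow> ('m \<Rightarrow>\<^sub>0 'k ratfun) \<Rightarrow> ('m \<Rightarrow>\<^sub>0 'k ratfun)"
  where "actP \<sigma> p =
    Abs_poly_mapping (\<lambda>y. perm_ratfun \<sigma> (Poly_Mapping.lookup p (point_act (inverse \<sigma>) y)))"

definition evalP :: "('m \<Rightarrow>\<^sub>0 'k ratfun) \<Rightarrow> 'm"
  where "evalP p = (\<Oplus>\<^bsub>M\<^esub>x\<in>Poly_Mapping.keys p \<inter> carrier M. Poly_Mapping.lookup p x \<odot>\<^bsub>M\<^esub> x)"

lemma scalar [simp]: "a \<in> carrier (ratfun_field (UNIV :: 'k set))"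
  by (simp add: ratfuns_UNIV)

lemmas smult_add = smult_l_distr[OF scalar scalar, unfolded ratfun_field_simps]
  and smult_smult = smult_assoc1[OF scalar scalar, unfolded ratfun_field_simps]
  and one_smult = smult_one[unfolded ratfun_field_simps]
  and zero_smult = smult_l_null[unfolded ratfun_field_simps]
  and smult_in = smult_closed[OF scalar]
  and smult_zero = smult_r_null[OF scalar]
  and smult_distr = smult_r_distr[OF scalar]
  and act_scale = act_smult[OF scalar]

lemma point_act_1: "point_act 1 x = x"
  by (simp add: point_act_def act_one)

lemma point_act_times: "point_act (\<sigma> * \<tau>) x = point_act \<sigma> (point_act \<tau> x)"
  by (simp add: point_act_def act_mult act_closed)

lemma point_act_inverse [simp]:
  "point_act \<sigma> (point_act (inverse \<sigma>) x) = x" "point_act (inverse \<sigma>) (point_act \<sigma> x) = x"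
  by (simp_all flip: point_act_times add: point_act_1)

lemma lookup_actP:
  "Poly_Mapping.lookup (actP \<sigma> p) y = perm_ratfun \<sigma> (Poly_Mapping.lookup p (point_act (inverse \<sigma>) y))"
proof -
  have "{y. perm_ratfun \<sigma> (Poly_Mapping.lookup p (point_act (inverse \<sigma>) y)) \<noteq> 0}
      \<subseteq> point_act \<sigma> ` Poly_Mapping.keys p"
  proof
    fix y assume "y \<in> {y. perm_ratfun \<sigma> (Poly_Mapping.lookup p (point_act (inverse \<sigma>) y)) \<noteq> 0}"
    then have "point_act (inverse \<sigma>) y \<in> Poly_Mapping.keys p"
      by (simp add: perm_ratfun_eq_0_iff in_keys_iff)
    then have "point_act \<sigma> (point_act (inverse \<sigma>) y) \<in> point_act \<sigma> ` Poly_Mapping.keys p" by (rule imageI)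
    then show "y \<in> point_act \<sigma> ` Poly_Mapping.keys p" by simp
  qed
  then have "finite {y. perm_ratfun \<sigma> (Poly_Mapping.lookup p (point_act (inverse \<sigma>) y)) \<noteq> 0}"
    by (rule finite_subset) simp
  then show ?thesis by (simp add: actP_def)
qed

lemma lookup_scaleP: "Poly_Mapping.lookup (scaleP a p) x = a * Poly_Mapping.lookup p x"
  by (simp add: scaleP_def lookup_map_mult)

lemma actP_single: "actP \<sigma> (Poly_Mapping.single x a) = Poly_Mapping.single (point_act \<sigma> x) (perm_ratfun \<sigma> a)"
proof (rule poly_mapping_eqI)
  fix y
  have "point_act (inverse \<sigma>) y = x \<longleftrightarrow> y = point_act \<sigma> x" by auto
  then show "Poly_Mapping.lookup (actP \<sigma> (Poly_Mapping.single x a)) y =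
      Poly_Mapping.lookup (Poly_Mapping.single (point_act \<sigma> x) (perm_ratfun \<sigma> a)) y"
    by (auto simp: lookup_actP lookup_single when_def perm_ratfun_zero)
qed

lemma scaleP_single: "scaleP a (Poly_Mapping.single x c) = Poly_Mapping.single x (a * c)"
  by (rule poly_mapping_eqI) (simp add: lookup_scaleP lookup_single when_def)

lemma actP_add: "actP \<sigma> (p + q) = actP \<sigma> p + actP \<sigma> q"
  by (rule poly_mapping_eqI) (simp add: lookup_actP lookup_add perm_ratfun_add)

lemma scaleP_add: "scaleP a (p + q) = scaleP a p + scaleP a q"
  by (rule poly_mapping_eqI) (simp add: lookup_scaleP lookup_add algebra_simps)

lemma evalP_superset:
  assumes "finite X" "Poly_Mapping.keys p \<inter> carrier M \<subseteq> X" "X \<subseteq> carrier M"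
  shows "evalP p = (\<Oplus>\<^bsub>M\<^esub>x\<in>X. Poly_Mapping.lookup p x \<odot>\<^bsub>M\<^esub> x)"
  unfolding evalP_def
  by (rule M.add.finprod_mono_neutral_cong_left)
    (use assms in \<open>auto simp: in_keys_iff zero_smult intro!: smult_in\<close>)

lemma evalP_closed: "evalP p \<in> carrier M"
  unfolding evalP_def by (rule M.finsum_closed) (auto intro: smult_in)

lemma evalP_add: "evalP (p + q) = evalP p \<oplus>\<^bsub>M\<^esub> evalP q"
proof -
  let ?X = "(Poly_Mapping.keys p \<union> Poly_Mapping.keys q) \<inter> carrier M"
  have "evalP (p + q) = (\<Oplus>\<^bsub>M\<^esub>x\<in>?X. Poly_Mapping.lookup (p + q) x \<odot>\<^bsub>M\<^esub> x)"
    by (rule evalP_superset) (use keys_add[of p q] in auto)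
  also have "\<dots> = (\<Oplus>\<^bsub>M\<^esub>x\<in>?X. Poly_Mapping.lookup p x \<odot>\<^bsub>M\<^esub> x \<oplus>\<^bsub>M\<^esub> Poly_Mapping.lookup q x \<odot>\<^bsub>M\<^esub> x)"
    by (rule M.finsum_cong') (auto simp: lookup_add smult_add intro!: smult_in)
  also have "\<dots> = (\<Oplus>\<^bsub>M\<^esub>x\<in>?X. Poly_Mapping.lookup p x \<odot>\<^bsub>M\<^esub> x) \<oplus>\<^bsub>M\<^esub>
      (\<Oplus>\<^bsub>M\<^esub>x\<in>?X. Poly_Mapping.lookup q x \<odot>\<^bsub>M\<^esub> x)"
    by (rule M.finsum_addf) (auto intro!: smult_in)
  also have "\<dots> = evalP p \<oplus>\<^bsub>M\<^esub> evalP q"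
    by (subst (1 2) evalP_superset[of ?X]) auto
  finally show ?thesis .
qed

lemma evalP_zero: "evalP 0 = \<zero>\<^bsub>M\<^esub>"
  by (simp add: evalP_def)

lemma evalP_single: "evalP (Poly_Mapping.single x a) = (if x \<in> carrier M then a \<odot>\<^bsub>M\<^esub> x else \<zero>\<^bsub>M\<^esub>)"
proof (cases "x \<in> carrier M")
  case True
  then have "evalP (Poly_Mapping.single x a) = (\<Oplus>\<^bsub>M\<^esub>y\<in>{x}. Poly_Mapping.lookup (Poly_Mapping.single x a) y \<odot>\<^bsub>M\<^esub> y)"
    by (intro evalP_superset) auto
  then show ?thesis using True by (simp add: M.finsum_insert smult_in)
next
  case False
  then have "Poly_Mapping.keys (Poly_Mapping.single x a) \<inter> carrier M = {}" by auto
  then show ?thesis using False by (simp add: evalP_def)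
qed

lemma act_zero: "act M \<sigma> \<zero>\<^bsub>M\<^esub> = \<zero>\<^bsub>M\<^esub>"
proof -
  have "act M \<sigma> \<zero>\<^bsub>M\<^esub> \<oplus>\<^bsub>M\<^esub> act M \<sigma> \<zero>\<^bsub>M\<^esub> = act M \<sigma> \<zero>\<^bsub>M\<^esub>"
    using act_add[of "\<zero>\<^bsub>M\<^esub>" "\<zero>\<^bsub>M\<^esub>" \<sigma>] by simp
  then show ?thesis using act_closed[of "\<zero>\<^bsub>M\<^esub>" \<sigma>] M.add.l_cancel_one by simp
qed

lemma evalP_scale: "evalP (scaleP a p) = a \<odot>\<^bsub>M\<^esub> evalP p"
proof (induction p rule: poly_mapping_single_add_induct)
  case 1
  have "scaleP a 0 = 0" by (rule poly_mapping_eqI) (simp add: lookup_scaleP)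
  then show ?case by (simp add: evalP_zero smult_zero)
next
  case (2 x c)
  show ?case by (simp add: scaleP_single evalP_single smult_smult smult_zero)
next
  case (3 p q)
  then show ?case by (simp add: scaleP_add evalP_add smult_distr evalP_closed)
qed

lemma evalP_act: "evalP (actP \<sigma> p) = act M \<sigma> (evalP p)"
proof (induction p rule: poly_mapping_single_add_induct)
  case 1
  have "actP \<sigma> 0 = 0" by (rule poly_mapping_eqI) (simp add: lookup_actP perm_ratfun_zero)
  then show ?case by (simp add: evalP_zero act_zero)
next
  case (2 x c)
  show ?case
    by (simp add: actP_single evalP_single act_zero point_act_def act_closed act_scale)
next
  case (3 p q)
  then show ?case by (simp add: actP_add evalP_add act_add evalP_closed)
qed

lemma evalP_diff: "evalP (p - q) = evalP p \<ominus>\<^bsub>M\<^esub> evalP q"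
proof -
  have "evalP p = evalP (p - q) \<oplus>\<^bsub>M\<^esub> evalP q" by (simp flip: evalP_add)
  then show ?thesis by (simp add: evalP_closed a_minus_def M.a_assoc M.r_neg)
qed

lemma evalP_basis: "x \<in> carrier M \<Longrightarrow> evalP (Poly_Mapping.single x 1) = x"
  by (simp add: evalP_single one_smult)

definition relations :: "('m \<Rightarrow>\<^sub>0 'k ratfun) set"
  where "relations = {p. evalP p = \<zero>\<^bsub>M\<^esub>}"

lemma diff_in_relations_iff: "p - q \<in> relations \<longleftrightarrow> evalP p = evalP q"
proof
  assume "p - q \<in> relations"
  moreover have "evalP p = evalP (p - q) \<oplus>\<^bsub>M\<^esub> evalP q" by (simp flip: evalP_add)
  ultimately show "evalP p = evalP q" by (simp add: relations_def evalP_closed)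
next
  assume "evalP p = evalP q"
  then show "p - q \<in> relations"
    by (simp add: relations_def evalP_diff a_minus_def M.r_neg evalP_closed)
qed

sublocale P: vector_space scaleP
  by unfold_locales
    (rule poly_mapping_eqI, simp add: lookup_scaleP lookup_add algebra_simps)+

sublocale P: semilinear scaleP actP relations
proof
  show "actP \<sigma> (scaleP a p) = scaleP (perm_ratfun \<sigma> a) (actP \<sigma> p)" for \<sigma> a p
    by (rule poly_mapping_eqI) (simp add: lookup_scaleP lookup_actP perm_ratfun_mult)
  show "actP 1 p = p" for p
    by (rule poly_mapping_eqI) (simp add: lookup_actP perm_ratfun_1 point_act_1)
  show "actP (\<sigma> * \<tau>) p = actP \<sigma> (actP \<tau> p)" for \<sigma> \<tau> p
    by (rule poly_mapping_eqI) (simp add: lookup_actP perm_ratfun_times point_act_times)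
  show "P.subspace relations"
    by (simp add: P.subspace_def relations_def evalP_zero evalP_add evalP_scale smult_zero)
  show "actP \<sigma> p \<in> relations" if "p \<in> relations" for \<sigma> p
    using that by (simp add: relations_def evalP_act act_zero)
qed (rule actP_add)

end

section \<open>From stable subspaces to subrepresentations of the shift\<close>

context rep_presentation
begin

lemma evalP_surj: "range evalP = carrier M"
  using evalP_closed evalP_basis by (auto simp: image_iff) metis

lemma shift_ops [simp]:
  "carrier (shift n M) = carrier M" "add (shift n M) = add M" "zero (shift n M) = zero M"
  "smult (shift n M) = (\<lambda>a x. shift_scalar n a \<odot>\<^bsub>M\<^esub> x)"
  "act (shift n M) = (\<lambda>\<sigma>. act M (shift_perm n \<sigma>))"
  by (simp_all add: shift_def)

abbreviation sub_shift :: "nat \<Rightarrow> ('m \<Rightarrow>\<^sub>0 'k ratfun) set \<Rightarrow> ('k ratfun ratfun, 'm) semirep"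
  where "sub_shift n B \<equiv> (shift n M)\<lparr>carrier := evalP ` B\<rparr>"

text \<open>A graded piece is a quotient taken inside the next member of the filtration, so the
  ambient object is the shift restricted to the image of \<open>C\<close>; \<open>C = UNIV\<close>
  recovers the whole shift. Stability under \<open>fix_below n\<close> is exactly what the shifted
  action requires.\<close>

lemma subrep_evalP_aux:
  assumes S: "smooth_semilinear_rep (ratfuns UNIV {..<n}) (sub_shift n C)"
    and A: "P.subspace A" "P.stable n A" "A \<subseteq> C"
  shows "subrep (ratfuns UNIV {..<n}) (evalP ` A) (sub_shift n C)"
proof -
  interpret S: smooth_semilinear_rep "ratfuns UNIV {..<n}" "sub_shift n C" by (rule S)
  \<comment> \<open>The additive inverse in a record depends on its carrier, so it is identified
    through uniqueness of inverses in the restricted record.\<close>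
  have minus: "\<ominus>\<^bsub>sub_shift n C\<^esub> evalP v = evalP (- v)" if v: "v \<in> A" for v
  proof (rule S.M.minus_equality)
    have "evalP (- v) \<oplus>\<^bsub>M\<^esub> evalP v = \<zero>\<^bsub>M\<^esub>" by (simp add: evalP_zero flip: evalP_add)
    then show "evalP (- v) \<oplus>\<^bsub>sub_shift n C\<^esub> evalP v = \<zero>\<^bsub>sub_shift n C\<^esub>" by simp
    show "evalP v \<in> carrier (sub_shift n C)" "evalP (- v) \<in> carrier (sub_shift n C)"
      using v P.subspace_neg[OF A(1)] A(3) by auto
  qed
  have "submodule (evalP ` A) (ratfun_field (ratfuns UNIV {..<n})) (sub_shift n C)"
  proof (rule S.submoduleI)
    show "evalP ` A \<subseteq> carrier (sub_shift n C)" using A(3) by auto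
    show "\<zero>\<^bsub>sub_shift n C\<^esub> \<in> evalP ` A"
      using P.subspace_0[OF A(1)] evalP_zero by (auto intro!: image_eqI[of _ _ 0])
    show "\<ominus>\<^bsub>sub_shift n C\<^esub> x \<in> evalP ` A" if "x \<in> evalP ` A" for x
      using that minus P.subspace_neg[OF A(1)] by auto
    show "x \<oplus>\<^bsub>sub_shift n C\<^esub> y \<in> evalP ` A" if "x \<in> evalP ` A" "y \<in> evalP ` A" for x y
      using that P.subspace_add[OF A(1)] by (auto simp flip: evalP_add)
    show "a \<odot>\<^bsub>sub_shift n C\<^esub> x \<in> evalP ` A"
      if "a \<in> carrier (ratfun_field (ratfuns UNIV {..<n}))" "x \<in> evalP ` A" for a x
      using that P.subspace_scale[OF A(1)] by (auto simp flip: evalP_scale)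
  qed
  moreover have "act (sub_shift n C) \<sigma> x \<in> evalP ` A" if "x \<in> evalP ` A" for \<sigma> x
    using that A(2) shift_perm_fix_below[of n \<sigma>] by (auto simp: P.stable_def simp flip: evalP_act)
  ultimately show ?thesis by (auto simp: subrep_def)
qed

lemma sub_shift_UNIV: "sub_shift n UNIV = shift n M"
  by (simp add: evalP_surj shift_def)

lemma subrep_evalP:
  assumes "P.subspace A" "P.stable n A"
  shows "subrep (ratfuns UNIV {..<n}) (evalP ` A) (shift n M)"
  using subrep_evalP_aux[of n UNIV A] assms smooth_semilinear_rep_shift[OF smooth_semilinear_rep_axioms]
  by (simp add: sub_shift_UNIV)

lemma smooth_sub_shift:
  assumes "P.subspace A" "P.stable n A"
  shows "smooth_semilinear_rep (ratfuns UNIV {..<n}) (sub_shift n A)"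
  by (rule smooth_semilinear_rep_subrep[OF smooth_semilinear_rep_shift[OF smooth_semilinear_rep_axioms]
        subrep_evalP[OF assms]])

lemma evalP_in_image_iff:
  assumes "P.subspace A" "relations \<subseteq> A"
  shows "evalP v \<in> evalP ` A \<longleftrightarrow> v \<in> A"
proof
  assume "evalP v \<in> evalP ` A"
  then obtain w where w: "w \<in> A" "evalP v = evalP w" by blast
  then have "v - w \<in> A" using assms(2) by (auto simp: diff_in_relations_iff[symmetric])
  then show "v \<in> A" using P.subspace_diff_iff[OF assms(1)] w(1) by blast
qed simp

text \<open>Since \<open>A\<close> contains the kernel \<open>relations\<close> of
  \<open>evalP\<close>, equality of cosets can be tested upstairs. This provides the kernel
  condition on \<open>h\<close> in \<open>std_step_rep_iso\<close>.\<close>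

lemma coset_evalP_eq_iff:
  assumes A: "P.subspace A" "P.stable n A" "relations \<subseteq> A" "A \<subseteq> B"
    and B: "P.subspace B" "P.stable n B" and vw: "v \<in> B" "w \<in> B"
  shows "evalP ` A +>\<^bsub>sub_shift n B\<^esub> evalP v = evalP ` A +>\<^bsub>sub_shift n B\<^esub> evalP w \<longleftrightarrow> v - w \<in> A"
proof -
  note S = smooth_sub_shift[OF B]
  interpret S: smooth_semilinear_rep "ratfuns UNIV {..<n}" "sub_shift n B" by (rule S)
  have C: "evalP v \<in> carrier (sub_shift n B)" "evalP w \<in> carrier (sub_shift n B)"
    "evalP (v - w) \<in> carrier (sub_shift n B)"
    using vw P.subspace_diff[OF B(1)] by auto
  have "evalP v = evalP (v - w) \<oplus>\<^bsub>M\<^esub> evalP w" by (simp flip: evalP_add)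
  then have "evalP v = evalP (v - w) \<oplus>\<^bsub>sub_shift n B\<^esub> evalP w" by simp
  then have "evalP v \<ominus>\<^bsub>sub_shift n B\<^esub> evalP w = evalP (v - w)"
    using C by (metis S.M.a_assoc S.M.a_inv_closed S.M.r_neg S.M.r_zero a_minus_def)
  then show ?thesis
    using coset_eq_iff[OF subring_coeff S subrep_evalP_aux[OF S A(1,2,4)] C(1,2)]
      evalP_in_image_iff[OF A(1,3)] by simp
qed

end

theorem theorem3p4:
  fixes M :: "('k::field ratfun, 'm) semirep"
  assumes "smooth_semilinear_rep UNIV M"
    and "finitely_generated UNIV M"
  shows "\<exists>n. semi_standard (ratfuns UNIV {..<n}) (shift n M)"
proof -
  interpret smooth_semilinear_rep UNIV M by (rule assms(1))
  interpret rep_presentation M ..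
  obtain X where X: "finite X" "X \<subseteq> carrier M" "carrier M = K_span UNIV M {act M \<sigma> x | \<sigma> x. x \<in> X}"
    using assms(2) by (auto simp: finitely_generated_def)
  have "\<forall>x\<in>X. \<exists>m. \<forall>\<sigma>. (\<forall>i<m. \<sigma> \<langle>$\<rangle> i = i) \<longrightarrow> act M \<sigma> x = x"
    using X(2) smooth by blast
  from bchoice[OF this] obtain lv where
    lv: "\<And>x \<sigma>. x \<in> X \<Longrightarrow> (\<forall>i<lv x. \<sigma> \<langle>$\<rangle> i = i) \<Longrightarrow> act M \<sigma> x = x" by blast
  \<comment> \<open>The sum is a convenient common upper bound for the smoothness levels of the
    generators.\<close>
  define d where "d = sum lv X"
  have d: "act M \<sigma> x = x" if "x \<in> X" "\<sigma> \<in> fix_below d" for x \<sigma>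
  proof -
    have "lv x \<le> d" unfolding d_def by (rule member_le_sum) (use that X(1) in auto)
    then show ?thesis using that by (intro lv) (auto simp: fix_below_def)
  qed
  define E where "E = (\<lambda>x. Poly_Mapping.single x (1 :: 'k ratfun)) ` X"
  interpret G: generated_semilinear scaleP actP relations d E
  proof
    show "finite E" using X(1) by (simp add: E_def)
    show "actP \<sigma> e - e \<in> relations" if "e \<in> E" "\<sigma> \<in> fix_below d" for e \<sigma>
      using that X(2) d by (auto simp: E_def diff_in_relations_iff evalP_act evalP_basis)
    \<comment> \<open>The image of \<open>?U\<close> in \<open>M\<close> is a submodule containing
      all translates of generators, hence all of \<open>M\<close>. As \<open>?U\<close> also
      contains the kernel of \<open>evalP\<close>, it is the whole free space.\<close>
    let ?U = "P.span (relations \<union> {actP \<sigma> e |\<sigma> e. e \<in> E})"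
    have "submodule (evalP ` ?U) (ratfun_field UNIV) M"
    proof (rule submoduleI)
      show "evalP ` ?U \<subseteq> carrier M" using evalP_closed by blast
      show "\<zero>\<^bsub>M\<^esub> \<in> evalP ` ?U"
        by (rule image_eqI[of _ _ 0]) (simp_all add: evalP_zero P.span_zero)
      show "\<ominus>\<^bsub>M\<^esub> x \<in> evalP ` ?U" if x: "x \<in> evalP ` ?U" for x
      proof -
        obtain v where v: "v \<in> ?U" "x = evalP v" using x by blast
        have "\<ominus>\<^bsub>M\<^esub> x = evalP (0 - v)"
          using v(2) by (simp only: evalP_diff evalP_zero) (simp add: a_minus_def evalP_closed)
        then show ?thesis using P.span_diff[OF P.span_zero v(1)] by blast
      qed
      show "x \<oplus>\<^bsub>M\<^esub> y \<in> evalP ` ?U" if "x \<in> evalP ` ?U" "y \<in> evalP ` ?U" for x y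
        using that P.span_add by (auto simp flip: evalP_add)
      show "a \<odot>\<^bsub>M\<^esub> x \<in> evalP ` ?U" if "x \<in> evalP ` ?U" for a x
        using that P.span_scale by (auto simp flip: evalP_scale)
    qed
    moreover have "act M \<sigma> x \<in> evalP ` ?U" if "x \<in> X" for \<sigma> x
    proof (rule image_eqI)
      show "act M \<sigma> x = evalP (actP \<sigma> (Poly_Mapping.single x 1))"
        using that X(2) by (simp add: evalP_act evalP_basis subset_iff)
      show "actP \<sigma> (Poly_Mapping.single x 1) \<in> ?U"
        using that by (intro P.span_base) (auto simp: E_def)
    qed
    ultimately have "carrier M \<subseteq> evalP ` ?U"
      unfolding X(3) K_span_def by auto
    moreover have "relations \<subseteq> ?U" using P.span_superset by blast
    ultimately have "p \<in> ?U" for p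
      using evalP_in_image_iff[OF P.subspace_span] evalP_closed by blast
    then show "?U = UNIV" by blast
  qed
  obtain n where n: "G.filtered n UNIV" using G.ex_filtered_UNIV by blast
  obtain s :: nat and N where N: "N 0 = relations" "N s = UNIV" "\<forall>i\<le>s. G.filtered n (N i)"
    "\<forall>i<s. G.std_step n (N i) (N (Suc i))"
    using G.filtered_sequence[OF n] by blast
  let ?F = "ratfuns (UNIV :: 'k set) {..<n}"
  have props: "P.subspace (N i)" "relations \<subseteq> N i" "P.stable n (N i)" if "i \<le> s" for i
    using G.filtered_properties[OF N(3)[rule_format, OF that]] by blast+
  have "standard ?F (quot_rep (sub_shift n (N (Suc i))) (evalP ` N i))" if i: "i < s" for i
  proof -
    let ?A = "N i" and ?B = "N (Suc i)" and ?S = "sub_shift n (N (Suc i))"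
    have A: "P.subspace ?A" "P.stable n ?A" "relations \<subseteq> ?A" using props[of i] i by auto
    have B: "P.subspace ?B" "P.stable n ?B" using props[of "Suc i"] i by auto
    have step: "G.std_step n ?A ?B" using N(4) i by blast
    then have AB: "?A \<subseteq> ?B" by (auto simp: G.std_step_def intro: P.span_base)
    note S = smooth_sub_shift[OF B]
    note sub = subrep_evalP_aux[OF S A(1,2) AB]
    have C: "evalP v \<in> carrier ?S" if "v \<in> ?B" for v using that by simp
    define h where "h v = evalP ` ?A +>\<^bsub>?S\<^esub> evalP v" for v
    \<comment> \<open>Elements of the graded piece are cosets, so the index set of the direct sum
      consists of cosets as well.\<close>
    have "\<exists>(J :: 'm set set) r. rep_iso ?F (quot_rep ?S (evalP ` ?A)) (direct_sum J (\<lambda>j. std_rep ?F (r j)))"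
    proof (rule G.std_step_rep_iso[OF step A(1,3)])
      show "h ` ?B = carrier (quot_rep ?S (evalP ` ?A))"
        using quot_rep_carrier[OF subring_coeff S sub] by (simp add: h_def[abs_def] image_image)
      show "h v = h w \<longleftrightarrow> v - w \<in> ?A" if "v \<in> ?B" "w \<in> ?B" for v w
        unfolding h_def by (rule coset_evalP_eq_iff[OF A AB B that])
      show "h (v + w) = h v \<oplus>\<^bsub>quot_rep ?S (evalP ` ?A)\<^esub> h w" if "v \<in> ?B" "w \<in> ?B" for v w
        using quot_rep_add[OF subring_coeff S sub C[OF that(1)] C[OF that(2)]]
        by (simp add: h_def evalP_add)
      show "h (scaleP (shift_scalar n a) v) = a \<odot>\<^bsub>quot_rep ?S (evalP ` ?A)\<^esub> h v"
        if "a \<in> ratfuns ?F UNIV" "v \<in> ?B" for a v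
        using quot_rep_smult[OF subring_coeff S sub that(1) C[OF that(2)]]
        by (simp add: h_def evalP_scale)
      show "h (actP (shift_perm n \<sigma>) v) = act (quot_rep ?S (evalP ` ?A)) \<sigma> (h v)" if "v \<in> ?B" for \<sigma> v
        using quot_rep_act[OF subring_coeff S sub C[OF that], of \<sigma>]
        by (simp add: h_def evalP_act)
    qed
    then show ?thesis
      unfolding standard_def using smooth_semilinear_rep_quot[OF subring_coeff S sub] by blast
  qed
  moreover have "evalP ` N i \<subseteq> evalP ` N (Suc i)" if "i < s" for i
    using N(4) that by (intro image_mono) (auto simp: G.std_step_def intro: P.span_base)
  moreover have "subrep ?F (evalP ` N i) (shift n M)" if "i \<le> s" for i
    by (rule subrep_evalP) (use props[OF that] in auto)
  moreover have "evalP ` N 0 = {\<zero>\<^bsub>shift n M\<^esub>}"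
    using evalP_zero by (auto simp: N(1) relations_def intro!: image_eqI[of _ _ 0])
  moreover have "evalP ` N s = carrier (shift n M)"
    by (simp add: N(2) evalP_surj)
  ultimately have "semi_standard ?F (shift n M)"
    unfolding semi_standard_def using smooth_semilinear_rep_shift[OF assms(1)]
    by (intro conjI exI[of _ s] exI[of _ "\<lambda>i. evalP ` N i"]) auto
  then show ?thesis by blast
qed

end
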